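(* Let $\mu\in\mathcal P$ and let $p(\mu)\in H^1_0(\Omega)$ be the weak solution for the parameter $\mu$, i.e. $b(p(\mu),q;\mu)=\int_\Omega f q\,dx$ for all $q\in H^1_0(\Omega)$. Let $s\in H^1_0(\Omega)$ and $p_h\in H^1(\tau_h)$ be arbitrary, and let $v\in H_{\rm div}(\Omega)$ fulfill the local conservation property $(\nabla\cdot v,1)_{L^2(T)}=(f,1)_{L^2(T)}$ for all $T\in\mathcal T_H$. For each $T\in\mathcal T_H$ let $C_P^T>0$ be a constant for which the Poincaré inequality $$\|\varphi-\Pi_0^T\varphi\|_{L^2(T)}^2\le C_P^T h_T^2\|\nabla\varphi\|_{L^2(T)}^2\qquad\text{for all }\varphi\in H^1(T)$$ holds, where $\Pi_0^T$ is the $L^2(T)$-orthogonal projection onto the constants on $T$. Then for arbitrary $\overline\mu,\hat\mu\in\mathcal P$, $$ \begin{aligned} |||p(\mu)-p_h|||_{\overline\mu}\le\frac{1}{\sqrt{\alpha(\mu,\overline\mu)}}\Bigg[&\sqrt{\gamma(\mu,\overline\mu)}\Big(\sum_{T\in\mathcal T_H}\tilde\eta_{\rm nc}^T(p_h,s;\overline\mu)^2\Big)^{1/2}+\Big(\sum_{T\in\mathcal T_H}\tilde\eta_{\rm r}^T(v)^2\Big)^{1/2}\\ &+\frac{1}{\sqrt{\alpha(\mu,\hat\mu)}}\Big(\sum_{T\in\mathcal T_H}\tilde\eta_{\rm df}^T(p_h,v;\hat\mu)^2\Big)^{1/2}\Bigg], \end{aligned} $$ where, for each $T\in\mathcal T_H$,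 $$\tilde\eta_{\rm nc}^T(p_h,s;\overline\mu):=|||p_h-s|||_{\overline\mu,T},\qquad \tilde\eta_{\rm r}^T(v):=\big(C_P^T/c_\varepsilon^T\big)^{1/2}h_T\,\|f-\nabla\cdot v\|_{L^2(T)},$$ $$\tilde\eta_{\rm df}^T(p_h,v;\hat\mu):=\big\|(\lambda(\hat\mu)\kappa_\varepsilon)^{-1/2}\big(\lambda(\mu)\kappa_\varepsilon\nabla_h p_h+v\big)\big\|_{L^2(T)}.$$
   Context: Setting. $\Omega\subset\mathbb R^d$, $d\in\{2,3\}$, is a bounded connected domain with polygonal boundary; $\tau_h$ is a shape-regular simplicial triangulation of $\Omega$ without hanging nodes. $\mathcal T_H$ is a coarse partition of $\Omega$ such that each coarse element $T\in\mathcal T_H$ is (up to null sets) the union of the fine elements in a subset $\tau_h^T\subset\tau_h$, the $\tau_h^T$ partitioning $\tau_h$; $h_T$ is the diameter of $T$. $\mathcal P\subset\mathbb R^p$ ($p\in\mathbb N$) is the set of parameters. Data. $f\in L^2(\Omega)$ is bounded; $\lambda(\mu)\in L^\infty(\Omega)$ is strictly positive for every $\mu\in\mathcal P$; $\kappa_\varepsilon\in[L^\infty(\Omega)]^{d\times d}$ is symmetric, uniformly positive definite, and constant on each $t\in\tau_h$; for each $\mu\in\mathcal P$, $\lambda(\mu)\kappa_\varepsilon$ is bounded from above and bounded from below away from $0$. For $t\in\tau_h$ let $c_\varepsilon^t(\mu)>0$ be the smallest eigenvalue of $(\lambda(\mu)\kappa_\varepsilon)|_t$ (the essential infimum over $x\in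 t$ of the smallest eigenvalue of $\lambda(x;\mu)\kappa_\varepsilon(x)$), let $c_\varepsilon^t:=\min_{\mu\in\mathcal P}c_\varepsilon^t(\mu)$, assumed to satisfy $c_\varepsilon^t>0$, and for $T\in\mathcal T_H$ let $c_\varepsilon^T:=\min_{t\in\tau_h^T}c_\varepsilon^t$. Parameter dependence. $\lambda(x;\mu)=\sum_{\xi=1}^{\Xi}\theta_\xi(\mu)\lambda_\xi(x)$ with $\Xi\in\mathbb N$, strictly positive coefficients $\theta_\xi:\mathcal P\to\mathbb R$ and $\lambda_\xi\in L^\infty(\Omega)$. For $\mu,\overline\mu\in\mathcal P$ set $$\alpha(\mu,\overline\mu):=\min_{1\le\xi\le\Xi}\theta_\xi(\mu)\theta_\xi(\overline\mu)^{-1},\qquad \gamma(\mu,\overline\mu):=\max_{1\le\xi\le\Xi}\theta_\xi(\mu)\theta_\xi(\overline\mu)^{-1}.$$ It is a standing assumption that $\alpha(\mu,\overline\mu)\lambda(\overline\mu)\le\lambda(\mu)\le\gamma(\mu,\overline\mu)\lambda(\overline\mu)$ almost everywhere in $\Omega$ for all $\mu,\overline\mu\in\mathcal P$. Notation. $H^1(\tau_h):=\{q\in L^2(\Omega): q|_t\in H^1(t)\ \forall t\in\tau_h\}$; $\nabla_h$ is the broken gradient, $(\nabla_h q)|_t:=\nabla(q|_t)$. $H_{\rm div}(\Omega)$ is the space of $v\in[L^2(\Omega)]^d$ with $\nabla\cdot v\in L^2(\Omega)$. For $p,q\in H^1(\tau_h)$, $\mu\in\mathcal P$, $T\in\mathcal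 T_H$: $b^T(p,q;\mu):=\int_T(\lambda(\mu)\kappa_\varepsilon\nabla_h p)\cdot\nabla_h q\,dx$, $b:=\sum_{T\in\mathcal T_H}b^T$, $|||q|||_{\mu,T}:=b^T(q,q;\mu)^{1/2}$ and $|||q|||_\mu:=\big(\sum_{T\in\mathcal T_H}|||q|||_{\mu,T}^2\big)^{1/2}$. *)

theory Defs
  imports "HOL-Analysis.Analysis"
begin

section \<open>Lebesgue spaces\<close>

text \<open>Functions are total on \<^typ>\<open>real^'d\<close>; only their values on the set at hand matter, and
  they represent classes modulo equality almost everywhere.\<close>

definition L2 :: "(real^'d) set \<Rightarrow> (real^'d \<Rightarrow> 'b::euclidean_space) set" where
  "L2 A = {u. u \<in> borel_measurable (lebesgue_on A) \<and>
              integrable (lebesgue_on A) (\<lambda>x. (norm (u x))\<^sup>2)}"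

definition L2_inner :: "(real^'d) set \<Rightarrow> (real^'d \<Rightarrow> 'b::euclidean_space) \<Rightarrow> (real^'d \<Rightarrow> 'b) \<Rightarrow> real" where
  "L2_inner A u w = (\<integral>x. u x \<bullet> w x \<partial>lebesgue_on A)"

definition L2_norm :: "(real^'d) set \<Rightarrow> (real^'d \<Rightarrow> 'b::euclidean_space) \<Rightarrow> real" where
  "L2_norm A u = sqrt (\<integral>x. (norm (u x))\<^sup>2 \<partial>lebesgue_on A)"

definition Linf :: "(real^'d) set \<Rightarrow> (real^'d \<Rightarrow> 'b::euclidean_space) set" where
  "Linf A = {u. u \<in> borel_measurable (lebesgue_on A) \<and>
                (\<exists>C. AE x in lebesgue_on A. norm (u x) \<le> C)}"

text \<open>Only meaningful when \<^term>\<open>g\<close> is essentially bounded below and above on a nontrivial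
  measure space; otherwise the supremum on \<^typ>\<open>real\<close> is unspecified.\<close>

definition essinf :: "'a measure \<Rightarrow> ('a \<Rightarrow> real) \<Rightarrow> real" where
  "essinf M g = Sup {c. AE x in M. c \<le> g x}"


section \<open>Weak derivatives and Sobolev spaces\<close>

definition grad :: "(real^'d \<Rightarrow> real) \<Rightarrow> real^'d \<Rightarrow> real^'d" where
  "grad \<phi> x = (\<chi> i. frechet_derivative \<phi> (at x) (axis i 1))"

primrec Ck :: "nat \<Rightarrow> (real^'d \<Rightarrow> real) \<Rightarrow> bool" where
  "Ck 0 \<phi> \<longleftrightarrow> continuous_on UNIV \<phi>"
| "Ck (Suc k) \<phi> \<longleftrightarrow> (\<forall>x. \<phi> differentiable at x) \<and> (\<forall>i. Ck k (\<lambda>x. grad \<phi> x $ i))"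

definition test_functions :: "(real^'d) set \<Rightarrow> (real^'d \<Rightarrow> real) set" where
  "test_functions A = {\<phi>. (\<forall>k. Ck k \<phi>) \<and> compact (closure {x. \<phi> x \<noteq> 0}) \<and>
                           closure {x. \<phi> x \<noteq> 0} \<subseteq> A}"

definition is_weak_gradient ::
  "(real^'d) set \<Rightarrow> (real^'d \<Rightarrow> real) \<Rightarrow> (real^'d \<Rightarrow> real^'d) \<Rightarrow> bool" where
  "is_weak_gradient A u g \<longleftrightarrow> g \<in> L2 A \<and>
     (\<forall>\<phi>\<in>test_functions A. \<forall>i.
        (\<integral>x. u x * grad \<phi> x $ i \<partial>lebesgue_on A) = - (\<integral>x. g x $ i * \<phi> x \<partial>lebesgue_on A))"

text \<open>The set \<^term>\<open>A\<close> is always an open set below; the weak gradient and the weak divergence are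
  unique up to null sets.\<close>

definition H1 :: "(real^'d) set \<Rightarrow> (real^'d \<Rightarrow> real) set" where
  "H1 A = {u \<in> L2 A. \<exists>g. is_weak_gradient A u g}"

definition weak_grad :: "(real^'d) set \<Rightarrow> (real^'d \<Rightarrow> real) \<Rightarrow> real^'d \<Rightarrow> real^'d" where
  "weak_grad A u = (SOME g. is_weak_gradient A u g)"

definition H1_norm :: "(real^'d) set \<Rightarrow> (real^'d \<Rightarrow> real) \<Rightarrow> real" where
  "H1_norm A u = sqrt ((L2_norm A u)\<^sup>2 + (L2_norm A (weak_grad A u))\<^sup>2)"

text \<open>The closure of the test functions in the \<open>H1\<close> norm.\<close>

definition H10 :: "(real^'d) set \<Rightarrow> (real^'d \<Rightarrow> real) set" where
  "H10 A = {u \<in> H1 A. \<forall>e>0. \<exists>\<phi>\<in>test_functions A. H1_norm A (\<lambda>x. u x - \<phi> x) < e}"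

definition is_weak_divergence ::
  "(real^'d) set \<Rightarrow> (real^'d \<Rightarrow> real^'d) \<Rightarrow> (real^'d \<Rightarrow> real) \<Rightarrow> bool" where
  "is_weak_divergence A v w \<longleftrightarrow> w \<in> L2 A \<and>
     (\<forall>\<phi>\<in>test_functions A. L2_inner A v (grad \<phi>) = - L2_inner A w \<phi>)"

definition Hdiv :: "(real^'d) set \<Rightarrow> (real^'d \<Rightarrow> real^'d) set" where
  "Hdiv A = {v \<in> L2 A. \<exists>w. is_weak_divergence A v w}"

definition weak_div :: "(real^'d) set \<Rightarrow> (real^'d \<Rightarrow> real^'d) \<Rightarrow> real^'d \<Rightarrow> real" where
  "weak_div A v = (SOME w. is_weak_divergence A v w)"


section \<open>Domain, fine triangulation, coarse partition\<close>

definition polygonal_domain :: "(real^'d) set \<Rightarrow> bool" where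
  "polygonal_domain \<Omega> \<longleftrightarrow> open \<Omega> \<and> \<Omega> \<noteq> {} \<and> connected \<Omega> \<and> bounded \<Omega> \<and>
     (\<exists>F. finite F \<and> (\<forall>K\<in>F. polytope K \<and> aff_dim K = int CARD('d) - 1) \<and> frontier \<Omega> = \<Union>F)"

text \<open>Fine elements are closed simplices of full dimension. \<^const>\<open>triangulation\<close> says that any two of
  them meet in a common face, i.e. there are no hanging nodes. The condition on interiors excludes
  elements crossing the boundary, which matters when \<open>\<Omega>\<close> lies on both sides of its boundary.\<close>

definition fine_triangulation :: "(real^'d) set \<Rightarrow> (real^'d) set set \<Rightarrow> bool" where
  "fine_triangulation \<Omega> \<tau> \<longleftrightarrow> triangulation \<tau> \<and> (\<forall>t\<in>\<tau>. int CARD('d) simplex t \<and> interior t \<subseteq> \<Omega>) \<and>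
     \<Union>\<tau> = closure \<Omega>"

definition inradius :: "(real^'d) set \<Rightarrow> real" where
  "inradius t = Sup {r. \<exists>x. cball x r \<subseteq> t}"

definition shape_regular :: "real \<Rightarrow> (real^'d) set set \<Rightarrow> bool" where
  "shape_regular \<sigma> \<tau> \<longleftrightarrow> (\<forall>t\<in>\<tau>. diameter t \<le> \<sigma> * inradius t)"

text \<open>\<^term>\<open>sub T\<close> is the set of fine elements making up the coarse element \<^term>\<open>T\<close>. Coarse elements are
  open, so that \<^term>\<open>H1 T\<close> makes sense.\<close>

definition coarse_partition ::
  "(real^'d) set \<Rightarrow> (real^'d) set set \<Rightarrow> (real^'d) set set \<Rightarrow> ((real^'d) set \<Rightarrow> (real^'d) set set) \<Rightarrow> bool" where
  "coarse_partition \<Omega> \<tau> \<T> sub \<longleftrightarrow>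
     (\<forall>T\<in>\<T>. open T \<and> T \<subseteq> \<Omega> \<and> sub T \<noteq> {} \<and> negligible (sym_diff T (\<Union>(sub T)))) \<and>
     \<Union>(sub ` \<T>) = \<tau> \<and> disjoint_family_on sub \<T>"

text \<open>The constant on \<^term>\<open>T\<close> whose difference to \<open>\<phi>\<close> is orthogonal in \<open>L2\<close> to all constants.\<close>

definition proj_const :: "(real^'d) set \<Rightarrow> (real^'d \<Rightarrow> real) \<Rightarrow> real" where
  "proj_const T \<phi> = (THE c. \<forall>k. L2_inner T (\<lambda>x. \<phi> x - c) (\<lambda>_. k) = 0)"

definition poincare_constant :: "(real^'d) set \<Rightarrow> real \<Rightarrow> bool" where
  "poincare_constant T C \<longleftrightarrow> 0 < C \<and>
     (\<forall>\<phi>\<in>H1 T. (L2_norm T (\<lambda>x. \<phi> x - proj_const T \<phi>))\<^sup>2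
                 \<le> C * (diameter T)\<^sup>2 * (L2_norm T (weak_grad T \<phi>))\<^sup>2)"

definition broken_H1 :: "(real^'d) set \<Rightarrow> (real^'d) set set \<Rightarrow> (real^'d \<Rightarrow> real) set" where
  "broken_H1 \<Omega> \<tau> = {q \<in> L2 \<Omega>. \<forall>t\<in>\<tau>. q \<in> H1 (interior t)}"

text \<open>The interiors of the fine elements are disjoint, so at most one summand is nonzero. The value on
  the skeleton, a null set, is zero.\<close>

definition broken_grad :: "(real^'d) set set \<Rightarrow> (real^'d \<Rightarrow> real) \<Rightarrow> real^'d \<Rightarrow> real^'d" where
  "broken_grad \<tau> q x = (\<Sum>t\<in>\<tau>. indicator (interior t) x *\<^sub>R weak_grad (interior t) q x)"


section \<open>Matrices\<close>

definition symmetric_matrix :: "real^'d^'d \<Rightarrow> bool" where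
  "symmetric_matrix A \<longleftrightarrow> transpose A = A"

definition eigenvalue :: "real^'d^'d \<Rightarrow> real \<Rightarrow> bool" where
  "eigenvalue A e \<longleftrightarrow> (\<exists>x. x \<noteq> 0 \<and> A *v x = e *\<^sub>R x)"

definition smallest_eigenvalue :: "real^'d^'d \<Rightarrow> real" where
  "smallest_eigenvalue A = (LEAST e. eigenvalue A e)"

text \<open>For a symmetric positive definite matrix the root is unique.\<close>

definition matrix_sqrt :: "real^'d^'d \<Rightarrow> real^'d^'d" where
  "matrix_sqrt A = (SOME B. symmetric_matrix B \<and> (\<forall>x. x \<noteq> 0 \<longrightarrow> 0 < x \<bullet> (B *v x)) \<and> B ** B = A)"

definition matrix_inv_sqrt :: "real^'d^'d \<Rightarrow> real^'d^'d" where
  "matrix_inv_sqrt A = matrix_inv (matrix_sqrt A)"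


section \<open>Bilinear form, energy norms, ellipticity constants\<close>

text \<open>\<open>\<mu>\<close> and \<open>\<nu>\<close> are parameters, \<open>lam \<mu>\<close> and \<open>\<kappa>\<close> the factors of the diffusion tensor.\<close>

definition b_loc ::
  "(real^'d) set set \<Rightarrow> ('m \<Rightarrow> real^'d \<Rightarrow> real) \<Rightarrow> (real^'d \<Rightarrow> real^'d^'d) \<Rightarrow> (real^'d) set \<Rightarrow>
   (real^'d \<Rightarrow> real) \<Rightarrow> (real^'d \<Rightarrow> real) \<Rightarrow> 'm \<Rightarrow> real" where
  "b_loc \<tau> lam \<kappa> T p q \<mu> =
     (\<integral>x. ((lam \<mu> x *\<^sub>R \<kappa> x) *v broken_grad \<tau> p x) \<bullet> broken_grad \<tau> q x \<partial>lebesgue_on T)"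

definition b_form ::
  "(real^'d) set set \<Rightarrow> (real^'d) set set \<Rightarrow> ('m \<Rightarrow> real^'d \<Rightarrow> real) \<Rightarrow> (real^'d \<Rightarrow> real^'d^'d) \<Rightarrow>
   (real^'d \<Rightarrow> real) \<Rightarrow> (real^'d \<Rightarrow> real) \<Rightarrow> 'm \<Rightarrow> real" where
  "b_form \<tau> \<T> lam \<kappa> p q \<mu> = (\<Sum>T\<in>\<T>. b_loc \<tau> lam \<kappa> T p q \<mu>)"

definition energy_norm_loc ::
  "(real^'d) set set \<Rightarrow> ('m \<Rightarrow> real^'d \<Rightarrow> real) \<Rightarrow> (real^'d \<Rightarrow> real^'d^'d) \<Rightarrow> 'm \<Rightarrow> (real^'d) set \<Rightarrow>
   (real^'d \<Rightarrow> real) \<Rightarrow> real" where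
  "energy_norm_loc \<tau> lam \<kappa> \<mu> T q = sqrt (b_loc \<tau> lam \<kappa> T q q \<mu>)"

definition energy_norm ::
  "(real^'d) set set \<Rightarrow> (real^'d) set set \<Rightarrow> ('m \<Rightarrow> real^'d \<Rightarrow> real) \<Rightarrow> (real^'d \<Rightarrow> real^'d^'d) \<Rightarrow> 'm \<Rightarrow>
   (real^'d \<Rightarrow> real) \<Rightarrow> real" where
  "energy_norm \<tau> \<T> lam \<kappa> \<mu> q = sqrt (\<Sum>T\<in>\<T>. (energy_norm_loc \<tau> lam \<kappa> \<mu> T q)\<^sup>2)"

definition c_fine_param ::
  "('m \<Rightarrow> real^'d \<Rightarrow> real) \<Rightarrow> (real^'d \<Rightarrow> real^'d^'d) \<Rightarrow> (real^'d) set \<Rightarrow> 'm \<Rightarrow> real" where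
  "c_fine_param lam \<kappa> t \<mu> = essinf (lebesgue_on t) (\<lambda>x. smallest_eigenvalue (lam \<mu> x *\<^sub>R \<kappa> x))"

text \<open>The minimum over the parameter set, read as an infimum since the set may be infinite.\<close>

definition c_fine ::
  "'m set \<Rightarrow> ('m \<Rightarrow> real^'d \<Rightarrow> real) \<Rightarrow> (real^'d \<Rightarrow> real^'d^'d) \<Rightarrow> (real^'d) set \<Rightarrow> real" where
  "c_fine \<P> lam \<kappa> t = (INF \<mu>\<in>\<P>. c_fine_param lam \<kappa> t \<mu>)"

definition c_coarse ::
  "'m set \<Rightarrow> ('m \<Rightarrow> real^'d \<Rightarrow> real) \<Rightarrow> (real^'d \<Rightarrow> real^'d^'d) \<Rightarrow>
   ((real^'d) set \<Rightarrow> (real^'d) set set) \<Rightarrow> (real^'d) set \<Rightarrow> real" where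
  "c_coarse \<P> lam \<kappa> sub T = Min (c_fine \<P> lam \<kappa> ` sub T)"

definition coeff_alpha :: "nat \<Rightarrow> (nat \<Rightarrow> 'm \<Rightarrow> real) \<Rightarrow> 'm \<Rightarrow> 'm \<Rightarrow> real" where
  "coeff_alpha \<Xi> \<theta> \<mu> \<nu> = Min ((\<lambda>\<xi>. \<theta> \<xi> \<mu> * inverse (\<theta> \<xi> \<nu>)) ` {1..\<Xi>})"

definition coeff_gamma :: "nat \<Rightarrow> (nat \<Rightarrow> 'm \<Rightarrow> real) \<Rightarrow> 'm \<Rightarrow> 'm \<Rightarrow> real" where
  "coeff_gamma \<Xi> \<theta> \<mu> \<nu> = Max ((\<lambda>\<xi>. \<theta> \<xi> \<mu> * inverse (\<theta> \<xi> \<nu>)) ` {1..\<Xi>})"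


section \<open>Estimators\<close>

definition eta_nc ::
  "(real^'d) set set \<Rightarrow> ('m \<Rightarrow> real^'d \<Rightarrow> real) \<Rightarrow> (real^'d \<Rightarrow> real^'d^'d) \<Rightarrow> (real^'d) set \<Rightarrow>
   (real^'d \<Rightarrow> real) \<Rightarrow> (real^'d \<Rightarrow> real) \<Rightarrow> 'm \<Rightarrow> real" where
  "eta_nc \<tau> lam \<kappa> T p\<^sub>h s \<nu> = energy_norm_loc \<tau> lam \<kappa> \<nu> T (\<lambda>x. p\<^sub>h x - s x)"

text \<open>\<open>C\<close> is the Poincare constant of \<open>T\<close> and \<open>c\<close> the ellipticity constant of \<open>T\<close>.\<close>

definition eta_r ::
  "(real^'d) set \<Rightarrow> (real^'d \<Rightarrow> real) \<Rightarrow> real \<Rightarrow> real \<Rightarrow> (real^'d) set \<Rightarrow> (real^'d \<Rightarrow> real^'d) \<Rightarrow> real" where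
  "eta_r \<Omega> f C c T v = sqrt (C / c) * diameter T * L2_norm T (\<lambda>x. f x - weak_div \<Omega> v x)"

definition eta_df ::
  "(real^'d) set set \<Rightarrow> ('m \<Rightarrow> real^'d \<Rightarrow> real) \<Rightarrow> (real^'d \<Rightarrow> real^'d^'d) \<Rightarrow> 'm \<Rightarrow> (real^'d) set \<Rightarrow>
   (real^'d \<Rightarrow> real) \<Rightarrow> (real^'d \<Rightarrow> real^'d) \<Rightarrow> 'm \<Rightarrow> real" where
  "eta_df \<tau> lam \<kappa> \<mu> T p\<^sub>h v \<nu> =
     L2_norm T (\<lambda>x. matrix_inv_sqrt (lam \<nu> x *\<^sub>R \<kappa> x) *v
                     ((lam \<mu> x *\<^sub>R \<kappa> x) *v broken_grad \<tau> p\<^sub>h x + v x))"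

end

theory Submission
  imports Defs
begin

text \<open>Write \<open>B\<close> for the bilinear form at \<open>\<mu>\<close> acting on broken gradients, and put \<open>e = p - p\<^sub>h\<close>,
  \<open>a = p\<^sub>h - s\<close> and \<open>w = p - s = e + a\<close>, which lies in \<open>H10\<close>. Expanding \<open>B(a,a) = B(w - e, w - e)\<close>
  gives \<open>B(e,e) = B(a,a) + 2 B(e,w) - B(w,w)\<close>. If \<open>B(e,w) \<le> R * sqrt (B(w,w))\<close>, the right-hand side is
  at most \<open>B(a,a) + R\<^sup>2 \<le> (sqrt (B(a,a)) + R)\<^sup>2\<close>; no projection onto \<open>H10\<close> is needed.
  The weak equation and the Green formula for \<open>v\<close> on \<open>H10\<close> turn \<open>B(e,w)\<close> into the sum of
  \<open>(f - div v, w)\<close>, in which local conservation permits subtracting the mean of \<open>w\<close> on each \<open>T\<close> so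
  that the Poincare inequality applies, and of \<open>- (\<lambda>(\<mu>)\<kappa>\<nabla>p\<^sub>h + v, \<nabla>w)\<close>, which is estimated by the
  Cauchy-Schwarz inequality with the weight \<open>\<lambda>(\<mu>\<^sub>h)\<kappa>\<close>. Comparing the coefficients at different parameters
  yields the claim. All of this presupposes that weak gradients are unique, which is deduced from
  the smooth function \<open>exp (-1/t)\<close>.\<close>

text \<open>The error is measured at \<open>\<mu>\<^sub>b\<close>, but the weak equation holds only
  at \<mu>, and the flux estimator is weighted at \<open>\<mu>\<^sub>h\<close>. The energy argument
  therefore runs at \<mu>. The factors \<open>1 / sqrt \<alpha>\<^sub>b\<close> and
  \<open>sqrt \<gamma>\<close> are the price of passing between \<open>\<mu>\<^sub>b\<close> and
  \<mu>, and \<open>1 / sqrt \<alpha>\<^sub>h\<close> that of weighting the flux at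
  \<open>\<mu>\<^sub>h\<close>. The residual has no factor of its own, since its ellipticity
  constant bounds the tensor from below for all parameters at once. The notions rest on choices and
  total operators: \<open>weak_grad\<close>, \<open>weak_div\<close> and \<open>matrix_sqrt\<close>
  are chosen by \<open>SOME\<close>, \<open>smallest_eigenvalue\<close> by \<open>LEAST\<close>,
  \<open>essinf\<close> is a real supremum, and a nonintegrable function has integral 0. Each has to
  be shown meaningful. In particular, the flux estimator would vanish if its integrand were not
  measurable, so an inverse matrix root must be shown to yield a measurable norm. Uniqueness of weak
  gradients connects the gradients chosen separately on simplices, on coarse elements and on the
  whole domain.\<close>

lemma quadratic_nonneg_discriminant:
  fixes a b c :: real
  assumes "\<And>t. 0 \<le> a + 2 * t * b + t\<^sup>2 * c" and "0 \<le> c"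
  shows "b\<^sup>2 \<le> a * c"
proof (cases "c = 0")
  case True
  have "b = 0"
  proof (rule ccontr)
    assume "b \<noteq> 0"
    \<comment> \<open>With \<open>c = 0\<close> the expression is affine in \<open>t\<close>, and
      this \<open>t\<close> gives it the value -1.\<close>
    then show False
      using assms(1)[of "- (a + 1) / (2 * b)"] True by (simp add: field_simps)
  qed
  then show ?thesis using True by simp
next
  case False
  \<comment> \<open>The quadratic is smallest at \<open>t = - b / c\<close>; the factor
    \<open>c\<close> clears the denominator.\<close>
  have "0 \<le> c * (a + 2 * (- b / c) * b + (- b / c)\<^sup>2 * c)"
    by (intro mult_nonneg_nonneg assms)
  also have "\<dots> = a * c - b\<^sup>2"
    using False by (simp add: field_simps power2_eq_square)
  finally show ?thesis by simp
qed

section \<open>Symmetric matrices\<close>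

lemma symmetric_matrix_inner:
  assumes "symmetric_matrix A"
  shows "(A *v x) \<bullet> y = x \<bullet> (A *v y)"
  using assms dot_lmul_matrix[of x A y] transpose_matrix_vector[of A x]
  by (simp add: symmetric_matrix_def)

lemma symmetric_matrix_quadratic:
  assumes "symmetric_matrix A"
  shows "(x + t *\<^sub>R y) \<bullet> (A *v (x + t *\<^sub>R y))
       = x \<bullet> (A *v x) + 2 * t * ((A *v x) \<bullet> y) + t\<^sup>2 * (y \<bullet> (A *v y))"
  using symmetric_matrix_inner[OF assms, of x y]
  by (simp add: matrix_vector_right_distrib matrix_vector_mult_scaleR inner_add_left
      inner_add_right power2_eq_square algebra_simps inner_commute)

text \<open>The minimum of the Rayleigh quotient over the unit sphere of \<open>S\<close> is
  attained at an eigenvector. The minimality of \<open>m\<close> is returned as well because it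
  identifies the smallest eigenvalue; the invariant subspace allows an induction on the
  dimension.\<close>

lemma symmetric_eigenvector:
  fixes A :: "real^'d^'d"
  assumes A: "symmetric_matrix A" and S: "subspace S" "S \<noteq> {0}"
    and inv: "\<And>x. x \<in> S \<Longrightarrow> A *v x \<in> S"
  obtains x m where "x \<in> S" "norm x = 1" "A *v x = m *\<^sub>R x"
    "\<And>y. y \<in> S \<Longrightarrow> m * (norm y)\<^sup>2 \<le> y \<bullet> (A *v y)"
proof -
  let ?K = "S \<inter> sphere 0 1"
  have "compact ?K"
    using closed_subspace[OF S(1)] by (simp add: closed_Int_compact)
  moreover obtain y where "y \<in> S" "y \<noteq> 0"
    using S subspace_0 by blast
  then have "(1 / norm y) *\<^sub>R y \<in> ?K"
    using S by (simp add: subspace_scale)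
  then have "?K \<noteq> {}" by blast
  moreover have "continuous_on ?K (\<lambda>x. x \<bullet> (A *v x))"
    by (intro continuous_intros linear_continuous_on) auto
  ultimately obtain x where x: "x \<in> ?K" and min: "\<And>y. y \<in> ?K \<Longrightarrow> x \<bullet> (A *v x) \<le> y \<bullet> (A *v y)"
    using continuous_attains_inf[of ?K "\<lambda>x. x \<bullet> (A *v x)"] by blast
  define m where "m = x \<bullet> (A *v x)"
  have xS: "x \<in> S" "norm x = 1" using x by auto
  have low: "m * (norm y)\<^sup>2 \<le> y \<bullet> (A *v y)" if "y \<in> S" for y
  proof (cases "y = 0")
    case False
    have "(1 / norm y) *\<^sub>R y \<in> ?K" using that False S by (simp add: subspace_scale)
    from min[OF this] have "m \<le> (y \<bullet> (A *v y)) / (norm y)\<^sup>2"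
      by (simp add: m_def matrix_vector_mult_scaleR power2_eq_square divide_simps)
    then show ?thesis using False by (simp add: field_simps)
  qed simp
  define z where "z = A *v x - m *\<^sub>R x"
  have zS: "z \<in> S" using xS inv S by (simp add: z_def subspace_diff subspace_scale)
  \<comment> \<open>The form \<open>y \<bullet> (A *v y) - m * (norm y)\<^sup>2\<close> is
    nonnegative on \<open>S\<close> and vanishes at \<open>x\<close>. By the discriminant its
    polarisation at \<open>x\<close> and \<open>z\<close> vanishes too, and that polarisation is
    \<open>z \<bullet> z\<close>.\<close>
  have "(z \<bullet> z)\<^sup>2 \<le> 0 * (z \<bullet> (A *v z) - m * (norm z)\<^sup>2)"
  proof (rule quadratic_nonneg_discriminant)
    fix t :: real
    have "x + t *\<^sub>R z \<in> S" using xS zS S by (simp add: subspace_add subspace_scale)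
    note low_t = low[OF this]
    have n: "(norm (x + t *\<^sub>R z))\<^sup>2 = 1 + 2 * t * (x \<bullet> z) + t\<^sup>2 * (norm z)\<^sup>2"
      using xS unfolding power2_norm_eq_inner
      by (simp add: inner_add_left inner_add_right inner_commute power2_eq_square algebra_simps norm_eq_1)
    have "m * (1 + 2 * t * (x \<bullet> z) + t\<^sup>2 * (norm z)\<^sup>2)
        \<le> m + 2 * t * ((A *v x) \<bullet> z) + t\<^sup>2 * (z \<bullet> (A *v z))"
      using low_t unfolding symmetric_matrix_quadratic[OF A] n by (simp add: m_def)
    moreover have "(A *v x) \<bullet> z = z \<bullet> z + m * (x \<bullet> z)"
      by (simp add: z_def inner_diff_left)
    ultimately show "0 \<le> 0 + 2 * t * (z \<bullet> z) + t\<^sup>2 * (z \<bullet> (A *v z) - m * (norm z)\<^sup>2)"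
      by (simp add: algebra_simps)
  qed (use low[OF zS] in simp)
  then have "A *v x = m *\<^sub>R x" by (simp add: z_def)
  with xS low show thesis by (intro that)
qed

text \<open>A \<open>LEAST\<close> over the reals is meaningful only if the minimum is attained. The
  minimum of the Rayleigh quotient is itself an eigenvalue and lies below every other one.\<close>

lemma smallest_eigenvalue_le_quadratic:
  fixes A :: "real^'d^'d"
  assumes "symmetric_matrix A"
  shows "eigenvalue A (smallest_eigenvalue A)"
    and "smallest_eigenvalue A * (norm y)\<^sup>2 \<le> y \<bullet> (A *v y)"
proof -
  have "(UNIV :: (real^'d) set) \<noteq> {0}"
    using UNIV_not_singleton by blast
  then obtain x m where x: "norm x = 1" "A *v x = m *\<^sub>R x"
    and low: "\<And>y. m * (norm y)\<^sup>2 \<le> y \<bullet> (A *v y)"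
    using symmetric_eigenvector[OF assms, of UNIV] by auto
  have e: "eigenvalue A m"
    using x unfolding eigenvalue_def by (intro exI[of _ x]) auto
  have "m \<le> e" if e: "eigenvalue A e" for e
  proof -
    obtain z where z: "z \<noteq> 0" "A *v z = e *\<^sub>R z" using e by (auto simp: eigenvalue_def)
    then show ?thesis using low[of z] by (simp add: power2_norm_eq_inner)
  qed
  with e have "smallest_eigenvalue A = m"
    unfolding smallest_eigenvalue_def by (intro Least_equality)
  with e low show "eigenvalue A (smallest_eigenvalue A)"
    "smallest_eigenvalue A * (norm y)\<^sup>2 \<le> y \<bullet> (A *v y)" by auto
qed

text \<open>An eigenvector is split off; by symmetry its orthogonal complement within
  \<open>S\<close> is again invariant and has smaller dimension.\<close>

lemma symmetric_eigenbasis: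
  fixes A :: "real^'d^'d"
  assumes A: "symmetric_matrix A" and S: "subspace S"
    and inv: "\<And>x. x \<in> S \<Longrightarrow> A *v x \<in> S"
  shows "\<exists>U. U \<subseteq> S \<and> pairwise orthogonal U \<and> (\<forall>u\<in>U. norm u = 1) \<and> span U = S \<and>
             (\<forall>u\<in>U. \<exists>l. A *v u = l *\<^sub>R u)"
  using S inv
proof (induction "dim S" arbitrary: S rule: less_induct)
  case less
  show ?case
  proof (cases "S = {0}")
    case True
    then show ?thesis by (intro exI[of _ "{}"]) (auto simp: pairwise_def)
  next
    case False
    obtain x m where x: "x \<in> S" "norm x = 1" "A *v x = m *\<^sub>R x"
      using symmetric_eigenvector[OF A less.prems(1) False less.prems(2)] by blast
    let ?S = "{y \<in> S. x \<bullet> y = 0}"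
    have sub: "subspace ?S"
      using less.prems(1) by (auto simp: subspace_def inner_add_right)
    have "x \<notin> ?S" using x by (auto simp: norm_eq_1)
    then have "?S \<subset> S" using x by blast
    then have "dim ?S < dim S"
      using sub less.prems(1) by (intro dim_psubset) (simp add: span_eq_iff[THEN iffD2])
    moreover have "A *v y \<in> ?S" if "y \<in> ?S" for y
      using that less.prems(2) symmetric_matrix_inner[OF A, of x y] x by auto
    ultimately obtain U where U: "U \<subseteq> ?S" "pairwise orthogonal U" "\<forall>u\<in>U. norm u = 1" "span U = ?S"
      "\<forall>u\<in>U. \<exists>l. A *v u = l *\<^sub>R u"
      using less.hyps[of ?S] sub by blast
    have "y \<in> span (insert x U)" if y: "y \<in> S" for y
    proof -
      have "y - (x \<bullet> y) *\<^sub>R x \<in> ?S"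
        using y x less.prems(1) by (auto simp: subspace_diff subspace_scale inner_diff_right norm_eq_1)
      then show ?thesis unfolding U(4)[symmetric] by (auto simp: span_breakdown_eq)
    qed
    moreover have "span (insert x U) \<subseteq> S"
      using U(1) x less.prems(1) by (intro span_minimal) auto
    moreover have "pairwise orthogonal (insert x U)"
      using U(1,2) by (auto simp: pairwise_insert orthogonal_def inner_commute)
    ultimately show ?thesis
      using U x by (intro exI[of _ "insert x U"]) auto
  qed
qed

text \<open>The choice in \<open>matrix_sqrt\<close> requires a witness: the map that multiplies
  each vector of an orthonormal eigenbasis by the square root of its eigenvalue.\<close>

lemma matrix_sqrt:
  fixes A :: "real^'d^'d"
  assumes A: "symmetric_matrix A" and pos: "\<And>x. x \<noteq> 0 \<Longrightarrow> 0 < x \<bullet> (A *v x)"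
  shows "symmetric_matrix (matrix_sqrt A)"
    and "x \<noteq> 0 \<Longrightarrow> 0 < x \<bullet> (matrix_sqrt A *v x)"
    and "matrix_sqrt A ** matrix_sqrt A = A"
proof -
  obtain U where U: "pairwise orthogonal U" "\<forall>u\<in>U. norm u = 1" "span U = UNIV"
      "\<forall>u\<in>U. \<exists>l. A *v u = l *\<^sub>R u"
    using symmetric_eigenbasis[OF A subspace_UNIV] by auto
  then obtain l where l: "\<And>u. u \<in> U \<Longrightarrow> A *v u = l u *\<^sub>R u" by metis
  have fin: "finite U" using U(1) pairwise_orthogonal_imp_finite by blast
  have uu: "u \<bullet> w = (if u = w then 1 else 0)" if "u \<in> U" "w \<in> U" for u w
    using that U(1,2) by (auto simp: pairwise_def orthogonal_def norm_eq_1)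
  have ex: "(\<Sum>u\<in>U. (u \<bullet> x) *\<^sub>R u) = x" for x
    using orthonormal_basis_expand[OF U(1) _ _ fin, of x] U by (auto simp: inner_commute)
  have lpos: "0 < l u" if "u \<in> U" for u
  proof -
    have "u \<noteq> 0" using that U by auto
    then show ?thesis using pos[of u] l[OF that] uu[OF that that] by simp
  qed
  define B where "B = matrix (\<lambda>x. \<Sum>u\<in>U. (sqrt (l u) * (u \<bullet> x)) *\<^sub>R u)"
  have lin: "linear (\<lambda>x. \<Sum>u\<in>U. (sqrt (l u) * (u \<bullet> x)) *\<^sub>R u)"
    by (rule linearI) (auto simp: inner_add_right scaleR_add_left distrib_left sum.distrib
        scaleR_sum_right mult.left_commute)
  have Bv: "B *v x = (\<Sum>u\<in>U. (sqrt (l u) * (u \<bullet> x)) *\<^sub>R u)" for x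
    using matrix_works[of _ x] lin by (simp add: B_def linear_matrix_vector_mul_eq)
  have Binner: "(B *v x) \<bullet> y = (\<Sum>u\<in>U. sqrt (l u) * (u \<bullet> x) * (u \<bullet> y))" for x y
    by (simp add: Bv inner_sum_left)
  have uB: "u \<bullet> (B *v x) = sqrt (l u) * (u \<bullet> x)" if "u \<in> U" for u x
  proof -
    have "u \<bullet> (B *v x) = (\<Sum>w\<in>U. sqrt (l w) * (w \<bullet> x) * (u \<bullet> w))"
      by (simp add: Bv inner_sum_right)
    also have "\<dots> = (\<Sum>w\<in>U. if w = u then sqrt (l u) * (u \<bullet> x) else 0)"
      using that uu by (intro sum.cong) auto
    also have "\<dots> = sqrt (l u) * (u \<bullet> x)" using that fin by simp
    finally show ?thesis .
  qed
  have "x \<bullet> (transpose B *v y) = x \<bullet> (B *v y)" for x y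
  proof -
    have "x \<bullet> (transpose B *v y) = (B *v x) \<bullet> y"
      by (metis dot_lmul_matrix transpose_matrix_vector transpose_transpose)
    also have "\<dots> = (B *v y) \<bullet> x" unfolding Binner by (simp add: mult_ac)
    finally show ?thesis by (simp add: inner_commute)
  qed
  then have "transpose B *v y = B *v y" for y
    using vector_eq_ldot by blast
  then have 1: "symmetric_matrix B"
    unfolding symmetric_matrix_def by (simp add: matrix_eq)
  have 2: "0 < x \<bullet> (B *v x)" if "x \<noteq> 0" for x
  proof -
    \<comment> \<open>In the eigenbasis the quadratic form is a sum of nonnegative terms, so
      strictness needs one coordinate of \<open>x\<close> that does not vanish.\<close>
    have "\<exists>u\<in>U. u \<bullet> x \<noteq> 0"
    proof (rule ccontr)
      assume "\<not> ?thesis"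
      then have "(\<Sum>u\<in>U. (u \<bullet> x) *\<^sub>R u) = 0" by (intro sum.neutral) auto
      then show False using ex[of x] that by simp
    qed
    then obtain w where w: "w \<in> U" "w \<bullet> x \<noteq> 0" by blast
    have "0 < (\<Sum>u\<in>U. sqrt (l u) * (u \<bullet> x)\<^sup>2)"
      using w lpos fin by (intro sum_pos2[of U w]) (auto intro!: mult_nonneg_nonneg mult_pos_pos simp: less_imp_le)
    then show ?thesis
      using Binner[of x x] by (simp add: inner_commute power2_eq_square mult.assoc)
  qed
  have "(B ** B) *v x = A *v x" for x
  proof -
    have "(B ** B) *v x = (\<Sum>u\<in>U. (sqrt (l u) * (sqrt (l u) * (u \<bullet> x))) *\<^sub>R u)"
      unfolding matrix_vector_mul_assoc[symmetric] by (subst Bv) (simp add: uB)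
    also have "\<dots> = (\<Sum>u\<in>U. (u \<bullet> x) *\<^sub>R (A *v u))"
    proof (rule sum.cong)
      fix u assume "u \<in> U"
      moreover from this have "sqrt (l u) * (sqrt (l u) * (u \<bullet> x)) = (u \<bullet> x) * l u"
        using lpos[of u] by (simp add: mult.assoc[symmetric])
      ultimately show "(sqrt (l u) * (sqrt (l u) * (u \<bullet> x))) *\<^sub>R u = (u \<bullet> x) *\<^sub>R (A *v u)"
        by (simp add: l)
    qed simp
    also have "\<dots> = A *v (\<Sum>u\<in>U. (u \<bullet> x) *\<^sub>R u)"
      by (simp add: linear_sum[OF matrix_vector_mul_linear] matrix_vector_mult_scaleR)
    finally show ?thesis by (simp add: ex)
  qed
  then have 3: "B ** B = A" by (simp add: matrix_eq)
  let ?P = "\<lambda>B. symmetric_matrix B \<and> (\<forall>x. x \<noteq> 0 \<longrightarrow> 0 < x \<bullet> (B *v x)) \<and> B ** B = A"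
  have "?P B" using 1 2 3 by blast
  then have P: "?P (matrix_sqrt A)"
    unfolding matrix_sqrt_def by (rule someI[of ?P])
  show "symmetric_matrix (matrix_sqrt A)" "x \<noteq> 0 \<Longrightarrow> 0 < x \<bullet> (matrix_sqrt A *v x)"
    "matrix_sqrt A ** matrix_sqrt A = A" using P by auto
qed

text \<open>With the root \<open>B\<close> and its inverse \<open>C\<close>, the first claim is
  Cauchy-Schwarz applied to \<open>(C *v w) \<bullet> (B *v z)\<close>; the second inserts
  \<open>C *v w\<close> into the lower bound. The third removes the root altogether: any solution
  \<open>z\<close> of \<open>A *v z = w\<close> gives the weighted norm, which is what makes its
  measurability accessible.\<close>

lemma matrix_inv_sqrt:
  fixes A :: "real^'d^'d"
  assumes A: "symmetric_matrix A" and pos: "\<And>x. x \<noteq> 0 \<Longrightarrow> 0 < x \<bullet> (A *v x)"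
  shows inner_le_matrix_inv_sqrt:
      "\<bar>w \<bullet> z\<bar> \<le> norm (matrix_inv_sqrt A *v w) * sqrt (z \<bullet> (A *v z))"
    and matrix_inv_sqrt_le:
      "(\<And>y. c * (norm y)\<^sup>2 \<le> y \<bullet> (A *v y)) \<Longrightarrow> c * (norm (matrix_inv_sqrt A *v w))\<^sup>2 \<le> (norm w)\<^sup>2"
    and norm_matrix_inv_sqrt:
      "A *v z = w \<Longrightarrow> (norm (matrix_inv_sqrt A *v w))\<^sup>2 = w \<bullet> z"
proof -
  let ?B = "matrix_sqrt A" and ?C = "matrix_inv_sqrt A"
  note B = matrix_sqrt[OF A pos]
  have "inj ((*v) ?B)"
    using B(2) by (subst linear_injective_0) (auto, metis inner_zero_right less_irrefl)
  then have "invertible ?B"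
    by (simp add: invertible_left_inverse matrix_left_invertible_injective)
  then have "?B ** ?C = mat 1" "?C ** ?B = mat 1"
    unfolding matrix_inv_sqrt_def matrix_inv_def invertible_def by (metis (mono_tags, lifting) someI_ex)+
  then have BC: "?B *v (?C *v x) = x" and CB: "?C *v (?B *v x) = x" for x
    by (simp_all add: matrix_vector_mul_assoc)
  have nB: "(norm (?B *v y))\<^sup>2 = y \<bullet> (A *v y)" for y
    using symmetric_matrix_inner[OF B(1), of y "?B *v y"] B(3)
    by (simp add: power2_norm_eq_inner matrix_vector_mul_assoc)
  have "w \<bullet> z = (?C *v w) \<bullet> (?B *v z)"
    using symmetric_matrix_inner[OF B(1), of "?C *v w" z] by (simp add: BC)
  also have "\<bar>\<dots>\<bar> \<le> norm (?C *v w) * norm (?B *v z)" by (rule Cauchy_Schwarz_ineq2)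
  also have "norm (?B *v z) = sqrt (z \<bullet> (A *v z))"
    using nB[of z] by (metis norm_ge_zero real_sqrt_unique)
  finally show "\<bar>w \<bullet> z\<bar> \<le> norm (?C *v w) * sqrt (z \<bullet> (A *v z))" .
  show "c * (norm (?C *v w))\<^sup>2 \<le> (norm w)\<^sup>2" if "\<And>y. c * (norm y)\<^sup>2 \<le> y \<bullet> (A *v y)"
    using that[of "?C *v w"] nB[of "?C *v w"] by (simp add: BC)
  show "(norm (?C *v w))\<^sup>2 = w \<bullet> z" if "A *v z = w"
  proof -
    have "?C *v w = ?B *v z"
      using that B(3) CB by (metis matrix_vector_mul_assoc)
    then show ?thesis using nB[of z] that by (simp add: inner_commute)
  qed
qed

section \<open>Smooth functions\<close>

lemma grad_nth:
  assumes "(\<phi> has_derivative D) (at x)"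
  shows "grad \<phi> x $ i = D (axis i 1)"
  using frechet_derivative_at[OF assms] by (simp add: grad_def)

lemma Ck_SucI:
  assumes "\<And>x. (\<phi> has_derivative D x) (at x)" "\<And>i. Ck k (\<lambda>x. D x (axis i 1))"
  shows "Ck (Suc k) \<phi>"
  using assms by (auto simp: grad_nth[OF assms(1)] differentiable_def)

lemma Ck_SucD:
  assumes "Ck (Suc k) \<phi>"
  shows "(\<phi> has_derivative (\<lambda>h. h \<bullet> grad \<phi> x)) (at x)"
proof -
  obtain D where D: "(\<phi> has_derivative D) (at x)"
    using assms by (auto simp: differentiable_def)
  interpret linear D using D by (rule has_derivative_linear)
  have "D h = h \<bullet> grad \<phi> x" for h
  proof -
    have "D h = D (\<Sum>i\<in>UNIV. h $ i *\<^sub>R axis i 1)"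
      by (simp add: basis_expansion scalar_mult_eq_scaleR[symmetric])
    then show ?thesis by (simp add: sum scaleR grad_nth[OF D] inner_vec_def)
  qed
  then have "D = (\<lambda>h. h \<bullet> grad \<phi> x)" by blast
  with D show ?thesis by simp
qed

text \<open>\<open>Ck (Suc k)\<close> speaks of differentiability and of the partial derivatives
  only; the base case is that differentiable functions are continuous.\<close>

lemma Ck_pred: "Ck (Suc k) \<phi> \<Longrightarrow> Ck k \<phi>"
proof (induction k arbitrary: \<phi>)
  case 0
  then show ?case
    by (auto intro!: continuous_at_imp_continuous_on differentiable_imp_continuous_within)
next
  case (Suc k)
  then show ?case by simp
qed

lemma Ck_const [simp]: "Ck k (\<lambda>x. c)"
proof (induction k arbitrary: c)
  case (Suc k)
  show ?case by (rule Ck_SucI[of _ "\<lambda>x h. 0"]) (auto intro: Suc)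
qed auto

lemma Ck_add: "Ck k \<phi> \<Longrightarrow> Ck k \<psi> \<Longrightarrow> Ck k (\<lambda>x. \<phi> x + \<psi> x)"
proof (induction k arbitrary: \<phi> \<psi>)
  case 0
  then show ?case by (auto intro: continuous_intros)
next
  case (Suc k)
  show ?case
  proof (rule Ck_SucI)
    fix x show "((\<lambda>x. \<phi> x + \<psi> x) has_derivative (\<lambda>h. h \<bullet> grad \<phi> x + h \<bullet> grad \<psi> x)) (at x)"
      by (intro has_derivative_add Ck_SucD[OF Suc.prems(1)] Ck_SucD[OF Suc.prems(2)])
  qed (use Suc in \<open>simp add: inner_axis'\<close>)
qed

lemma Ck_mult: "Ck k \<phi> \<Longrightarrow> Ck k \<psi> \<Longrightarrow> Ck k (\<lambda>x. \<phi> x * \<psi> x)"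
proof (induction k arbitrary: \<phi> \<psi>)
  case 0
  then show ?case by (auto intro: continuous_intros)
next
  case (Suc k)
  show ?case
  proof (rule Ck_SucI)
    fix x show "((\<lambda>x. \<phi> x * \<psi> x) has_derivative
        (\<lambda>h. \<phi> x * (h \<bullet> grad \<psi> x) + (h \<bullet> grad \<phi> x) * \<psi> x)) (at x)"
      by (intro has_derivative_mult Ck_SucD[OF Suc.prems(1)] Ck_SucD[OF Suc.prems(2)])
  next
    fix i
    show "Ck k (\<lambda>x. \<phi> x * (axis i 1 \<bullet> grad \<psi> x) + (axis i 1 \<bullet> grad \<phi> x) * \<psi> x)"
      using Suc.prems Ck_pred[OF Suc.prems(1)] Ck_pred[OF Suc.prems(2)]
      by (auto simp: inner_axis' intro!: Ck_add Suc.IH)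
  qed
qed

lemma Ck_diff: "Ck k \<phi> \<Longrightarrow> Ck k \<psi> \<Longrightarrow> Ck k (\<lambda>x. \<phi> x - \<psi> x)"
  using Ck_add[OF _ Ck_mult[OF Ck_const[of k "-1"]], of \<phi> \<psi>] by simp

lemma Ck_prod: "finite I \<Longrightarrow> (\<And>i. i \<in> I \<Longrightarrow> Ck k (\<phi> i)) \<Longrightarrow> Ck k (\<lambda>x. \<Prod>i\<in>I. \<phi> i x)"
  by (induction rule: finite_induct) (auto intro: Ck_mult)

text \<open>These functions vanish to infinite order at \<open>0\<close>, and the family is closed under
  differentiation.\<close>

definition flat :: "real poly \<Rightarrow> real \<Rightarrow> real" where
  "flat P t = (if t \<le> 0 then 0 else poly P (inverse t) * exp (- inverse t))"

lemma poly_times_exp_minus_tendsto_0: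
  "((\<lambda>y. poly P y * exp (- y)) \<longlongrightarrow> (0::real)) at_top"
proof -
  have "((\<lambda>y. \<Sum>i\<le>degree P. coeff P i * (y ^ i / exp y)) \<longlongrightarrow> (\<Sum>i\<le>degree P. coeff P i * 0)) at_top"
    by (intro tendsto_intros tendsto_power_div_exp_0)
  then show ?thesis
    by (simp add: poly_altdef sum_distrib_right exp_minus divide_inverse mult.assoc)
qed

text \<open>For positive \<open>t\<close> put \<open>y = inverse t\<close>, so that dy/dt = -y^2.
  The derivative of P(y) exp(-y) in \<open>t\<close> is then y^2 (P - P')(y) exp(-y), again of the
  same form.\<close>

lemma DERIV_flat:
  "(flat P has_field_derivative flat ([:0, 0, 1:] * (P - pderiv P)) t) (at t)"
proof -
  consider "t < 0" | "t = 0" | "0 < t" by linarith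
  then show ?thesis
  proof cases
    case 1
    have "((\<lambda>t. 0) has_field_derivative 0) (at t)" by simp
    then have "(flat P has_field_derivative 0) (at t)"
      by (rule has_field_derivative_transform_within_open[of _ _ _ "{..<0}"])
        (use 1 in \<open>auto simp: flat_def\<close>)
    then show ?thesis using 1 by (simp add: flat_def)
  next
    case 2
    \<comment> \<open>The difference quotient at 0 is y P(y) exp(-y) with y = 1/h; the factor
      \<open>[:0, 1:]\<close> absorbs the division by \<open>h\<close>.\<close>
    have "((\<lambda>h. poly (P * [:0, 1:]) (inverse h) * exp (- inverse h)) \<longlongrightarrow> 0) (at_right 0)"
      by (rule filterlim_compose[OF poly_times_exp_minus_tendsto_0 filterlim_inverse_at_top_right])
    then have "((\<lambda>h. flat P h / h) \<longlongrightarrow> 0) (at_right 0)"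
      by (rule Lim_transform_eventually)
        (auto simp: eventually_at_filter flat_def divide_inverse)
    moreover have "((\<lambda>h. flat P h / h) \<longlongrightarrow> 0) (at_left 0)"
      by (rule tendsto_eventually) (auto simp: eventually_at_filter flat_def)
    ultimately have "((\<lambda>h. flat P h / h) \<longlongrightarrow> 0) (at 0)"
      by (intro filterlim_split_at)
    then show ?thesis using 2 by (simp add: DERIV_def flat_def)
  next
    case 3
    have "((\<lambda>t. poly P (inverse t) * exp (- inverse t)) has_field_derivative
        flat ([:0, 0, 1:] * (P - pderiv P)) t) (at t)"
      using 3 by (auto intro!: derivative_eq_intros DERIV_chain'[OF _ poly_DERIV]
          simp: flat_def power2_eq_square algebra_simps)
    then show ?thesis
      by (rule has_field_derivative_transform_within_open[of _ _ _ "{0<..}"])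
        (use 3 in \<open>auto simp: flat_def\<close>)
  qed
qed

text \<open>The polynomial changes with every derivative, so the induction runs over all
  \<open>P\<close> at once. An affine function of one coordinate is all that a product over the
  sides of a box requires.\<close>

lemma Ck_flat: "Ck k (\<lambda>x. flat P (c * x $ i + e))"
proof (induction k arbitrary: P)
  case 0
  have "continuous_on UNIV (flat P)" for P
    by (intro continuous_at_imp_continuous_on ballI DERIV_isCont[OF DERIV_flat])
  then show ?case
    unfolding Ck.simps by (rule continuous_on_compose2) (auto intro!: continuous_intros)
next
  case (Suc k)
  let ?Q = "[:0, 0, 1:] * (P - pderiv P)"
  show ?case
  proof (rule Ck_SucI)
    fix x
    have "((\<lambda>x. c * x $ i + e) has_derivative (\<lambda>h. c * h $ i + 0)) (at x)"
      by (intro has_derivative_add has_derivative_mult_right has_derivative_const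
          bounded_linear_imp_has_derivative bounded_linear_vec_nth)
    from has_derivative_compose[OF this DERIV_flat[unfolded has_field_derivative_def]]
    show "((\<lambda>x. flat P (c * x $ i + e)) has_derivative
        (\<lambda>h. flat ?Q (c * x $ i + e) * (c * h $ i))) (at x)"
      unfolding add_0_right .
  next
    fix j
    show "Ck k (\<lambda>x. flat ?Q (c * x $ i + e) * (c * axis j 1 $ i))"
      by (rule Ck_mult[OF Suc Ck_const])
  qed
qed

section \<open>Test functions\<close>

lemma test_functionsI:
  assumes "\<And>k. Ck k \<phi>" "compact K" "K \<subseteq> A" "\<And>x. x \<notin> K \<Longrightarrow> \<phi> x = 0"
  shows "\<phi> \<in> test_functions A"
proof -
  have "closure {x. \<phi> x \<noteq> 0} \<subseteq> K"
    using assms by (intro closure_minimal compact_imp_closed) auto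
  then show ?thesis
    using assms compact_Int_closed[OF assms(2), of "closure {x. \<phi> x \<noteq> 0}"]
    by (auto simp: test_functions_def Int_absorb1)
qed

text \<open>Off the closed support the function is zero on a whole neighbourhood, hence its gradient
  vanishes there too.\<close>

lemma test_functionsE:
  assumes "\<phi> \<in> test_functions A"
  obtains K where "\<And>k. Ck k \<phi>" "compact K" "K \<subseteq> A" "\<And>x. x \<notin> K \<Longrightarrow> \<phi> x = 0"
    "\<And>x. x \<notin> K \<Longrightarrow> grad \<phi> x = 0"
proof -
  obtain K where K: "K = closure {x. \<phi> x \<noteq> 0}" by blast
  have 0: "\<phi> x = 0" if "x \<notin> K" for x
    using that closure_subset[of "{x. \<phi> x \<noteq> 0}"] K by auto
  have "grad \<phi> x = 0" if "x \<notin> K" for x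
  proof -
    have K': "open (- K)" unfolding K by (intro open_Compl closed_closure)
    have "((\<lambda>x. 0) has_derivative (\<lambda>h. 0)) (at x)" by simp
    then have "(\<phi> has_derivative (\<lambda>h. 0)) (at x)"
      by (rule has_derivative_transform_within_open[OF _ K']) (simp_all add: that 0)
    then show ?thesis by (simp add: vec_eq_iff grad_nth[of \<phi> "\<lambda>h. 0"])
  qed
  moreover have "Ck k \<phi>" "compact K" "K \<subseteq> A" for k
    using assms by (auto simp: test_functions_def K)
  ultimately show thesis using 0 by (intro that)
qed

lemma test_functions_mono: "A \<subseteq> B \<Longrightarrow> test_functions A \<subseteq> test_functions B"
  by (auto simp: test_functions_def)

lemma test_functions_diff:
  assumes "\<phi> \<in> test_functions A" "\<psi> \<in> test_functions A"
  shows "(\<lambda>x. \<phi> x - \<psi> x) \<in> test_functions A"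
proof -
  obtain K L where "\<And>k. Ck k \<phi>" "compact K" "K \<subseteq> A" "\<And>x. x \<notin> K \<Longrightarrow> \<phi> x = 0"
     "\<And>k. Ck k \<psi>" "compact L" "L \<subseteq> A" "\<And>x. x \<notin> L \<Longrightarrow> \<psi> x = 0"
    using assms by (meson test_functionsE)
  then show ?thesis
    by (intro test_functionsI[of _ "K \<union> L"]) (auto intro: Ck_diff)
qed

text \<open>The factors are exp(-1/(c (x_i - a_i))) and exp(-1/(c (b_i - x_i))) inside the box, each
  cut off to 0 at its side. The steepness \<open>c\<close> is sent to infinity later, when the bump
  tends to the indicator of the box.\<close>

definition box_bump :: "real^'d \<Rightarrow> real^'d \<Rightarrow> real \<Rightarrow> real^'d \<Rightarrow> real" where
  "box_bump a b c x = (\<Prod>i\<in>UNIV. flat 1 (c * x $ i + - c * a $ i) * flat 1 (- c * x $ i + c * b $ i))"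

lemma Ck_box_bump: "Ck k (box_bump a b c)"
  unfolding box_bump_def by (intro Ck_prod Ck_mult Ck_flat) auto

lemma flat_1_range: "0 \<le> flat 1 t" "flat 1 t \<le> 1"
  by (auto simp: flat_def)

lemma box_bump_range: "0 \<le> box_bump a b c x" "box_bump a b c x \<le> 1"
  unfolding box_bump_def using flat_1_range
  by (auto intro!: prod_nonneg prod_le_1 mult_le_one)

lemma box_bump_eq_0:
  assumes "0 \<le> c" "x \<notin> box a b"
  shows "box_bump a b c x = 0"
proof -
  obtain i where i: "x $ i \<le> a $ i \<or> b $ i \<le> x $ i"
    using assms(2) by (auto simp: mem_box_cart not_less)
  then have "c * x $ i + - c * a $ i \<le> 0 \<or> - c * x $ i + c * b $ i \<le> 0"
    using assms(1) by (auto intro: mult_left_mono)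
  then show ?thesis
    unfolding box_bump_def by (auto simp: flat_def intro!: prod_zero)
qed

lemma box_bump_tendsto_1:
  assumes "x \<in> box a b"
  shows "(\<lambda>n. box_bump a b (real n) x) \<longlonglongrightarrow> 1"
proof -
  have f: "(\<lambda>n. flat 1 (real n * t)) \<longlonglongrightarrow> 1" if "0 < t" for t
  proof -
    have "filterlim (\<lambda>n. real n * t) at_top sequentially"
      using filterlim_tendsto_pos_mult_at_top[OF tendsto_const that filterlim_real_sequentially]
      by (simp add: mult.commute)
    then have "(\<lambda>n. exp (- inverse (real n * t))) \<longlonglongrightarrow> exp (- 0)"
      by (intro tendsto_intros tendsto_inverse_0_at_top)
    then have l: "(\<lambda>n. exp (- inverse (real n * t))) \<longlonglongrightarrow> 1" by simp
    show ?thesis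
    proof (rule Lim_transform_eventually[OF l])
      show "\<forall>\<^sub>F n in sequentially. exp (- inverse (real n * t)) = flat 1 (real n * t)"
        using eventually_gt_at_top[of 0]
      proof eventually_elim
        case (elim n)
        then have "0 < real n * t" using that by simp
        then show ?case by (simp add: flat_def)
      qed
    qed
  qed
  have "(\<lambda>n. \<Prod>i\<in>UNIV. flat 1 (real n * (x $ i - a $ i)) * flat 1 (real n * (b $ i - x $ i)))
      \<longlonglongrightarrow> (\<Prod>i\<in>(UNIV::'a set). 1 * 1)"
    using assms by (intro tendsto_intros f) (auto simp: mem_box_cart)
  then show ?thesis
    by (simp add: box_bump_def algebra_simps)
qed

text \<open>This takes the place of mollification: an open set is a countable union of boxes, and
  the bumps of the first \<open>n\<close> boxes, with steepness \<open>n\<close>, are merged into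
  one test function.\<close>

lemma indicator_open_limit_test_functions:
  fixes U :: "(real^'d) set"
  assumes "open U"
  obtains \<psi> where "\<And>n::nat. \<psi> n \<in> test_functions U" "\<And>n x. 0 \<le> \<psi> n x" "\<And>n x. \<psi> n x \<le> 1"
    "\<And>x. (\<lambda>n. \<psi> n x) \<longlonglongrightarrow> indicator U x"
proof -
  let ?F = "(\<lambda>(a, b). box a b) ` {(a, b). cbox a b \<subseteq> U}"
  have "open S" if "S \<in> ?F" for S using that by (auto simp: open_box)
  then obtain F where F: "F \<subseteq> ?F" "countable F" "\<Union>F = \<Union>?F"
    by (rule Lindelof)
  have UF: "\<Union>?F = U"
  proof (intro equalityI subsetI)
    fix x assume "x \<in> \<Union>?F" then show "x \<in> U" using box_subset_cbox by fastforce
  next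
    fix x assume "x \<in> U"
    then obtain a b where "cbox a b \<subseteq> U" "x \<in> box a b"
      by (rule open_contains_cbox[OF assms])
    then show "x \<in> \<Union>?F" by auto
  qed
  show thesis
  proof (cases "F = {}")
    case True
    then have "U = {}" using F UF by auto
    then show thesis
      by (intro that[of "\<lambda>_ _. 0"]) (auto intro!: test_functionsI[of _ "{}"])
  next
    case False
    have "\<exists>a b. from_nat_into F k = box a b \<and> cbox a b \<subseteq> U" for k
    proof -
      have "from_nat_into F k \<in> ?F" using F(1) from_nat_into[OF False, of k] by (rule subsetD)
      then show ?thesis by auto
    qed
    then obtain a b where ab: "\<And>k. from_nat_into F k = box (a k) (b k)" "\<And>k. cbox (a k) (b k) \<subseteq> U"
      by metis
    have U: "U = (\<Union>k. box (a k) (b k))"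
    proof -
      have "U = \<Union>(range (from_nat_into F))"
        using F(3) UF range_from_nat_into[OF False F(2)] by simp
      then show ?thesis by (simp add: ab(1))
    qed
    \<comment> \<open>This is a smooth substitute for the maximum of the bumps: it stays between 0
      and 1, vanishes where all of them vanish, and is close to 1 as soon as one of them is.\<close>
    let ?\<psi> = "\<lambda>n x. 1 - (\<Prod>k<n. 1 - box_bump (a k) (b k) (real n) x)"
    have r: "0 \<le> 1 - box_bump (a k) (b k) (real n) x" "1 - box_bump (a k) (b k) (real n) x \<le> 1" for k n x
      using box_bump_range[of "a k" "b k" "real n" x] by auto
    show thesis
    proof (rule that[of ?\<psi>])
      fix n
      show "?\<psi> n \<in> test_functions U"
      proof (rule test_functionsI)
        show "compact (\<Union>k<n. cbox (a k) (b k))" by (intro compact_UN) (auto simp: compact_cbox)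
        show "Ck k (?\<psi> n)" for k
          by (intro Ck_diff Ck_prod Ck_box_bump Ck_const) auto
        show "?\<psi> n x = 0" if "x \<notin> (\<Union>k<n. cbox (a k) (b k))" for x
        proof -
          have "box_bump (a k) (b k) (real n) x = 0" if "k < n" for k
            using that \<open>x \<notin> _\<close> box_subset_cbox by (intro box_bump_eq_0) auto
          then show ?thesis by simp
        qed
      qed (use ab in auto)
      show "0 \<le> ?\<psi> n x" "?\<psi> n x \<le> 1" for x
        using r by (auto intro!: prod_le_1 prod_nonneg)
    next
      fix x
      show "(\<lambda>n. ?\<psi> n x) \<longlonglongrightarrow> indicator U x"
      proof (cases "x \<in> U")
        case True
        then obtain k where k: "x \<in> box (a k) (b k)" using U by auto
        have l: "(\<lambda>n. 1 - box_bump (a k) (b k) (real n) x) \<longlonglongrightarrow> 0"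
          using tendsto_diff[OF tendsto_const[of 1] box_bump_tendsto_1[OF k]] by simp
        \<comment> \<open>The factor of a box containing \<open>x\<close> tends to 0 while all
          others lie between 0 and 1.\<close>
        have "(\<lambda>n. \<Prod>k<n. 1 - box_bump (a k) (b k) (real n) x) \<longlonglongrightarrow> 0"
        proof (rule tendsto_sandwich[OF _ _ tendsto_const l])
          show "\<forall>\<^sub>F n in sequentially. (\<Prod>k<n. 1 - box_bump (a k) (b k) (real n) x)
              \<le> 1 - box_bump (a k) (b k) (real n) x"
            using eventually_gt_at_top[of k]
          proof eventually_elim
            case (elim n)
            have "(\<Prod>k<n. 1 - box_bump (a k) (b k) (real n) x)
              = (1 - box_bump (a k) (b k) (real n) x) *
                (\<Prod>k\<in>{..<n} - {k}. 1 - box_bump (a k) (b k) (real n) x)"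
              using elim by (intro prod.remove) auto
            also have "\<dots> \<le> 1 - box_bump (a k) (b k) (real n) x"
              using r by (intro mult_left_le prod_le_1) auto
            finally show ?case .
          qed
        qed (auto intro!: always_eventually prod_nonneg r)
        from tendsto_diff[OF tendsto_const[of 1] this] show ?thesis using True by simp
      next
        case False
        then have "box_bump (a k) (b k) (real n) x = 0" for k n
          using U by (intro box_bump_eq_0) auto
        then show ?thesis using False by simp
      qed
    qed
  qed
qed

section \<open>Square-integrable functions\<close>

lemma L2_measurable [dest, measurable_dest]: "u \<in> L2 A \<Longrightarrow> u \<in> borel_measurable (lebesgue_on A)"
  and L2_integrable [dest]: "u \<in> L2 A \<Longrightarrow> integrable (lebesgue_on A) (\<lambda>x. (norm (u x))\<^sup>2)"
  by (auto simp: L2_def)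

lemma L2_bound:
  assumes "u \<in> L2 A" "w \<in> borel_measurable (lebesgue_on A)"
    "AE x in lebesgue_on A. norm (w x) \<le> C * norm (u x)"
  shows "w \<in> L2 A"
proof -
  have "integrable (lebesgue_on A) (\<lambda>x. C\<^sup>2 * (norm (u x))\<^sup>2)"
    using assms(1) by (intro integrable_mult_right) auto
  then have "integrable (lebesgue_on A) (\<lambda>x. (norm (w x))\<^sup>2)"
  proof (rule Bochner_Integration.integrable_bound)
    show "AE x in lebesgue_on A. norm ((norm (w x))\<^sup>2) \<le> norm (C\<^sup>2 * (norm (u x))\<^sup>2)"
      using assms(3)
    proof eventually_elim
      case (elim x)
      from power_mono[OF this, of 2] show ?case by (simp add: power_mult_distrib)
    qed
  qed (use assms(2) in measurable)
  with assms(2) show ?thesis by (simp add: L2_def)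
qed

lemma L2_add:
  assumes "u \<in> L2 A" "w \<in> L2 A"
  shows "(\<lambda>x. u x + w x) \<in> L2 A"
proof -
  note [measurable] = L2_measurable[OF assms(1)] L2_measurable[OF assms(2)]
  have "integrable (lebesgue_on A) (\<lambda>x. 2 * (norm (u x))\<^sup>2 + 2 * (norm (w x))\<^sup>2)"
    using assms by (intro Bochner_Integration.integrable_add integrable_mult_right) auto
  then have "integrable (lebesgue_on A) (\<lambda>x. (norm (u x + w x))\<^sup>2)"
  proof (rule Bochner_Integration.integrable_bound)
    have "(norm (a + b))\<^sup>2 \<le> 2 * (norm a)\<^sup>2 + 2 * (norm b)\<^sup>2" for a b :: 'b
    proof -
      have "(norm (a + b))\<^sup>2 \<le> (norm a + norm b)\<^sup>2"
        by (intro power_mono norm_triangle_ineq) auto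
      also have "\<dots> \<le> 2 * (norm a)\<^sup>2 + 2 * (norm b)\<^sup>2"
        using zero_le_power2[of "norm a - norm b"] by (simp add: power2_eq_square algebra_simps)
      finally show ?thesis .
    qed
    then show "AE x in lebesgue_on A. norm ((norm (u x + w x))\<^sup>2)
        \<le> norm (2 * (norm (u x))\<^sup>2 + 2 * (norm (w x))\<^sup>2)"
      by simp
  qed measurable
  then show ?thesis by (simp add: L2_def)
qed

lemma L2_scaleR: "u \<in> L2 A \<Longrightarrow> (\<lambda>x. c *\<^sub>R u x) \<in> L2 A"
  by (rule L2_bound[where C = "\<bar>c\<bar>"]) auto

lemma L2_diff: "u \<in> L2 A \<Longrightarrow> w \<in> L2 A \<Longrightarrow> (\<lambda>x. u x - w x) \<in> L2 A"
  using L2_add[OF _ L2_scaleR[of w A "-1"]] by simp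

lemma L2_nth:
  fixes g :: "real^'d \<Rightarrow> real^'n"
  assumes "g \<in> L2 A"
  shows "(\<lambda>x. g x $ i) \<in> L2 A"
proof (rule L2_bound[OF assms])
  show "(\<lambda>x. g x $ i) \<in> borel_measurable (lebesgue_on A)"
    using assms by (intro borel_measurable_continuous_on[OF _ L2_measurable, of "\<lambda>y. y $ i"])
      (auto intro!: continuous_intros)
  show "AE x in lebesgue_on A. norm (g x $ i) \<le> 1 * norm (g x)"
    by (simp add: component_le_norm_cart)
qed

lemma L2_inner_integrable:
  assumes "u \<in> L2 A" "w \<in> L2 A"
  shows "integrable (lebesgue_on A) (\<lambda>x. u x \<bullet> w x)"
proof (rule Bochner_Integration.integrable_bound)
  show "integrable (lebesgue_on A) (\<lambda>x. (norm (u x))\<^sup>2 + (norm (w x))\<^sup>2)"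
    using assms by (intro Bochner_Integration.integrable_add) auto
  have "\<bar>a \<bullet> b\<bar> \<le> (norm a)\<^sup>2 + (norm b)\<^sup>2" for a b :: 'b
    using Cauchy_Schwarz_ineq2[of a b] zero_le_power2[of "norm a - norm b"]
      mult_nonneg_nonneg[of "norm a" "norm b"] by (simp add: power2_eq_square algebra_simps)
  then show "AE x in lebesgue_on A. norm (u x \<bullet> w x) \<le> norm ((norm (u x))\<^sup>2 + (norm (w x))\<^sup>2)"
    by simp
qed (use assms in \<open>auto intro: borel_measurable_inner\<close>)

lemma L2_mult_integrable:
  fixes u w :: "real^'d \<Rightarrow> real"
  shows "u \<in> L2 A \<Longrightarrow> w \<in> L2 A \<Longrightarrow> integrable (lebesgue_on A) (\<lambda>x. u x * w x)"
  using L2_inner_integrable[of u A w] by simp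

lemma L2_inner_commute: "L2_inner A u w = L2_inner A w u"
  by (simp add: L2_inner_def inner_commute)

lemma L2_inner_diff:
  assumes "u \<in> L2 A" "w \<in> L2 A" "z \<in> L2 A"
  shows "L2_inner A (\<lambda>x. u x - w x) z = L2_inner A u z - L2_inner A w z"
    and "L2_inner A z (\<lambda>x. u x - w x) = L2_inner A z u - L2_inner A z w"
  using assms by (simp_all add: L2_inner_def inner_diff_left inner_diff_right L2_inner_integrable)

lemma L2_inner_cong:
  "\<lbrakk>u \<in> L2 A; w \<in> L2 A; u' \<in> L2 A; w' \<in> L2 A; AE x in lebesgue_on A. u x = u' x;
    AE x in lebesgue_on A. w x = w' x\<rbrakk> \<Longrightarrow> L2_inner A u w = L2_inner A u' w'"
  unfolding L2_inner_def
  by (intro integral_cong_AE borel_measurable_integrable L2_inner_integrable) auto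

lemma L2_norm_ge_0 [simp]: "0 \<le> L2_norm A u"
  by (simp add: L2_norm_def)

lemma L2_norm_power2: "(L2_norm A u)\<^sup>2 = L2_inner A u u"
  by (simp add: L2_norm_def L2_inner_def power2_norm_eq_inner)

lemma L2_Cauchy_Schwarz:
  assumes u: "u \<in> L2 A" and w: "w \<in> L2 A"
  shows "\<bar>L2_inner A u w\<bar> \<le> L2_norm A u * L2_norm A w"
proof -
  have "(L2_inner A u w)\<^sup>2 \<le> L2_inner A u u * L2_inner A w w"
  proof (rule quadratic_nonneg_discriminant)
    fix t :: real
    have "0 \<le> L2_inner A (\<lambda>x. u x + t *\<^sub>R w x) (\<lambda>x. u x + t *\<^sub>R w x)"
      unfolding L2_inner_def by simp
    also have "\<dots> = L2_inner A u u + 2 * t * L2_inner A u w + t\<^sup>2 * L2_inner A w w"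
      using u w by (simp add: L2_inner_def inner_add_left inner_add_right L2_inner_integrable
          inner_commute power2_eq_square mult.assoc)
    finally show "0 \<le> L2_inner A u u + 2 * t * L2_inner A u w + t\<^sup>2 * L2_inner A w w" .
  qed (simp add: L2_inner_def)
  then show ?thesis
    by (intro power2_le_imp_le[of "\<bar>_\<bar>"]) (simp_all add: power_mult_distrib L2_norm_power2)
qed

lemma L2_norm_triangle:
  assumes u: "u \<in> L2 A" and w: "w \<in> L2 A"
  shows "L2_norm A (\<lambda>x. u x - w x) \<le> L2_norm A u + L2_norm A w"
proof (rule power2_le_imp_le)
  have "(L2_norm A (\<lambda>x. u x - w x))\<^sup>2 = (L2_norm A u)\<^sup>2 - 2 * L2_inner A u w + (L2_norm A w)\<^sup>2"
    using u w by (simp add: L2_norm_power2 L2_inner_diff L2_diff L2_inner_commute[of A w u])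
  also have "\<dots> \<le> (L2_norm A u + L2_norm A w)\<^sup>2"
    using L2_Cauchy_Schwarz[OF u w] by (simp add: power2_eq_square algebra_simps)
  finally show "(L2_norm A (\<lambda>x. u x - w x))\<^sup>2 \<le> (L2_norm A u + L2_norm A w)\<^sup>2" .
qed simp

section \<open>Restriction to subsets, sets of finite measure, and compact supports\<close>

lemma AE_lebesgue_on_subset:
  assumes "AE x in lebesgue_on A. P x" "B \<subseteq> A" "A \<in> sets lebesgue" "B \<in> sets lebesgue"
  shows "AE x in lebesgue_on B. P x"
proof -
  have "AE x in lebesgue. x \<in> A \<longrightarrow> P x" using assms(1,3) by (simp add: AE_restrict_space_iff)
  then have "AE x in lebesgue. x \<in> B \<longrightarrow> P x" by eventually_elim (use assms(2) in auto)
  then show ?thesis using assms(4) by (simp add: AE_restrict_space_iff)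
qed

lemma L2_subset:
  assumes "u \<in> L2 A" "B \<subseteq> A" "A \<in> sets lebesgue" "B \<in> sets lebesgue"
  shows "u \<in> L2 B"
proof -
  have "integrable lebesgue (\<lambda>x. indicator A x *\<^sub>R (norm (u x))\<^sup>2)"
    using L2_integrable[OF assms(1)] assms(3) by (subst (asm) integrable_restrict_space) simp_all
  from integrable_mult_indicator[OF assms(4) this]
  have "integrable lebesgue (\<lambda>x. indicator B x *\<^sub>R (indicator A x *\<^sub>R (norm (u x))\<^sup>2))" .
  also have "(\<lambda>x. indicator B x *\<^sub>R (indicator A x *\<^sub>R (norm (u x))\<^sup>2)) = (\<lambda>x. indicator B x *\<^sub>R (norm (u x))\<^sup>2)"
    using assms(2) by (auto simp: indicator_def fun_eq_iff)
  finally have "integrable (lebesgue_on B) (\<lambda>x. (norm (u x))\<^sup>2)"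
    using assms(4) by (subst integrable_restrict_space) simp_all
  then show ?thesis
    using measurable_restrict_mono[OF L2_measurable[OF assms(1)] assms(2)] by (simp add: L2_def)
qed

text \<open>The localisation argument for weak gradients works with integrable functions; finite
  measure gets there from square integrability.\<close>

lemma L2_finite_measure_integrable:
  assumes "u \<in> L2 A" "A \<in> lmeasurable"
  shows "integrable (lebesgue_on A) u"
proof -
  interpret finite_measure "lebesgue_on A"
    using assms(2) by (rule finite_measure_lebesgue_on)
  have "integrable (lebesgue_on A) (\<lambda>x. 1 + (norm (u x))\<^sup>2)"
    using assms by (intro Bochner_Integration.integrable_add) auto
  then show ?thesis
  proof (rule Bochner_Integration.integrable_bound)
    have "a \<le> 1 + a\<^sup>2" for a :: real
      using zero_le_power2[of "a - 1/2"] by (simp add: power2_eq_square algebra_simps)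
    then show "AE x in lebesgue_on A. norm (u x) \<le> norm (1 + (norm (u x))\<^sup>2)" by simp
  qed (use assms in auto)
qed

lemma L2_const: "A \<in> lmeasurable \<Longrightarrow> (\<lambda>x. c) \<in> L2 A"
  by (simp add: L2_def finite_measure.integrable_const[OF finite_measure_lebesgue_on])

lemma continuous_borel_measurable_lebesgue_on:
  "continuous_on UNIV \<phi> \<Longrightarrow> \<phi> \<in> borel_measurable (lebesgue_on A)"
  by (intro measurable_restrict_space1 measurable_completion) (simp add: borel_measurable_continuous_onI)

lemma L2_compact_support:
  assumes "continuous_on UNIV \<phi>" "compact K" "\<And>x. x \<notin> K \<Longrightarrow> \<phi> x = 0" "A \<in> sets lebesgue"
  shows "\<phi> \<in> L2 A"
proof -
  have [measurable]: "\<phi> \<in> borel_measurable lebesgue"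
    using continuous_borel_measurable_lebesgue_on[OF assms(1), of UNIV] by (simp add: lebesgue_on_UNIV_eq)
  have K: "K \<in> lmeasurable" using assms(2) by (rule lmeasurable_compact)
  have "compact (\<phi> ` K)"
    using assms by (intro compact_continuous_image) (auto intro: continuous_on_subset)
  then obtain B where "\<forall>y\<in>\<phi> ` K. norm y \<le> B"
    using compact_imp_bounded bounded_iff by blast
  then have B: "\<And>x. x \<in> K \<Longrightarrow> norm (\<phi> x) \<le> B" by blast
  have "integrable lebesgue (\<lambda>x. B\<^sup>2 * indicator K x)"
    using K by (intro integrable_mult_right integrable_real_indicator) (auto simp: fmeasurable_def)
  then have "integrable lebesgue (\<lambda>x. (norm (\<phi> x))\<^sup>2)"
  proof (rule Bochner_Integration.integrable_bound)
    show "AE x in lebesgue. norm ((norm (\<phi> x))\<^sup>2) \<le> norm (B\<^sup>2 * indicat_real K x)"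
      using B assms(3) by (intro AE_I2) (simp add: indicator_def power_mono)
  qed measurable
  then have "\<phi> \<in> L2 UNIV" by (simp add: L2_def lebesgue_on_UNIV_eq)
  then show ?thesis using assms(4) by (intro L2_subset[of \<phi> UNIV A]) auto
qed

lemma test_functions_L2:
  assumes "\<phi> \<in> test_functions A" "B \<in> sets lebesgue"
  shows "\<phi> \<in> L2 B" "grad \<phi> \<in> L2 B"
proof -
  obtain K where K: "\<And>k. Ck k \<phi>" "compact K" "\<And>x. x \<notin> K \<Longrightarrow> \<phi> x = 0" "\<And>x. x \<notin> K \<Longrightarrow> grad \<phi> x = 0"
    using assms(1) by (elim test_functionsE) blast
  show "\<phi> \<in> L2 B"
    using K(1)[of 0] by (intro L2_compact_support[OF _ K(2,3) assms(2)]) simp_all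
  have "continuous_on UNIV (\<lambda>x. \<chi> i. grad \<phi> x $ i)"
    using K(1)[of "Suc 0"] by (intro continuous_on_vec_lambda) simp
  then show "grad \<phi> \<in> L2 B"
    by (intro L2_compact_support[OF _ K(2,4) assms(2)]) simp_all
qed

section \<open>Weak gradients\<close>

lemma integral_lebesgue_on_support:
  fixes h :: "real^'d \<Rightarrow> real"
  assumes "B \<subseteq> A" "A \<in> sets lebesgue" "B \<in> sets lebesgue" "\<And>x. x \<in> A - B \<Longrightarrow> h x = 0"
  shows "integral\<^sup>L (lebesgue_on A) h = integral\<^sup>L (lebesgue_on B) h"
proof -
  have "integral\<^sup>L (lebesgue_on A) h = integral\<^sup>L (lebesgue_on A) (\<lambda>x. if x \<in> B then h x else 0)"
    using assms(4) by (intro Bochner_Integration.integral_cong) auto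
  then show ?thesis using assms by (simp add: integral_restrict)
qed

text \<open>The fundamental lemma of the calculus of variations. Dominated convergence passes from
  test functions to open subsets and from these to G-delta sets, which exhaust the measurable sets
  up to null sets; a function with zero integral over every measurable set is zero almost
  everywhere.\<close>

lemma integral_test_functions_zero_imp_AE_zero:
  fixes g :: "real^'d \<Rightarrow> real"
  assumes A: "open A" "A \<in> lmeasurable" and g: "integrable (lebesgue_on A) g"
    and zero: "\<And>\<phi>. \<phi> \<in> test_functions A \<Longrightarrow> (\<integral>x. g x * \<phi> x \<partial>lebesgue_on A) = 0"
  shows "AE x in lebesgue_on A. g x = 0"
proof -
  have A_meas [measurable]: "A \<in> sets lebesgue" using A by auto
  interpret finite_measure "lebesgue_on A"
    using A(2) by (rule finite_measure_lebesgue_on)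
  have op: "(\<integral>x. indicator U x * g x \<partial>lebesgue_on A) = 0" if U: "open U" "U \<subseteq> A" for U
  proof -
    obtain \<psi> where \<psi>: "\<And>n::nat. \<psi> n \<in> test_functions U" "\<And>n x. 0 \<le> \<psi> n x" "\<And>n x. \<psi> n x \<le> 1"
      "\<And>x. (\<lambda>n. \<psi> n x) \<longlonglongrightarrow> indicator U x"
      using indicator_open_limit_test_functions[OF U(1)] by blast
    have "(\<lambda>n. \<integral>x. g x * \<psi> n x \<partial>lebesgue_on A) \<longlonglongrightarrow> (\<integral>x. g x * indicator U x \<partial>lebesgue_on A)"
    proof (rule integral_dominated_convergence[where w = "\<lambda>x. norm (g x)"])
      show "(\<lambda>x. g x * indicator U x) \<in> borel_measurable (lebesgue_on A)"
        using g U by (intro borel_measurable_times borel_measurable_indicator borel_measurable_integrable)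
          (auto simp: sets_restrict_space_iff)
      show "(\<lambda>x. g x * \<psi> n x) \<in> borel_measurable (lebesgue_on A)" for n
        using g test_functions_L2[OF \<psi>(1) A_meas] by (intro borel_measurable_times) auto
      show "AE x in lebesgue_on A. (\<lambda>n. g x * \<psi> n x) \<longlonglongrightarrow> g x * indicator U x"
        using \<psi>(4) by (intro AE_I2 tendsto_mult tendsto_const) auto
      show "AE x in lebesgue_on A. norm (g x * \<psi> n x) \<le> norm (g x)" for n
        using \<psi>(2,3) by (intro AE_I2) (auto simp: abs_mult intro: mult_left_le)
    qed (use g in auto)
    moreover have "(\<integral>x. g x * \<psi> n x \<partial>lebesgue_on A) = 0" for n
      using zero \<psi>(1) test_functions_mono[OF U(2)] by blast
    ultimately show ?thesis
      by (simp add: mult.commute LIMSEQ_const_iff)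
  qed
  show ?thesis
  proof (rule density_zero[OF g])
    fix E assume E: "E \<in> sets (lebesgue_on A)"
    then have "E \<subseteq> A" "E \<in> sets lebesgue" by (auto simp: sets_restrict_space_iff)
    obtain C N where C: "gdelta C" and N: "N \<in> null_sets lebesgue" "E \<union> N = C"
      using lebesgue_set_almost_gdelta[OF \<open>E \<in> sets lebesgue\<close>] by blast
    from C obtain V where V: "\<And>n::nat. open (V n)" "C = (\<Inter>n. V n)" by (auto elim: gdelta.cases)
    \<comment> \<open>Finite intersections keep the sets open, the factor \<open>A\<close> keeps
      them inside \<open>A\<close> so that \<open>op\<close> applies, and on \<open>A\<close> their
      indicators converge to that of \<open>C\<close>.\<close>
    define W where "W n = A \<inter> (\<Inter>k\<le>n. V k)" for n
    have W: "open (W n)" "W n \<subseteq> A" for n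
      using A(1) V(1) by (auto simp: W_def intro!: open_Int open_INT)
    have lim: "(\<lambda>n. indicat_real (W n) x) \<longlonglongrightarrow> indicator C x" if "x \<in> A" for x
    proof (cases "x \<in> C")
      case True
      then have "indicat_real (W n) x = 1" for n using that V(2) by (auto simp: W_def)
      with True show ?thesis by simp
    next
      case False
      then obtain m where "x \<notin> V m" using V(2) by auto
      then have "\<forall>\<^sub>F n in sequentially. indicat_real (W n) x = 0"
        by (intro eventually_mono[OF eventually_ge_at_top[of m]]) (auto simp: W_def indicator_def)
      with False show ?thesis by (simp add: tendsto_eventually)
    qed
    have "(\<lambda>n. \<integral>x. indicator (W n) x * g x \<partial>lebesgue_on A) \<longlonglongrightarrow> (\<integral>x. indicator E x *\<^sub>R g x \<partial>lebesgue_on A)"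
    proof (rule integral_dominated_convergence[where w = "\<lambda>x. norm (g x)"])
      show "(\<lambda>x. indicator E x *\<^sub>R g x) \<in> borel_measurable (lebesgue_on A)"
        using g E by (intro borel_measurable_scaleR borel_measurable_indicator) auto
      show "(\<lambda>x. indicator (W n) x * g x) \<in> borel_measurable (lebesgue_on A)" for n
        using g W[of n] by (intro borel_measurable_times borel_measurable_indicator)
          (auto simp: sets_restrict_space_iff)
      have "AE x in lebesgue_on UNIV. x \<notin> N"
        unfolding lebesgue_on_UNIV_eq by (rule AE_not_in[OF N(1)])
      then have "AE x in lebesgue_on A. x \<notin> N"
        using A_meas by (intro AE_lebesgue_on_subset[where A = UNIV and B = A]) auto
      moreover have "AE x in lebesgue_on A. x \<in> A"
        by (intro AE_I2) auto
      ultimately show "AE x in lebesgue_on A. (\<lambda>n. indicator (W n) x * g x) \<longlonglongrightarrow> indicator E x *\<^sub>R g x"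
      proof eventually_elim
        case (elim x)
        then have "indicat_real E x = indicator C x" using N(2) by (auto simp: indicator_def)
        then show ?case using tendsto_mult[OF lim[OF \<open>x \<in> A\<close>] tendsto_const[of "g x"]] by simp
      qed
      show "AE x in lebesgue_on A. norm (indicator (W n) x * g x) \<le> norm (g x)" for n
        by (intro AE_I2) (auto simp: indicator_def)
    qed (use g in auto)
    then show "set_lebesgue_integral (lebesgue_on A) E g = 0"
      by (simp add: op[OF W] set_lebesgue_integral_def LIMSEQ_const_iff)
  qed
qed

text \<open>Each component of the difference integrates to zero against all test functions.\<close>

lemma weak_gradient_unique:
  assumes A: "open A" "A \<in> lmeasurable" and g: "is_weak_gradient A u g" "is_weak_gradient A u h"
  shows "AE x in lebesgue_on A. g x = h x"
proof -
  have gh: "g \<in> L2 A" "h \<in> L2 A" using g by (auto simp: is_weak_gradient_def)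
  have A_meas: "A \<in> sets lebesgue" using A by auto
  have "AE x in lebesgue_on A. g x $ i - h x $ i = 0" for i
  proof (rule integral_test_functions_zero_imp_AE_zero[OF A])
    show "integrable (lebesgue_on A) (\<lambda>x. g x $ i - h x $ i)"
      using gh A(2) by (intro L2_finite_measure_integrable L2_diff L2_nth)
    fix \<phi> assume \<phi>: "\<phi> \<in> test_functions A"
    then have "\<phi> \<in> L2 A" by (rule test_functions_L2) (rule A_meas)
    moreover have "(\<integral>x. g x $ i * \<phi> x \<partial>lebesgue_on A) = (\<integral>x. h x $ i * \<phi> x \<partial>lebesgue_on A)"
    proof -
      have "(\<integral>x. u x * grad \<phi> x $ i \<partial>lebesgue_on A) = - (\<integral>x. k x $ i * \<phi> x \<partial>lebesgue_on A)"
        if "is_weak_gradient A u k" for k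
        using that \<phi> by (simp add: is_weak_gradient_def)
      from this[OF g(1)] this[OF g(2)] show ?thesis by simp
    qed
    ultimately show "(\<integral>x. (g x $ i - h x $ i) * \<phi> x \<partial>lebesgue_on A) = 0"
      using gh by (simp add: left_diff_distrib L2_mult_integrable L2_nth)
  qed
  then have "AE x in lebesgue_on A. \<forall>i. g x $ i - h x $ i = 0"
    by (simp add: AE_all_countable)
  then show ?thesis by eventually_elim (simp add: vec_eq_iff)
qed

lemma H1_L2: "u \<in> H1 A \<Longrightarrow> u \<in> L2 A"
  by (simp add: H1_def)

lemma weak_grad: "u \<in> H1 A \<Longrightarrow> is_weak_gradient A u (weak_grad A u)"
  unfolding H1_def weak_grad_def using someI[of "is_weak_gradient A u"] by blast

lemma weak_grad_L2: "u \<in> H1 A \<Longrightarrow> weak_grad A u \<in> L2 A"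
  using weak_grad by (auto simp: is_weak_gradient_def)

text \<open>Through uniqueness any weak gradient at hand computes \<open>weak_grad\<close>.
  Gradients of differences, restrictions and test functions are all identified in this way.\<close>

lemma weak_gradient_H1:
  assumes "u \<in> L2 A" "is_weak_gradient A u g" "open A" "A \<in> lmeasurable"
  shows "u \<in> H1 A" "AE x in lebesgue_on A. weak_grad A u x = g x"
proof -
  show "u \<in> H1 A" using assms by (auto simp: H1_def)
  with assms show "AE x in lebesgue_on A. weak_grad A u x = g x"
    using weak_gradient_unique weak_grad by blast
qed

lemma weak_gradient_diff:
  assumes "A \<in> sets lebesgue" "u \<in> L2 A" "w \<in> L2 A" "is_weak_gradient A u g" "is_weak_gradient A w h"
  shows "is_weak_gradient A (\<lambda>x. u x - w x) (\<lambda>x. g x - h x)"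
proof -
  have gh: "g \<in> L2 A" "h \<in> L2 A" using assms by (auto simp: is_weak_gradient_def)
  show ?thesis
    using assms gh unfolding is_weak_gradient_def
    by (auto simp: L2_diff left_diff_distrib L2_mult_integrable L2_nth test_functions_L2)
qed

lemma H1_diff:
  assumes "open A" "A \<in> lmeasurable" "u \<in> H1 A" "w \<in> H1 A"
  shows "(\<lambda>x. u x - w x) \<in> H1 A"
    and "AE x in lebesgue_on A. weak_grad A (\<lambda>x. u x - w x) x = weak_grad A u x - weak_grad A w x"
proof -
  have "is_weak_gradient A (\<lambda>x. u x - w x) (\<lambda>x. weak_grad A u x - weak_grad A w x)"
    using assms by (intro weak_gradient_diff weak_grad H1_L2) auto
  moreover have "(\<lambda>x. u x - w x) \<in> L2 A"
    using assms by (intro L2_diff H1_L2)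
  ultimately show "(\<lambda>x. u x - w x) \<in> H1 A"
    "AE x in lebesgue_on A. weak_grad A (\<lambda>x. u x - w x) x = weak_grad A u x - weak_grad A w x"
    using assms(1,2) weak_gradient_H1 by blast+
qed

text \<open>A test function on \<open>B\<close> is one on \<open>A\<close> that vanishes with its
  gradient outside \<open>B\<close>, so the defining integrals over \<open>A\<close> and
  \<open>B\<close> agree. It transfers gradients from the domain to the coarse elements and to the
  simplices.\<close>

lemma H1_subset:
  assumes A: "open A" "A \<in> lmeasurable" and B: "open B" "B \<subseteq> A" and u: "u \<in> H1 A"
  shows "u \<in> H1 B" and "AE x in lebesgue_on B. weak_grad B u x = weak_grad A u x"
proof -
  have sets: "A \<in> sets lebesgue" "B \<in> sets lebesgue" using A B by auto
  have Bm: "B \<in> lmeasurable"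
    using A(2) B(2) sets(2) by (rule fmeasurableI2)
  have "is_weak_gradient B u (weak_grad A u)"
    unfolding is_weak_gradient_def
  proof (intro conjI ballI allI)
    show "weak_grad A u \<in> L2 B"
      using weak_grad_L2[OF u] B(2) sets by (rule L2_subset)
    fix \<phi> :: "real^'a \<Rightarrow> real" and i assume \<phi>: "\<phi> \<in> test_functions B"
    then obtain K where K: "K \<subseteq> B" "\<And>x. x \<notin> K \<Longrightarrow> \<phi> x = 0" "\<And>x. x \<notin> K \<Longrightarrow> grad \<phi> x = 0"
      by (elim test_functionsE) blast
    then have 0: "\<phi> x = 0" "grad \<phi> x = 0" if "x \<notin> B" for x using that by auto
    have "(\<integral>x. u x * grad \<phi> x $ i \<partial>lebesgue_on A) = - (\<integral>x. weak_grad A u x $ i * \<phi> x \<partial>lebesgue_on A)"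
      using weak_grad[OF u] \<phi> test_functions_mono[OF B(2)] by (auto simp: is_weak_gradient_def)
    then show "(\<integral>x. u x * grad \<phi> x $ i \<partial>lebesgue_on B) = - (\<integral>x. weak_grad A u x $ i * \<phi> x \<partial>lebesgue_on B)"
      using integral_lebesgue_on_support[OF B(2) sets, of "\<lambda>x. u x * grad \<phi> x $ i"]
        integral_lebesgue_on_support[OF B(2) sets, of "\<lambda>x. weak_grad A u x $ i * \<phi> x"]
      by (simp add: 0)
  qed
  moreover have "u \<in> L2 B" using H1_L2[OF u] B(2) sets by (rule L2_subset)
  ultimately show "u \<in> H1 B" "AE x in lebesgue_on B. weak_grad B u x = weak_grad A u x"
    using B(1) Bm weak_gradient_H1 by blast+
qed

section \<open>Integration by parts\<close>

lemma lborel_integral_translate: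
  fixes u :: "'a::euclidean_space \<Rightarrow> real"
  assumes [measurable]: "u \<in> borel_measurable borel"
  shows "(\<integral>x. u (x + c) \<partial>lborel) = (\<integral>x. u x \<partial>lborel)"
proof -
  have "(\<integral>x. u x \<partial>lborel) = (\<integral>x. u x \<partial>distr lborel borel ((+) c))"
    by (simp add: lborel_distr_plus)
  also have "\<dots> = (\<integral>x. u (c + x) \<partial>lborel)"
    by (rule integral_distr) simp_all
  finally show ?thesis by (simp add: add.commute)
qed

text \<open>Difference quotients of \<open>u\<close> have integral zero because the Lebesgue measure
  is translation invariant. They converge to the partial derivative and are dominated by a constant
  on a compact set.\<close>

lemma integral_grad_compact_support_eq_0:
  fixes u :: "real^'d \<Rightarrow> real"
  assumes u: "Ck (Suc 0) u" and K: "compact K" "\<And>x. x \<notin> K \<Longrightarrow> u x = 0"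
  shows "(\<integral>x. grad u x $ i \<partial>lebesgue) = 0"
proof -
  define e :: "real^'d" where "e = axis i 1"
  have gcont: "continuous_on UNIV (\<lambda>x. grad u x $ i)" using u by simp
  have ucont: "continuous_on UNIV u" using Ck_pred[OF u] by simp
  have [measurable]: "u \<in> borel_measurable borel" "(\<lambda>x. grad u x $ i) \<in> borel_measurable borel"
    using gcont ucont by (auto intro: borel_measurable_continuous_onI)
  have D: "((\<lambda>t. u (x + t *\<^sub>R e)) has_real_derivative grad u (x + t *\<^sub>R e) $ i) (at t)" for x t
  proof -
    have "((\<lambda>t. x + t *\<^sub>R e) has_derivative (\<lambda>h. h *\<^sub>R e)) (at t)"
      by (auto intro!: derivative_eq_intros)
    from has_derivative_compose[OF this Ck_SucD[OF u]]
    have "((\<lambda>t. u (x + t *\<^sub>R e)) has_derivative (\<lambda>h. (h *\<^sub>R e) \<bullet> grad u (x + t *\<^sub>R e))) (at t)" .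
    then show ?thesis
      by (simp add: has_field_derivative_def e_def inner_axis' mult.commute[of _ "grad _ _ $ _"])
  qed
  \<comment> \<open>From a point outside \<open>K'\<close> no step of length between 0 and 1 in
    direction \<open>e\<close> reaches \<open>K\<close>, so every difference quotient used below
    vanishes there.\<close>
  define K' where "K' = (\<lambda>(x, t). x - t *\<^sub>R e) ` (K \<times> {0..1})"
  have K': "compact K'"
    unfolding K'_def using K(1) by (intro compact_continuous_image compact_Times)
      (auto simp: case_prod_unfold intro!: continuous_intros)
  have in_K': "x \<in> K'" if "x + t *\<^sub>R e \<in> K" "0 \<le> t" "t \<le> 1" for x t
    unfolding K'_def using that by (intro image_eqI[of _ _ "(x + t *\<^sub>R e, t)"]) auto
  \<comment> \<open>By the mean value theorem a quotient at a point of \<open>K'\<close> is a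
    derivative at some point of \<open>L\<close>, where compactness provides the bound
    \<open>B\<close>.\<close>
  define L where "L = (\<lambda>(x, t). x + t *\<^sub>R e) ` (K' \<times> {0..1})"
  have "compact L"
    unfolding L_def using K' by (intro compact_continuous_image compact_Times)
      (auto simp: case_prod_unfold intro!: continuous_intros)
  then have "compact ((\<lambda>x. grad u x $ i) ` L)"
    using gcont by (intro compact_continuous_image) (auto intro: continuous_on_subset)
  then obtain B where "\<forall>y\<in>(\<lambda>x. grad u x $ i) ` L. norm y \<le> B"
    using compact_imp_bounded bounded_iff by blast
  then have B: "\<bar>grad u (x + t *\<^sub>R e) $ i\<bar> \<le> B" if "x \<in> K'" "0 \<le> t" "t \<le> 1" for x t
    using that by (force simp: L_def)
  define h where "h n = 1 / real (Suc n)" for n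
  have h: "0 < h n" "h n \<le> 1" for n by (auto simp: h_def)
  have h0: "filterlim h (at 0) sequentially"
  proof (rule filterlim_atI)
    have "h = (\<lambda>n. inverse (real (Suc n)))" by (simp add: h_def fun_eq_iff inverse_eq_divide)
    then show "h \<longlonglongrightarrow> 0" using LIMSEQ_inverse_real_of_nat by simp
    show "\<forall>\<^sub>F n in sequentially. h n \<noteq> 0" using h(1) by (simp add: less_imp_neq[symmetric])
  qed
  define q where "q n x = (u (x + h n *\<^sub>R e) - u x) / h n" for n x
  have [measurable]: "q n \<in> borel_measurable borel" for n
    unfolding q_def by measurable
  have q_lim: "(\<lambda>n. q n x) \<longlonglongrightarrow> grad u x $ i" for x
    using filterlim_compose[OF D[of x 0, unfolded DERIV_def] h0] by (simp add: q_def)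
  have q_bound: "\<bar>q n x\<bar> \<le> B * indicator K' x" for n x
  proof (cases "x \<in> K'")
    case True
    have "\<exists>z>0. z < h n \<and> u (x + h n *\<^sub>R e) - u (x + 0 *\<^sub>R e) = (h n - 0) * grad u (x + z *\<^sub>R e) $ i"
      using h[of n] D by (intro MVT2) auto
    then obtain z where z: "0 < z" "z < h n" "u (x + h n *\<^sub>R e) - u (x + 0 *\<^sub>R e) = (h n - 0) * grad u (x + z *\<^sub>R e) $ i"
      by blast
    then have "q n x = grad u (x + z *\<^sub>R e) $ i" using h[of n] by (simp add: q_def)
    then show ?thesis using B[of x z] z h[of n] True by simp
  next
    case False
    then have "x + 0 *\<^sub>R e \<notin> K" "x + h n *\<^sub>R e \<notin> K"
      using in_K'[of x 0] in_K'[of x "h n"] h[of n] by auto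
    then show ?thesis using K(2) False by (simp add: q_def)
  qed
  have [measurable]: "K' \<in> sets borel" using K' by (intro borel_compact)
  have "(\<lambda>n. \<integral>x. q n x \<partial>lborel) \<longlonglongrightarrow> (\<integral>x. grad u x $ i \<partial>lborel)"
  proof (rule integral_dominated_convergence[where w = "\<lambda>x. B * indicator K' x"])
    show "integrable lborel (\<lambda>x. B * indicat_real K' x)"
      using emeasure_compact_finite[OF K']
      by (intro integrable_mult_right integrable_real_indicator) simp_all
  qed (use q_lim q_bound in auto)
  moreover have "(\<integral>x. q n x \<partial>lborel) = 0" for n
  proof -
    have ui: "integrable lborel u"
    proof -
      have "integrable lebesgue u"
      proof -
        have "u \<in> L2 K"
          using lmeasurable_compact[OF K(1)] by (intro L2_compact_support[OF ucont K] fmeasurableD)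
        then have "integrable (lebesgue_on K) u"
          by (rule L2_finite_measure_integrable[OF _ lmeasurable_compact[OF K(1)]])
        then have "integrable lebesgue (\<lambda>x. indicator K x *\<^sub>R u x)"
          using lmeasurable_compact[OF K(1)] by (subst (asm) integrable_restrict_space) auto
        also have "(\<lambda>x. indicator K x *\<^sub>R u x) = u" using K(2) by (auto simp: indicator_def fun_eq_iff)
        finally show ?thesis .
      qed
      then show ?thesis by (simp add: integrable_completion)
    qed
    have "integrable lborel (\<lambda>x. u (x + h n *\<^sub>R e))"
    proof -
      have "integrable (distr lborel borel ((+) (h n *\<^sub>R e))) u" using ui by (simp add: lborel_distr_plus)
      then have "integrable lborel (\<lambda>x. u (h n *\<^sub>R e + x))"
        by (subst (asm) integrable_distr_eq) simp_all
      then show ?thesis by (simp add: add.commute)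
    qed
    then have "(\<integral>x. u (x + h n *\<^sub>R e) - u x \<partial>lborel) = 0"
      using ui by (simp add: lborel_integral_translate)
    then show ?thesis unfolding q_def by simp
  qed
  ultimately have "(\<integral>x. grad u x $ i \<partial>lborel) = 0" by (simp add: LIMSEQ_const_iff)
  then show ?thesis by (simp add: integral_completion)
qed

text \<open>The gradient of the product of two test functions integrates to zero. Test functions
  thus belong to \<open>H1\<close>, and the approximation inside \<open>H10\<close> concerns
  classical gradients.\<close>

lemma test_function_weak_gradient:
  assumes A: "A \<in> sets lebesgue" and \<phi>: "\<phi> \<in> test_functions A"
  shows "is_weak_gradient A \<phi> (grad \<phi>)"
  unfolding is_weak_gradient_def
proof (intro conjI ballI allI)
  show "grad \<phi> \<in> L2 A" using \<phi> A by (rule test_functions_L2)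
  fix \<psi> :: "real^'a \<Rightarrow> real" and i assume \<psi>: "\<psi> \<in> test_functions A"
  obtain K where K: "\<And>k. Ck k \<phi>" "compact K" "K \<subseteq> A" "\<And>x. x \<notin> K \<Longrightarrow> \<phi> x = 0" "\<And>x. x \<notin> K \<Longrightarrow> grad \<phi> x = 0"
    using \<phi> by (elim test_functionsE) blast
  have C\<psi>: "Ck k \<psi>" for k using \<psi> by (auto simp: test_functions_def)
  have "((\<lambda>x. \<phi> x * \<psi> x) has_derivative (\<lambda>h. \<phi> x * (h \<bullet> grad \<psi> x) + (h \<bullet> grad \<phi> x) * \<psi> x)) (at x)" for x
    by (intro has_derivative_mult Ck_SucD[OF K(1)] Ck_SucD[OF C\<psi>])
  note D = this
  have g: "grad (\<lambda>x. \<phi> x * \<psi> x) x $ i = \<phi> x * grad \<psi> x $ i + grad \<phi> x $ i * \<psi> x" for x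
    by (simp add: grad_nth[OF D] inner_axis')
  have "(\<integral>x. \<phi> x * grad \<psi> x $ i + grad \<phi> x $ i * \<psi> x \<partial>lebesgue_on A)
      = (\<integral>x. \<phi> x * grad \<psi> x $ i + grad \<phi> x $ i * \<psi> x \<partial>lebesgue_on UNIV)"
  proof (rule integral_lebesgue_on_support[symmetric])
    fix x assume "x \<in> UNIV - A"
    then have "x \<notin> K" using K(3) by blast
    then show "\<phi> x * grad \<psi> x $ i + grad \<phi> x $ i * \<psi> x = 0" using K(4,5) by simp
  qed (use A in auto)
  also have "\<dots> = 0"
    using integral_grad_compact_support_eq_0[of "\<lambda>x. \<phi> x * \<psi> x" K i] Ck_mult[OF K(1) C\<psi>] K(2,4)
    unfolding g lebesgue_on_UNIV_eq by simp
  finally show "(\<integral>x. \<phi> x * grad \<psi> x $ i \<partial>lebesgue_on A) = - (\<integral>x. grad \<phi> x $ i * \<psi> x \<partial>lebesgue_on A)"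
    using test_functions_L2[OF \<phi> A] test_functions_L2[OF \<psi> A]
    by (simp add: L2_mult_integrable L2_nth)
qed

lemma test_function_H1:
  assumes "open A" "A \<in> lmeasurable" "\<phi> \<in> test_functions A"
  shows "\<phi> \<in> H1 A" "AE x in lebesgue_on A. weak_grad A \<phi> x = grad \<phi> x"
proof -
  have A: "A \<in> sets lebesgue" using assms(1) by auto
  show "\<phi> \<in> H1 A" "AE x in lebesgue_on A. weak_grad A \<phi> x = grad \<phi> x"
    using weak_gradient_H1[OF test_functions_L2(1)[OF assms(3) A] test_function_weak_gradient[OF A assms(3)] assms(1,2)]
    by auto
qed

section \<open>The \<open>H1\<close> norm and the closure of the test functions in it\<close>

lemma L2_norm_cong:
  assumes "u \<in> L2 A" "w \<in> L2 A" "AE x in lebesgue_on A. u x = w x"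
  shows "L2_norm A u = L2_norm A w"
proof (rule power2_eq_imp_eq)
  show "(L2_norm A u)\<^sup>2 = (L2_norm A w)\<^sup>2"
    unfolding L2_norm_power2 by (rule L2_inner_cong[OF assms(1,1,2,2,3,3)])
qed simp_all

lemma H1_norm_ge: "L2_norm A u \<le> H1_norm A u" "L2_norm A (weak_grad A u) \<le> H1_norm A u"
  by (simp_all add: H1_norm_def)

lemma H1_norm_triangle:
  assumes "open A" "A \<in> lmeasurable" "u \<in> H1 A" "w \<in> H1 A"
  shows "H1_norm A (\<lambda>x. u x - w x) \<le> H1_norm A u + H1_norm A w"
proof -
  have "L2_norm A (weak_grad A (\<lambda>x. u x - w x)) = L2_norm A (\<lambda>x. weak_grad A u x - weak_grad A w x)"
    using assms by (intro L2_norm_cong H1_diff L2_diff weak_grad_L2)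
  also have "\<dots> \<le> L2_norm A (weak_grad A u) + L2_norm A (weak_grad A w)"
    using assms by (intro L2_norm_triangle weak_grad_L2)
  finally have "H1_norm A (\<lambda>x. u x - w x) \<le> sqrt ((L2_norm A u + L2_norm A w)\<^sup>2
      + (L2_norm A (weak_grad A u) + L2_norm A (weak_grad A w))\<^sup>2)"
    unfolding H1_norm_def using assms
    by (intro real_sqrt_le_mono add_mono power_mono L2_norm_triangle H1_L2) auto
  also have "\<dots> \<le> H1_norm A u + H1_norm A w"
    unfolding H1_norm_def by (rule real_sqrt_sum_squares_triangle_ineq)
  finally show ?thesis .
qed

lemma H10_H1: "u \<in> H10 A \<Longrightarrow> u \<in> H1 A"
  unfolding H10_def by blast

lemma H10_diff:
  assumes A: "open A" "A \<in> lmeasurable" and u: "u \<in> H10 A" and w: "w \<in> H10 A"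
  shows "(\<lambda>x. u x - w x) \<in> H10 A"
proof -
  have "\<exists>\<phi>\<in>test_functions A. H1_norm A (\<lambda>x. u x - w x - \<phi> x) < e" if "0 < e" for e
  proof -
    have "0 < e / 2" using that by simp
    then obtain \<phi> \<psi> where \<phi>: "\<phi> \<in> test_functions A" "H1_norm A (\<lambda>x. u x - \<phi> x) < e / 2"
      and \<psi>: "\<psi> \<in> test_functions A" "H1_norm A (\<lambda>x. w x - \<psi> x) < e / 2"
      using u w unfolding H10_def by blast
    have "H1_norm A (\<lambda>x. u x - w x - (\<phi> x - \<psi> x)) = H1_norm A (\<lambda>x. (u x - \<phi> x) - (w x - \<psi> x))"
      by (rule arg_cong[where f = "H1_norm A"]) (simp add: fun_eq_iff)
    also have "\<dots> \<le> H1_norm A (\<lambda>x. u x - \<phi> x) + H1_norm A (\<lambda>x. w x - \<psi> x)"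
      using A u w \<phi>(1) \<psi>(1) by (intro H1_norm_triangle H1_diff(1) H10_H1 test_function_H1(1))
    also have "\<dots> < e" using \<phi>(2) \<psi>(2) by simp
    finally show ?thesis
      using test_functions_diff[OF \<phi>(1) \<psi>(1)] by (intro bexI)
  qed
  moreover have "(\<lambda>x. u x - w x) \<in> H1 A" using A H10_H1[OF u] H10_H1[OF w] by (rule H1_diff(1))
  ultimately show ?thesis by (simp add: H10_def)
qed

text \<open>The definition of the weak divergence gives the formula for test functions, and both
  sides are continuous in the \<open>H1\<close> norm.\<close>

lemma weak_divergence_H10:
  assumes A: "open A" "A \<in> lmeasurable" and v: "v \<in> L2 A" "is_weak_divergence A v w"
    and u: "u \<in> H10 A"
  shows "L2_inner A v (weak_grad A u) = - L2_inner A w u"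
proof -
  have w: "w \<in> L2 A" using v by (simp add: is_weak_divergence_def)
  have meas: "A \<in> sets lebesgue" using A by auto
  let ?d = "L2_inner A v (weak_grad A u) + L2_inner A w u"
  let ?C = "L2_norm A v + L2_norm A w"
  have bound: "\<bar>?d\<bar> \<le> ?C * e" if "0 < e" for e
  proof -
    obtain \<phi> where \<phi>: "\<phi> \<in> test_functions A" "H1_norm A (\<lambda>x. u x - \<phi> x) < e"
      using u \<open>0 < e\<close> unfolding H10_def by blast
    note \<phi>_L2 = test_functions_L2[OF \<phi>(1) meas] and \<phi>_H1 = test_function_H1[OF A \<phi>(1)]
    have diff: "(\<lambda>x. u x - \<phi> x) \<in> H1 A"
      using A H10_H1[OF u] \<phi>_H1(1) by (rule H1_diff(1))
    have "AE x in lebesgue_on A. weak_grad A (\<lambda>x. u x - \<phi> x) x = weak_grad A u x - grad \<phi> x"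
      using H1_diff(2)[OF A H10_H1[OF u] \<phi>_H1(1)] \<phi>_H1(2) by eventually_elim simp
    then have "L2_inner A v (weak_grad A (\<lambda>x. u x - \<phi> x)) = L2_inner A v (\<lambda>x. weak_grad A u x - grad \<phi> x)"
      using v diff u \<phi>_L2 by (intro L2_inner_cong weak_grad_L2 L2_diff) (auto intro: H10_H1)
    also have "\<dots> = L2_inner A v (weak_grad A u) - L2_inner A v (grad \<phi>)"
      using v u \<phi>_L2 by (intro L2_inner_diff weak_grad_L2 H10_H1)
    also have "L2_inner A v (grad \<phi>) = - L2_inner A w \<phi>"
      using v(2) \<phi>(1) by (simp add: is_weak_divergence_def)
    finally have "?d = L2_inner A v (weak_grad A (\<lambda>x. u x - \<phi> x)) + L2_inner A w (\<lambda>x. u x - \<phi> x)"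
      using w u \<phi>_L2 by (simp add: L2_inner_diff H1_L2 H10_H1)
    also have "\<bar>\<dots>\<bar> \<le> L2_norm A v * L2_norm A (weak_grad A (\<lambda>x. u x - \<phi> x))
        + L2_norm A w * L2_norm A (\<lambda>x. u x - \<phi> x)"
      using L2_Cauchy_Schwarz[OF v(1) weak_grad_L2[OF diff]] L2_Cauchy_Schwarz[OF w H1_L2[OF diff]]
      by linarith
    also have "\<dots> \<le> L2_norm A v * e + L2_norm A w * e"
      using H1_norm_ge[where A = A and u = "\<lambda>x. u x - \<phi> x"] \<phi>(2) by (intro add_mono mult_left_mono) auto
    finally show ?thesis by (simp add: distrib_right)
  qed
  have "?d = 0"
  proof (rule ccontr)
    assume "?d \<noteq> 0"
    moreover have C: "0 < ?C + 1"
      using L2_norm_ge_0[of A v] L2_norm_ge_0[of A w] by linarith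
    \<comment> \<open>The summand 1 makes the denominator positive and the bound
      \<open>?C * e\<close> strictly smaller than the defect itself.\<close>
    ultimately have e: "0 < \<bar>?d\<bar> / (?C + 1)" by (intro divide_pos_pos) simp_all
    have "?C * (\<bar>?d\<bar> / (?C + 1)) < (?C + 1) * (\<bar>?d\<bar> / (?C + 1))"
      using e by (intro mult_strict_right_mono) auto
    also have "\<dots> = \<bar>?d\<bar>" using C by simp
    finally show False using bound[OF e] by simp
  qed
  then show ?thesis by simp
qed

section \<open>Meshes\<close>

lemma negligible_imp_AE: "negligible N \<Longrightarrow> AE x in lebesgue. x \<notin> N"
  unfolding negligible_iff_null_sets by (rule AE_not_in)

lemma AE_lebesgue_onI: "A \<in> sets lebesgue \<Longrightarrow> AE x in lebesgue. x \<in> A \<longrightarrow> P x \<Longrightarrow> AE x in lebesgue_on A. P x"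
  by (simp add: AE_restrict_space_iff)

lemma AE_lebesgue_onD: "A \<in> sets lebesgue \<Longrightarrow> AE x in lebesgue_on A. P x \<Longrightarrow> AE x in lebesgue. x \<in> A \<longrightarrow> P x"
  by (simp add: AE_restrict_space_iff)

lemma AE_lebesgue_on_almost_subset:
  assumes "AE x in lebesgue_on A. P x" "A \<in> sets lebesgue" "B \<in> sets lebesgue" "negligible (B - A)"
  shows "AE x in lebesgue_on B. P x"
proof (rule AE_lebesgue_onI[OF assms(3)])
  show "AE x in lebesgue. x \<in> B \<longrightarrow> P x"
    using AE_lebesgue_onD[OF assms(2,1)] negligible_imp_AE[OF assms(4)] by eventually_elim auto
qed

lemma L2_sum: "finite I \<Longrightarrow> A \<in> lmeasurable \<Longrightarrow> (\<And>i. i \<in> I \<Longrightarrow> u i \<in> L2 A) \<Longrightarrow> (\<lambda>x. \<Sum>i\<in>I. u i x) \<in> L2 A"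
  by (induction rule: finite_induct) (auto intro: L2_add L2_const)

lemma L2_extend_zero:
  fixes u :: "real^'d \<Rightarrow> 'b::euclidean_space"
  assumes u: "u \<in> L2 B" and "B \<subseteq> A" and sets: "A \<in> sets lebesgue" "B \<in> sets lebesgue"
  shows "(\<lambda>x. indicator B x *\<^sub>R u x) \<in> L2 A"
proof -
  have meas: "(\<lambda>x. indicator B x *\<^sub>R u x) \<in> borel_measurable lebesgue"
    using L2_measurable[OF u] sets(2) by (subst (asm) borel_measurable_restrict_space_iff) auto
  have "integrable lebesgue (\<lambda>x. indicator B x *\<^sub>R (norm (u x))\<^sup>2)"
    using L2_integrable[OF u] sets(2) by (subst (asm) integrable_restrict_space) auto
  also have "(\<lambda>x. indicator B x *\<^sub>R (norm (u x))\<^sup>2) = (\<lambda>x. (norm (indicator B x *\<^sub>R u x))\<^sup>2)"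
    by (auto simp: indicator_def fun_eq_iff)
  finally have "(\<lambda>x. indicator B x *\<^sub>R u x) \<in> L2 UNIV"
    using meas unfolding L2_def lebesgue_on_UNIV_eq by simp
  then show ?thesis using sets(1) by (intro L2_subset[of _ UNIV A]) auto
qed

locale coarse_mesh =
  fixes \<Omega> :: "(real^'d) set" and \<tau> \<T> :: "(real^'d) set set"
    and sub :: "(real^'d) set \<Rightarrow> (real^'d) set set"
  assumes domain: "polygonal_domain \<Omega>"
    and fine: "fine_triangulation \<Omega> \<tau>"
    and coarse: "coarse_partition \<Omega> \<tau> \<T> sub"
begin

lemma open_domain: "open \<Omega>" and domain_lmeasurable: "\<Omega> \<in> lmeasurable"
  and domain_sets: "\<Omega> \<in> sets lebesgue"
  using domain by (auto simp: polygonal_domain_def lmeasurable_open)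

lemma finite_fine: "finite \<tau>"
  using fine by (simp add: fine_triangulation_def triangulation_def)

lemma fine_simplex: "t \<in> \<tau> \<Longrightarrow> int CARD('d) simplex t"
  and fine_interior_subset: "t \<in> \<tau> \<Longrightarrow> interior t \<subseteq> \<Omega>"
  using fine unfolding fine_triangulation_def by blast+

lemma fine_convex: "t \<in> \<tau> \<Longrightarrow> convex t" and fine_compact: "t \<in> \<tau> \<Longrightarrow> compact t"
  using fine_simplex convex_simplex compact_simplex by blast+

lemma fine_sets: "t \<in> \<tau> \<Longrightarrow> t \<in> sets lebesgue"
  using fine_compact lmeasurable_compact by blast

text \<open>Positive measure is what gives the essential infimum over \<open>t\<close> a value: on a
  null set every real number is a lower bound almost everywhere.\<close>

lemma fine_not_negligible:
  assumes "t \<in> \<tau>"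
  shows "\<not> negligible t"
proof -
  have "aff_dim t = int CARD('d)"
    using fine_simplex[OF assms] by (rule aff_dim_simplex)
  then have "rel_interior t = interior t" "t \<noteq> {}"
    using interior_rel_interior[of t] by auto
  then have "interior t \<noteq> {}"
    using rel_interior_eq_empty[OF fine_convex[OF assms]] by simp
  then show ?thesis using negligible_convex_interior[OF fine_convex[OF assms]] by simp
qed

lemma fine_frontier_negligible: "t \<in> \<tau> \<Longrightarrow> negligible (t - interior t)"
  using negligible_convex_frontier[OF fine_convex, of t] compact_imp_closed[OF fine_compact, of t]
  by (simp add: frontier_def)

text \<open>The intersection is a face of both simplices and, as they differ, a proper face of at
  least one. Its dimension therefore drops, and a convex set without interior is a null set.\<close>

lemma fine_Int_negligible:
  assumes t: "t \<in> \<tau>" "t' \<in> \<tau>" "t \<noteq> t'"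
  shows "negligible (t \<inter> t')"
proof -
  have dim: "aff_dim s = int CARD('d)" if "s \<in> \<tau>" for s
    using fine_simplex[OF that] by (rule aff_dim_simplex)
  have face: "(t \<inter> t') face_of t" "(t \<inter> t') face_of t'"
    using t fine unfolding fine_triangulation_def triangulation_def by (blast, metis Int_commute)
  have "aff_dim (t \<inter> t') < int CARD('d)"
  proof (cases "t \<inter> t' = t")
    case True
    then have "t \<inter> t' \<noteq> t'" using t(3) by simp
    from face_of_aff_dim_lt[OF fine_convex[OF t(2)] face(2) this] show ?thesis using dim[OF t(2)] by simp
  next
    case False
    from face_of_aff_dim_lt[OF fine_convex[OF t(1)] face(1) this] show ?thesis using dim[OF t(1)] by simp
  qed
  then have "interior (t \<inter> t') = {}" by (intro low_dim_interior) simp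
  then show ?thesis
    using negligible_convex_interior[OF convex_Int[OF fine_convex[OF t(1)] fine_convex[OF t(2)]]] by simp
qed

lemma fine_interiors_disjoint:
  assumes "t \<in> \<tau>" "t' \<in> \<tau>" "x \<in> interior t" "x \<in> interior t'"
  shows "t = t'"
proof (rule ccontr)
  assume "t \<noteq> t'"
  then have "negligible (interior t \<inter> interior t')"
    using assms interior_subset by (intro negligible_subset[OF fine_Int_negligible[of t t']]) auto
  then show False using open_not_negligible[of "interior t \<inter> interior t'"] assms by auto
qed

lemma coarse_open: "T \<in> \<T> \<Longrightarrow> open T" and coarse_subset: "T \<in> \<T> \<Longrightarrow> T \<subseteq> \<Omega>"
  and coarse_sub_nonempty: "T \<in> \<T> \<Longrightarrow> sub T \<noteq> {}"
  using coarse unfolding coarse_partition_def by simp_all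

lemma coarse_sub: "T \<in> \<T> \<Longrightarrow> sub T \<subseteq> \<tau>"
  using coarse unfolding coarse_partition_def by blast

lemma coarse_sub_disjoint: "T \<in> \<T> \<Longrightarrow> T' \<in> \<T> \<Longrightarrow> T \<noteq> T' \<Longrightarrow> sub T \<inter> sub T' = {}"
  using coarse unfolding coarse_partition_def disjoint_family_on_def by simp

lemma coarse_negligible:
  assumes "T \<in> \<T>"
  shows "negligible (T - \<Union>(sub T))" "negligible (\<Union>(sub T) - T)"
proof -
  have "negligible (sym_diff T (\<Union>(sub T)))"
    using coarse assms unfolding coarse_partition_def by simp
  then show "negligible (T - \<Union>(sub T))" "negligible (\<Union>(sub T) - T)"
    by (auto intro: negligible_subset)
qed

lemma coarse_sets: "T \<in> \<T> \<Longrightarrow> T \<in> sets lebesgue"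
  using coarse_open by auto

lemma coarse_lmeasurable: "T \<in> \<T> \<Longrightarrow> T \<in> lmeasurable"
  using domain_lmeasurable coarse_subset coarse_sets by (rule fmeasurableI2)

text \<open>Finiteness is inherited from \<tau>: the sets \<open>sub T\<close> are nonempty and
  disjoint, so \<open>sub\<close> is injective with values in a finite power set.\<close>

lemma finite_coarse: "finite \<T>"
proof (rule finite_imageD)
  show "finite (sub ` \<T>)"
    using coarse_sub finite_fine by (auto intro: finite_subset[of _ "Pow \<tau>"])
  show "inj_on sub \<T>"
  proof (intro inj_onI)
    fix S T assume ST: "S \<in> \<T>" "T \<in> \<T>" "sub S = sub T"
    show "S = T"
    proof (rule ccontr)
      assume "S \<noteq> T"
      from coarse_sub_disjoint[OF ST(1,2) this] coarse_sub_nonempty[OF ST(1)] ST(3)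
      show False by simp
    qed
  qed
qed

text \<open>Being unions of simplices only up to null sets, two coarse elements at first have just a
  negligible intersection; since they are open it must be empty.\<close>

lemma coarse_disjoint:
  assumes T: "T \<in> \<T>" "T' \<in> \<T>" "T \<noteq> T'"
  shows "T \<inter> T' = {}"
proof -
  have "sub T \<inter> sub T' = {}"
    using T by (rule coarse_sub_disjoint)
  then have "negligible (t \<inter> t')" if "t \<in> sub T" "t' \<in> sub T'" for t t'
    using that coarse_sub[OF T(1)] coarse_sub[OF T(2)] by (intro fine_Int_negligible) auto
  moreover have "finite (sub S)" if "S \<in> \<T>" for S
    using coarse_sub[OF that] finite_fine by (rule finite_subset)
  ultimately have "negligible (\<Union>(t, t')\<in>sub T \<times> sub T'. t \<inter> t')"
    using T(1,2) by (intro negligible_Union finite_imageI finite_cartesian_product) auto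
  then have "negligible ((\<Union>(t, t')\<in>sub T \<times> sub T'. t \<inter> t') \<union> ((T - \<Union>(sub T)) \<union> (T' - \<Union>(sub T'))))"
    using coarse_negligible(1) T by (intro negligible_Un) auto
  then have "negligible (T \<inter> T')"
    by (rule negligible_subset) fastforce
  then show ?thesis
    using open_not_negligible[of "T \<inter> T'"] coarse_open T by auto
qed

lemma AE_fine_interior:
  assumes "T \<in> \<T>"
  shows "AE x in lebesgue_on T. \<exists>t\<in>sub T. x \<in> interior t"
proof (rule AE_lebesgue_onI[OF coarse_sets[OF assms]])
  have "negligible (\<Union>t\<in>sub T. t - interior t)"
    using coarse_sub[OF assms] finite_subset[OF _ finite_fine] fine_frontier_negligible
    by (intro negligible_Union) auto
  from negligible_imp_AE[OF this] negligible_imp_AE[OF coarse_negligible(1)[OF assms]]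
  show "AE x in lebesgue. x \<in> T \<longrightarrow> (\<exists>t\<in>sub T. x \<in> interior t)"
    by eventually_elim blast
qed

lemma AE_coarse: "AE x in lebesgue_on \<Omega>. \<exists>T\<in>\<T>. x \<in> T"
proof (rule AE_lebesgue_onI[OF domain_sets])
  have "negligible (\<Union>T\<in>\<T>. \<Union>(sub T) - T)"
    using coarse_negligible(2) finite_coarse by (intro negligible_Union) auto
  from negligible_imp_AE[OF this]
  have "AE x in lebesgue. x \<notin> (\<Union>T\<in>\<T>. \<Union>(sub T) - T)" .
  moreover have "\<Omega> \<subseteq> \<Union>(\<Union>(sub ` \<T>))"
    using coarse fine closure_subset[of \<Omega>] by (simp add: coarse_partition_def fine_triangulation_def)
  ultimately show "AE x in lebesgue. x \<in> \<Omega> \<longrightarrow> (\<exists>T\<in>\<T>. x \<in> T)"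
    by (elim eventually_mono) blast
qed

lemma AE_coarse_imp_domain:
  assumes "\<And>T. T \<in> \<T> \<Longrightarrow> AE x in lebesgue_on T. P x"
  shows "AE x in lebesgue_on \<Omega>. P x"
proof (rule AE_lebesgue_onI[OF domain_sets])
  have "AE x in lebesgue. \<forall>T\<in>\<T>. x \<in> T \<longrightarrow> P x"
    using assms coarse_sets by (intro AE_finite_allI[OF finite_coarse] AE_lebesgue_onD)
  then show "AE x in lebesgue. x \<in> \<Omega> \<longrightarrow> P x"
    using AE_lebesgue_onD[OF domain_sets AE_coarse] by eventually_elim blast
qed

lemma AE_domain_imp_coarse: "AE x in lebesgue_on \<Omega>. P x \<Longrightarrow> T \<in> \<T> \<Longrightarrow> AE x in lebesgue_on T. P x"
  by (rule AE_lebesgue_on_subset[OF _ coarse_subset domain_sets coarse_sets])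

text \<open>A closed simplex may leave the open domain, but only along its frontier.\<close>

lemma AE_domain_imp_fine:
  assumes "AE x in lebesgue_on \<Omega>. P x" "t \<in> \<tau>"
  shows "AE x in lebesgue_on t. P x"
proof (rule AE_lebesgue_on_almost_subset[OF assms(1) domain_sets fine_sets[OF assms(2)]])
  show "negligible (t - \<Omega>)"
    using fine_interior_subset[OF assms(2)]
    by (intro negligible_subset[OF fine_frontier_negligible[OF assms(2)]]) auto
qed

text \<open>The property may depend on \<open>t\<close>, as the ellipticity constant and the value
  of \<kappa> do. Putting the point in the interior of \<open>t\<close> determines \<open>t\<close>
  uniquely.\<close>

lemma AE_fine_imp_coarse:
  assumes "T \<in> \<T>" "\<And>t. t \<in> sub T \<Longrightarrow> AE x in lebesgue_on t. P t x"
  shows "AE x in lebesgue_on T. \<exists>t\<in>sub T. x \<in> interior t \<and> P t x"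
proof (rule AE_lebesgue_onI[OF coarse_sets[OF assms(1)]])
  have "finite (sub T)" using coarse_sub[OF assms(1)] finite_fine by (rule finite_subset)
  then have "AE x in lebesgue. \<forall>t\<in>sub T. x \<in> t \<longrightarrow> P t x"
    using assms(2) fine_sets coarse_sub[OF assms(1)] by (intro AE_finite_allI AE_lebesgue_onD) auto
  then show "AE x in lebesgue. x \<in> T \<longrightarrow> (\<exists>t\<in>sub T. x \<in> interior t \<and> P t x)"
    using AE_lebesgue_onD[OF coarse_sets[OF assms(1)] AE_fine_interior[OF assms(1)]]
  proof eventually_elim
    case (elim x)
    then show ?case using interior_subset by blast
  qed
qed

lemma sum_integral_coarse:
  fixes h :: "real^'d \<Rightarrow> real"
  assumes h: "integrable (lebesgue_on \<Omega>) h"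
  shows "(\<Sum>T\<in>\<T>. integral\<^sup>L (lebesgue_on T) h) = integral\<^sup>L (lebesgue_on \<Omega>) h"
proof -
  have ind: "integrable (lebesgue_on \<Omega>) (\<lambda>x. indicator T x *\<^sub>R h x)" if "T \<in> \<T>" for T
    using h coarse_sets[OF that] coarse_subset[OF that] domain_sets
    by (intro integrable_mult_indicator) (auto simp: sets_restrict_space_iff)
  have "integral\<^sup>L (lebesgue_on T) h = (\<integral>x. indicator T x *\<^sub>R h x \<partial>lebesgue_on \<Omega>)" if "T \<in> \<T>" for T
  proof -
    have "integral\<^sup>L (lebesgue_on T) h = (\<integral>x. (if x \<in> T then h x else 0) \<partial>lebesgue_on \<Omega>)"
      using coarse_sets[OF that] coarse_subset[OF that] domain_sets by (simp add: integral_restrict)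
    also have "\<dots> = (\<integral>x. indicator T x *\<^sub>R h x \<partial>lebesgue_on \<Omega>)"
      by (intro Bochner_Integration.integral_cong) (auto simp: indicator_def)
    finally show ?thesis .
  qed
  then have "(\<Sum>T\<in>\<T>. integral\<^sup>L (lebesgue_on T) h) = (\<Sum>T\<in>\<T>. \<integral>x. indicator T x *\<^sub>R h x \<partial>lebesgue_on \<Omega>)"
    by simp
  also have "\<dots> = (\<integral>x. (\<Sum>T\<in>\<T>. indicator T x *\<^sub>R h x) \<partial>lebesgue_on \<Omega>)"
    using ind by (intro Bochner_Integration.integral_sum[symmetric])
  also have "\<dots> = integral\<^sup>L (lebesgue_on \<Omega>) h"
  proof (rule integral_cong_AE)
    show "(\<lambda>x. \<Sum>T\<in>\<T>. indicator T x *\<^sub>R h x) \<in> borel_measurable (lebesgue_on \<Omega>)"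
      using ind by (intro borel_measurable_sum borel_measurable_integrable)
    show "AE x in lebesgue_on \<Omega>. (\<Sum>T\<in>\<T>. indicator T x *\<^sub>R h x) = h x"
      using AE_coarse
    proof eventually_elim
      case (elim x)
      then obtain T where T: "T \<in> \<T>" "x \<in> T" by blast
      then have "indicat_real S x = (if S = T then 1 else 0)" if "S \<in> \<T>" for S
        using coarse_disjoint[OF that T(1)] T(2) by (auto simp: indicator_def)
      then have "(\<Sum>S\<in>\<T>. indicator S x *\<^sub>R h x) = (\<Sum>S\<in>\<T>. if S = T then h x else 0)"
        by (intro sum.cong) auto
      then show ?case using finite_coarse T(1) by simp
    qed
  qed (use h in auto)
  finally show ?thesis .
qed

section \<open>Broken gradients\<close>

lemma broken_grad_interior:
  assumes "t \<in> \<tau>" "x \<in> interior t"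
  shows "broken_grad \<tau> q x = weak_grad (interior t) q x"
proof -
  have "indicator (interior s) x *\<^sub>R weak_grad (interior s) q x = 0" if "s \<in> \<tau> - {t}" for s
  proof -
    have "x \<notin> interior s"
      using fine_interiors_disjoint[of s t x] that assms by blast
    then show ?thesis by simp
  qed
  then have "(\<Sum>s\<in>\<tau> - {t}. indicator (interior s) x *\<^sub>R weak_grad (interior s) q x) = 0"
    by (rule sum.neutral[rule_format])
  then show ?thesis
    unfolding broken_grad_def sum.remove[OF finite_fine assms(1)] using assms(2) by simp
qed

lemma interior_lmeasurable: "t \<in> \<tau> \<Longrightarrow> interior t \<in> lmeasurable"
  using domain_lmeasurable fine_interior_subset by (rule fmeasurableI2) auto

lemma broken_grad_L2:
  assumes "q \<in> broken_H1 \<Omega> \<tau>"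
  shows "broken_grad \<tau> q \<in> L2 \<Omega>"
proof -
  have "broken_grad \<tau> q = (\<lambda>x. \<Sum>t\<in>\<tau>. indicator (interior t) x *\<^sub>R weak_grad (interior t) q x)"
    by (simp add: broken_grad_def fun_eq_iff)
  moreover have "(\<lambda>x. indicator (interior t) x *\<^sub>R weak_grad (interior t) q x) \<in> L2 \<Omega>" if "t \<in> \<tau>" for t
    using assms that fine_interior_subset[OF that] domain_sets
    by (intro L2_extend_zero weak_grad_L2) (auto simp: broken_H1_def)
  ultimately show ?thesis using finite_fine domain_lmeasurable by (simp only: L2_sum)
qed

lemma AE_broken_gradI:
  assumes "\<And>t. t \<in> \<tau> \<Longrightarrow> AE x in lebesgue_on (interior t). P x"
  shows "AE x in lebesgue_on \<Omega>. P x"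
proof (rule AE_coarse_imp_domain)
  fix T assume T: "T \<in> \<T>"
  have "AE x in lebesgue_on t. P x" if "t \<in> sub T" for t
  proof -
    have "t \<in> \<tau>" using coarse_sub[OF T] that by blast
    then show ?thesis
      by (intro AE_lebesgue_on_almost_subset[OF assms _ fine_sets fine_frontier_negligible]) auto
  qed
  then have "AE x in lebesgue_on T. \<exists>t\<in>sub T. x \<in> interior t \<and> P x"
    by (rule AE_fine_imp_coarse[OF T])
  then show "AE x in lebesgue_on T. P x"
    by eventually_elim blast
qed

lemma H1_broken_H1: "q \<in> H1 \<Omega> \<Longrightarrow> q \<in> broken_H1 \<Omega> \<tau>"
  using H1_subset(1)[OF open_domain domain_lmeasurable open_interior fine_interior_subset]
  by (simp add: broken_H1_def H1_L2)

text \<open>The weak equation is written with broken gradients, the Green formula with the gradient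
  on the whole domain; for conforming functions this identity joins them.\<close>

lemma broken_grad_H1:
  assumes "q \<in> H1 \<Omega>"
  shows "AE x in lebesgue_on \<Omega>. broken_grad \<tau> q x = weak_grad \<Omega> q x"
proof (rule AE_broken_gradI)
  fix t assume t: "t \<in> \<tau>"
  have "AE x in lebesgue_on (interior t). x \<in> interior t" by (intro AE_I2) auto
  with H1_subset(2)[OF open_domain domain_lmeasurable open_interior fine_interior_subset[OF t] assms]
  show "AE x in lebesgue_on (interior t). broken_grad \<tau> q x = weak_grad \<Omega> q x"
    by eventually_elim (simp add: broken_grad_interior[OF t])
qed

text \<open>The gradient of a difference is chosen independently of the two others, so linearity
  holds only up to a null set.\<close>

lemma broken_grad_diff:
  assumes "q \<in> broken_H1 \<Omega> \<tau>" "r \<in> broken_H1 \<Omega> \<tau>"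
  shows "(\<lambda>x. q x - r x) \<in> broken_H1 \<Omega> \<tau>"
    and "AE x in lebesgue_on \<Omega>. broken_grad \<tau> (\<lambda>x. q x - r x) x = broken_grad \<tau> q x - broken_grad \<tau> r x"
proof -
  have qr: "q \<in> H1 (interior t)" "r \<in> H1 (interior t)" if "t \<in> \<tau>" for t
    using assms that by (auto simp: broken_H1_def)
  show "(\<lambda>x. q x - r x) \<in> broken_H1 \<Omega> \<tau>"
    using assms qr H1_diff(1)[OF open_interior interior_lmeasurable] by (auto simp: broken_H1_def L2_diff)
  show "AE x in lebesgue_on \<Omega>. broken_grad \<tau> (\<lambda>x. q x - r x) x = broken_grad \<tau> q x - broken_grad \<tau> r x"
  proof (rule AE_broken_gradI)
    fix t assume t: "t \<in> \<tau>"
    have "AE x in lebesgue_on (interior t). x \<in> interior t" by (intro AE_I2) auto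
    with H1_diff(2)[OF open_interior interior_lmeasurable[OF t] qr[OF t]]
    show "AE x in lebesgue_on (interior t).
        broken_grad \<tau> (\<lambda>x. q x - r x) x = broken_grad \<tau> q x - broken_grad \<tau> r x"
      by eventually_elim (simp add: broken_grad_interior[OF t])
  qed
qed

end

section \<open>The diffusion tensor\<close>

text \<open>A bound on the quadratic form becomes a bound on the operator by the Cauchy-Schwarz
  inequality of the semidefinite form, applied to \<open>y\<close> and \<open>A *v y\<close>. Square
  integrability of tensor times gradient depends on it.\<close>

lemma positive_symmetric_norm_le:
  fixes A :: "real^'d^'d"
  assumes A: "symmetric_matrix A" and ge: "\<And>y. 0 \<le> y \<bullet> (A *v y)"
    and le: "\<And>y. y \<bullet> (A *v y) \<le> C * (norm y)\<^sup>2"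
  shows "norm (A *v y) \<le> C * norm y"
proof (cases "A *v y = 0")
  case True
  have "0 \<le> C" if "y \<noteq> 0"
    using order_trans[OF ge le, of y] that by (simp add: zero_le_mult_iff)
  then show ?thesis using True by (cases "y = 0") auto
next
  case False
  let ?z = "A *v y"
  have "0 \<le> C * (norm ?z)\<^sup>2" using ge le by (rule order_trans)
  then have C: "0 \<le> C" using False by (simp add: zero_le_mult_iff)
  have "(?z \<bullet> ?z)\<^sup>2 \<le> (y \<bullet> (A *v y)) * (?z \<bullet> (A *v ?z))"
    by (rule quadratic_nonneg_discriminant)
      (use ge symmetric_matrix_quadratic[OF A, of y _ ?z, symmetric] in auto)
  also have "\<dots> \<le> (C * (norm y)\<^sup>2) * (C * (norm ?z)\<^sup>2)"
    using C by (intro mult_mono le ge) auto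
  finally have "((norm ?z)\<^sup>2)\<^sup>2 \<le> (C * norm y * norm ?z)\<^sup>2"
    by (simp add: power2_norm_eq_inner power_mult_distrib) (simp add: power2_eq_square ac_simps)
  then have "(norm ?z)\<^sup>2 \<le> C * norm y * norm ?z"
    by (rule power2_le_imp_le) (use C in simp)
  then show ?thesis using False by (simp add: power2_eq_square)
qed

lemma borel_measurable_matrix_vector_mult:
  fixes M :: "'a \<Rightarrow> real^'d^'d"
  assumes "M \<in> borel_measurable N" "g \<in> borel_measurable N"
  shows "(\<lambda>x. M x *v g x) \<in> borel_measurable N"
proof (rule borel_measurable_continuous_Pair[OF assms])
  have "(\<lambda>p. fst p *v snd p) = (\<lambda>p. \<chi> i. (fst p :: real^'d^'d) $ i \<bullet> snd p)"
    by (simp add: fun_eq_iff vec_eq_iff matrix_vector_mul_component)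
  then show "continuous_on UNIV (\<lambda>p. (fst p :: real^'d^'d) *v snd p)"
    by (simp only:) (intro continuous_intros)
qed

text \<open>Completeness of the Lebesgue measure: changing a function on a null set keeps it
  measurable.\<close>

lemma borel_measurable_lebesgue_on_AE:
  fixes f g :: "real^'d \<Rightarrow> real"
  assumes T: "T \<in> sets lebesgue" and f: "f \<in> borel_measurable (lebesgue_on T)"
    and "AE x in lebesgue_on T. f x = g x"
  shows "g \<in> borel_measurable (lebesgue_on T)"
proof -
  have T': "T \<inter> space lebesgue \<in> sets lebesgue" using T by simp
  have "(\<lambda>x. indicator T x *\<^sub>R f x) \<in> borel_measurable lebesgue"
    using f unfolding borel_measurable_restrict_space_iff[OF T'] .
  moreover have "AE x in lebesgue. indicator T x *\<^sub>R f x = indicator T x *\<^sub>R g x"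
    using AE_lebesgue_onD[OF T assms(3)] by eventually_elim (auto simp: indicator_def)
  ultimately have "(\<lambda>x. indicator T x *\<^sub>R g x) \<in> borel_measurable lebesgue"
    by (rule borel_measurable_AE)
  then show ?thesis unfolding borel_measurable_restrict_space_iff[OF T'] .
qed

text \<open>The lower bound makes the set of essential lower bounds nonempty; the upper bound on a
  space that is not null makes it bounded above, so the real supremum is genuine. It is itself an
  essential lower bound as countably many null sets form a null set.\<close>

lemma essinf_le:
  assumes M: "emeasure M (space M) \<noteq> 0" and lo: "AE x in M. l \<le> g x" and hi: "AE x in M. g x \<le> u"
  shows "l \<le> essinf M g" and "AE x in M. essinf M g \<le> g x"
proof -
  let ?S = "{c. AE x in M. c \<le> g x}"
  have "c \<le> u" if "c \<in> ?S" for c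
  proof (rule ccontr)
    assume "\<not> c \<le> u"
    have "AE x in M. c \<le> g x" using that by simp
    with hi have "AE x in M. False"
      by eventually_elim (use \<open>\<not> c \<le> u\<close> in simp)
    then show False using M by (simp add: AE_iff_null_sets[symmetric] null_sets_def emeasure_notin_sets AE_iff_measurable[OF _ refl])
  qed
  then have "bdd_above ?S" by (rule bdd_aboveI)
  moreover have "l \<in> ?S" using lo by simp
  ultimately have S: "bdd_above ?S" "l \<in> ?S" by blast+
  then show "l \<le> essinf M g" unfolding essinf_def by (intro cSup_upper)
  have "AE x in M. essinf M g - 1 / real (Suc n) \<le> g x" for n
  proof -
    have "essinf M g - 1 / real (Suc n) < Sup ?S" by (simp add: essinf_def)
    then obtain c where c: "c \<in> ?S" "essinf M g - 1 / real (Suc n) < c"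
      using S less_cSup_iff[of ?S] by blast
    from c(1) have "AE x in M. c \<le> g x" by simp
    then show ?thesis by eventually_elim (use c(2) in linarith)
  qed
  then have "AE x in M. \<forall>n. essinf M g - 1 / real (Suc n) \<le> g x"
    by (simp add: AE_all_countable)
  then show "AE x in M. essinf M g \<le> g x"
  proof eventually_elim
    case (elim x)
    have "(\<lambda>n. essinf M g - inverse (real (Suc n))) \<longlonglongrightarrow> essinf M g - 0"
      by (intro tendsto_diff tendsto_const LIMSEQ_inverse_real_of_nat)
    then show ?case
      using elim by (intro LIMSEQ_le_const2[of _ "essinf M g"]) (auto simp: inverse_eq_divide)
  qed
qed

locale diffusion_mesh = coarse_mesh \<Omega> \<tau> \<T> sub
  for \<Omega> :: "(real^'d) set" and \<tau> \<T> sub +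
  fixes \<P> :: "'m set" and lam :: "'m \<Rightarrow> real^'d \<Rightarrow> real" and \<kappa> :: "real^'d \<Rightarrow> real^'d^'d"
  assumes lam: "\<And>\<nu>. \<nu> \<in> \<P> \<Longrightarrow> lam \<nu> \<in> Linf \<Omega>"
      "\<And>\<nu>. \<nu> \<in> \<P> \<Longrightarrow> AE x in lebesgue_on \<Omega>. 0 < lam \<nu> x"
    and kappa: "\<kappa> \<in> Linf \<Omega>"
      "AE x in lebesgue_on \<Omega>. symmetric_matrix (\<kappa> x)"
      "\<And>t. t \<in> \<tau> \<Longrightarrow> \<exists>K. AE x in lebesgue_on t. \<kappa> x = K"
    and lam_kappa: "\<And>\<nu>. \<nu> \<in> \<P> \<Longrightarrow> \<exists>c>0. \<exists>C. AE x in lebesgue_on \<Omega>. \<forall>y.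
        c * (norm y)\<^sup>2 \<le> y \<bullet> ((lam \<nu> x *\<^sub>R \<kappa> x) *v y) \<and>
        y \<bullet> ((lam \<nu> x *\<^sub>R \<kappa> x) *v y) \<le> C * (norm y)\<^sup>2"
    and c_pos: "\<And>t. t \<in> \<tau> \<Longrightarrow> 0 < c_fine \<P> lam \<kappa> t"
begin

abbreviation tensor :: "'m \<Rightarrow> real^'d \<Rightarrow> real^'d^'d" where
  "tensor \<nu> x \<equiv> lam \<nu> x *\<^sub>R \<kappa> x"

lemma tensor_bounds:
  assumes "\<nu> \<in> \<P>"
  obtains c C where "0 < c" "AE x in lebesgue_on \<Omega>. 0 < lam \<nu> x \<and> symmetric_matrix (tensor \<nu> x) \<and>
    (\<forall>y. c * (norm y)\<^sup>2 \<le> y \<bullet> (tensor \<nu> x *v y) \<and> y \<bullet> (tensor \<nu> x *v y) \<le> C * (norm y)\<^sup>2)"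
proof -
  obtain c C where c: "0 < c" and bounds: "AE x in lebesgue_on \<Omega>. \<forall>y.
        c * (norm y)\<^sup>2 \<le> y \<bullet> (tensor \<nu> x *v y) \<and> y \<bullet> (tensor \<nu> x *v y) \<le> C * (norm y)\<^sup>2"
    using lam_kappa[OF assms] by blast
  from bounds lam(2)[OF assms] kappa(2)
  have "AE x in lebesgue_on \<Omega>. 0 < lam \<nu> x \<and> symmetric_matrix (tensor \<nu> x) \<and>
    (\<forall>y. c * (norm y)\<^sup>2 \<le> y \<bullet> (tensor \<nu> x *v y) \<and> y \<bullet> (tensor \<nu> x *v y) \<le> C * (norm y)\<^sup>2)"
    by eventually_elim (simp add: symmetric_matrix_def transpose_def vec_eq_iff)
  with c show thesis by (rule that)
qed

lemma tensor_measurable: "\<nu> \<in> \<P> \<Longrightarrow> g \<in> L2 \<Omega> \<Longrightarrow> (\<lambda>x. tensor \<nu> x *v g x) \<in> borel_measurable (lebesgue_on \<Omega>)"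
  using lam(1)[of \<nu>] kappa(1) unfolding Linf_def
  by (intro borel_measurable_matrix_vector_mult borel_measurable_scaleR) auto

lemma tensor_L2:
  assumes \<nu>: "\<nu> \<in> \<P>" and g: "g \<in> L2 \<Omega>"
  shows "(\<lambda>x. tensor \<nu> x *v g x) \<in> L2 \<Omega>"
proof -
  obtain c C where c: "0 < c" and bounds: "AE x in lebesgue_on \<Omega>. 0 < lam \<nu> x \<and> symmetric_matrix (tensor \<nu> x) \<and>
    (\<forall>y. c * (norm y)\<^sup>2 \<le> y \<bullet> (tensor \<nu> x *v y) \<and> y \<bullet> (tensor \<nu> x *v y) \<le> C * (norm y)\<^sup>2)"
    using tensor_bounds[OF \<nu>] .
  show ?thesis
  proof (rule L2_bound[OF g tensor_measurable[OF \<nu> g]])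
    show "AE x in lebesgue_on \<Omega>. norm (tensor \<nu> x *v g x) \<le> C * norm (g x)"
      using bounds
    proof eventually_elim
      case (elim x)
      have "0 \<le> c * (norm y)\<^sup>2" for y :: "real^'d" using c by simp
      then have "0 \<le> y \<bullet> (tensor \<nu> x *v y)" for y using elim order_trans by blast
      with elim show ?case by (intro positive_symmetric_norm_le) auto
    qed
  qed
qed

lemma L2_coarse: "T \<in> \<T> \<Longrightarrow> u \<in> L2 \<Omega> \<Longrightarrow> u \<in> L2 T"
  by (rule L2_subset[OF _ coarse_subset domain_sets coarse_sets])

lemma sum_L2_inner_coarse:
  assumes "u \<in> L2 \<Omega>" "w \<in> L2 \<Omega>"
  shows "(\<Sum>T\<in>\<T>. L2_inner T u w) = L2_inner \<Omega> u w"
  unfolding L2_inner_def by (rule sum_integral_coarse[OF L2_inner_integrable[OF assms]])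

text \<open>The energy of a vector field instead of a scalar function: gradients equal almost
  everywhere can be exchanged by \<open>energy_cong\<close>, and differences of gradients can be
  taken literally.\<close>

definition energy :: "'m \<Rightarrow> (real^'d) set \<Rightarrow> (real^'d \<Rightarrow> real^'d) \<Rightarrow> real" where
  "energy \<nu> D g = L2_inner D (\<lambda>x. tensor \<nu> x *v g x) g"

lemma tensor_nonneg:
  assumes "\<nu> \<in> \<P>"
  shows "AE x in lebesgue_on \<Omega>. \<forall>y. 0 \<le> (tensor \<nu> x *v y) \<bullet> y"
proof -
  obtain c C where c: "0 < c" and bounds: "AE x in lebesgue_on \<Omega>. 0 < lam \<nu> x \<and> symmetric_matrix (tensor \<nu> x) \<and>
    (\<forall>y. c * (norm y)\<^sup>2 \<le> y \<bullet> (tensor \<nu> x *v y) \<and> y \<bullet> (tensor \<nu> x *v y) \<le> C * (norm y)\<^sup>2)"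
    using tensor_bounds[OF assms] .
  show ?thesis
    using bounds
  proof (eventually_elim, intro allI)
    fix x and y :: "real^'d"
    assume x: "0 < lam \<nu> x \<and> symmetric_matrix (tensor \<nu> x) \<and>
      (\<forall>y. c * (norm y)\<^sup>2 \<le> y \<bullet> (tensor \<nu> x *v y) \<and> y \<bullet> (tensor \<nu> x *v y) \<le> C * (norm y)\<^sup>2)"
    have "0 \<le> c * (norm y)\<^sup>2" using c by simp
    also have "\<dots> \<le> y \<bullet> (tensor \<nu> x *v y)" using x by blast
    finally show "0 \<le> (tensor \<nu> x *v y) \<bullet> y" by (simp add: inner_commute)
  qed
qed

lemma energy_ge_0:
  assumes "\<nu> \<in> \<P>"
  shows "0 \<le> energy \<nu> \<Omega> g" and "T \<in> \<T> \<Longrightarrow> 0 \<le> energy \<nu> T g"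
proof -
  note nonneg = tensor_nonneg[OF assms]
  show "0 \<le> energy \<nu> \<Omega> g" unfolding energy_def L2_inner_def
    using nonneg by (intro integral_nonneg_AE) (elim eventually_mono, blast)
  show "0 \<le> energy \<nu> T g" if "T \<in> \<T>" unfolding energy_def L2_inner_def
    using AE_domain_imp_coarse[OF nonneg that] by (intro integral_nonneg_AE) (elim eventually_mono, blast)
qed

lemma energy_cong:
  assumes "\<nu> \<in> \<P>" "g \<in> L2 \<Omega>" "h \<in> L2 \<Omega>" "AE x in lebesgue_on \<Omega>. g x = h x"
  shows "energy \<nu> \<Omega> g = energy \<nu> \<Omega> h"
proof -
  have "AE x in lebesgue_on \<Omega>. tensor \<nu> x *v g x = tensor \<nu> x *v h x"
    using assms(4) by eventually_elim simp
  then show ?thesis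
    unfolding energy_def by (intro L2_inner_cong tensor_L2 assms)
qed

lemma sum_energy: "\<nu> \<in> \<P> \<Longrightarrow> g \<in> L2 \<Omega> \<Longrightarrow> (\<Sum>T\<in>\<T>. energy \<nu> T g) = energy \<nu> \<Omega> g"
  unfolding energy_def by (intro sum_L2_inner_coarse tensor_L2)

text \<open>The bridge from the norms of the statement to \<open>energy\<close>; squaring removes
  the local roots because the local energies are nonnegative.\<close>

lemma sum_energy_norm_loc:
  assumes "\<nu> \<in> \<P>" "q \<in> broken_H1 \<Omega> \<tau>" "g \<in> L2 \<Omega>"
    "AE x in lebesgue_on \<Omega>. broken_grad \<tau> q x = g x"
  shows "(\<Sum>T\<in>\<T>. (energy_norm_loc \<tau> lam \<kappa> \<nu> T q)\<^sup>2) = energy \<nu> \<Omega> g"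
proof -
  have b: "b_loc \<tau> lam \<kappa> T q q \<nu> = energy \<nu> T (broken_grad \<tau> q)" for T
    by (simp add: b_loc_def energy_def L2_inner_def)
  have "(\<Sum>T\<in>\<T>. (energy_norm_loc \<tau> lam \<kappa> \<nu> T q)\<^sup>2) = (\<Sum>T\<in>\<T>. energy \<nu> T (broken_grad \<tau> q))"
    using energy_ge_0(2)[OF assms(1)] by (intro sum.cong) (simp_all add: energy_norm_loc_def b)
  also have "\<dots> = energy \<nu> \<Omega> (broken_grad \<tau> q)"
    using assms(1) broken_grad_L2[OF assms(2)] by (rule sum_energy)
  also have "\<dots> = energy \<nu> \<Omega> g"
    using assms broken_grad_L2 by (intro energy_cong)
  finally show ?thesis .
qed

text \<open>Tensors at two parameters differ only by a scalar factor in front of the positive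
  semidefinite \<kappa>, so a pointwise comparison of these factors compares the energies. The
  constants on both sides serve the bounds by \<alpha> and by \<gamma> alike.\<close>

lemma energy_mono:
  assumes "\<nu> \<in> \<P>" "\<rho> \<in> \<P>" "g \<in> L2 \<Omega>" "AE x in lebesgue_on \<Omega>. a * lam \<nu> x \<le> b * lam \<rho> x"
  shows "a * energy \<nu> \<Omega> g \<le> b * energy \<rho> \<Omega> g"
proof -
  have "AE x in lebesgue_on \<Omega>. a * ((tensor \<nu> x *v g x) \<bullet> g x) \<le> b * ((tensor \<rho> x *v g x) \<bullet> g x)"
    using assms(4) tensor_nonneg[OF assms(1)] lam(2)[OF assms(1)]
  proof eventually_elim
    case (elim x)
    have s: "(tensor \<nu> x *v g x) \<bullet> g x = lam \<nu> x * ((\<kappa> x *v g x) \<bullet> g x)" for \<nu>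
      by (simp add: scaleR_matrix_vector_assoc[symmetric])
    have "0 \<le> lam \<nu> x * ((\<kappa> x *v g x) \<bullet> g x)" using elim(2) unfolding s[symmetric] by blast
    then have "0 \<le> (\<kappa> x *v g x) \<bullet> g x" using elim(3) by (simp add: zero_le_mult_iff)
    then show ?case unfolding s using mult_right_mono[OF elim(1)] by (simp add: mult.assoc)
  qed
  then have "(\<integral>x. a * ((tensor \<nu> x *v g x) \<bullet> g x) \<partial>lebesgue_on \<Omega>)
      \<le> (\<integral>x. b * ((tensor \<rho> x *v g x) \<bullet> g x) \<partial>lebesgue_on \<Omega>)"
    using assms by (intro integral_mono_AE integrable_mult_right L2_inner_integrable tensor_L2)
  then show ?thesis by (simp add: energy_def L2_inner_def)
qed

text \<open>The three layers of the constant are undone in turn: infimum over the parameters,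
  essential infimum over \<open>t\<close>, smallest eigenvalue of the matrix.\<close>

lemma c_fine_le:
  assumes t: "t \<in> \<tau>" and \<mu>: "\<mu> \<in> \<P>"
  shows "AE x in lebesgue_on t. \<forall>y. c_fine \<P> lam \<kappa> t * (norm y)\<^sup>2 \<le> y \<bullet> (tensor \<mu> x *v y)"
proof -
  have not_null: "emeasure (lebesgue_on t) (space (lebesgue_on t)) \<noteq> 0"
  proof
    assume "emeasure (lebesgue_on t) (space (lebesgue_on t)) = 0"
    then have "emeasure lebesgue t = 0"
      using fine_sets[OF t] by (simp add: emeasure_restrict_space)
    then show False
      using fine_not_negligible[OF t] fine_sets[OF t] by (simp add: negligible_iff_null_sets null_sets_def)
  qed
  \<comment> \<open>Nonnegativity for every parameter bounds the family below, without which the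
    real infimum would not be a lower bound.\<close>
  have param: "0 \<le> c_fine_param lam \<kappa> t \<nu> \<and>
      (AE x in lebesgue_on t. symmetric_matrix (tensor \<nu> x) \<and>
         c_fine_param lam \<kappa> t \<nu> \<le> smallest_eigenvalue (tensor \<nu> x))" if \<nu>: "\<nu> \<in> \<P>" for \<nu>
  proof -
    obtain c C where c: "0 < c" and "AE x in lebesgue_on \<Omega>. 0 < lam \<nu> x \<and> symmetric_matrix (tensor \<nu> x) \<and>
      (\<forall>y. c * (norm y)\<^sup>2 \<le> y \<bullet> (tensor \<nu> x *v y) \<and> y \<bullet> (tensor \<nu> x *v y) \<le> C * (norm y)\<^sup>2)"
      using tensor_bounds[OF \<nu>] .
    from AE_domain_imp_fine[OF this(2) t]
    have ev: "AE x in lebesgue_on t. symmetric_matrix (tensor \<nu> x) \<and>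
        c \<le> smallest_eigenvalue (tensor \<nu> x) \<and> smallest_eigenvalue (tensor \<nu> x) \<le> C"
    proof eventually_elim
      case (elim x)
      then have sym: "symmetric_matrix (tensor \<nu> x)" by blast
      \<comment> \<open>At an eigenvector the quadratic form is the eigenvalue times the squared
        norm, so both bounds of the form pass to the smallest eigenvalue.\<close>
      obtain y where y: "y \<noteq> 0" "tensor \<nu> x *v y = smallest_eigenvalue (tensor \<nu> x) *\<^sub>R y"
        using smallest_eigenvalue_le_quadratic(1)[OF sym] unfolding eigenvalue_def by blast
      then have q: "y \<bullet> (tensor \<nu> x *v y) = smallest_eigenvalue (tensor \<nu> x) * (norm y)\<^sup>2"
        by (simp only: inner_scaleR_right power2_norm_eq_inner)
      have "c * (norm y)\<^sup>2 \<le> y \<bullet> (tensor \<nu> x *v y)" "y \<bullet> (tensor \<nu> x *v y) \<le> C * (norm y)\<^sup>2"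
        using elim by blast+
      then show ?case using sym y(1) unfolding q by simp
    qed
    have lo: "AE x in lebesgue_on t. c \<le> smallest_eigenvalue (tensor \<nu> x)"
      and hi: "AE x in lebesgue_on t. smallest_eigenvalue (tensor \<nu> x) \<le> C"
      using ev by (elim eventually_mono, blast)+
    note e = essinf_le[OF not_null lo hi]
    have "AE x in lebesgue_on t. symmetric_matrix (tensor \<nu> x) \<and>
         c_fine_param lam \<kappa> t \<nu> \<le> smallest_eigenvalue (tensor \<nu> x)"
      using ev e(2) unfolding c_fine_param_def by eventually_elim blast
    moreover have "0 \<le> c_fine_param lam \<kappa> t \<nu>"
      using c e(1) unfolding c_fine_param_def by linarith
    ultimately show ?thesis by blast
  qed
  have "bdd_below (c_fine_param lam \<kappa> t ` \<P>)"
    using param by (intro bdd_belowI2[of _ 0]) blast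
  then have le: "c_fine \<P> lam \<kappa> t \<le> c_fine_param lam \<kappa> t \<mu>"
    unfolding c_fine_def using \<mu> by (rule cINF_lower)
  from param[OF \<mu>, THEN conjunct2] show ?thesis
  proof (eventually_elim, intro allI)
    fix x and y :: "real^'d"
    assume x: "symmetric_matrix (tensor \<mu> x) \<and> c_fine_param lam \<kappa> t \<mu> \<le> smallest_eigenvalue (tensor \<mu> x)"
    then have "c_fine \<P> lam \<kappa> t * (norm y)\<^sup>2 \<le> smallest_eigenvalue (tensor \<mu> x) * (norm y)\<^sup>2"
      using le by (intro mult_right_mono) auto
    also have "\<dots> \<le> y \<bullet> (tensor \<mu> x *v y)"
      using x smallest_eigenvalue_le_quadratic(2) by blast
    finally show "c_fine \<P> lam \<kappa> t * (norm y)\<^sup>2 \<le> y \<bullet> (tensor \<mu> x *v y)" .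
  qed
qed

lemma c_coarse_pos: "T \<in> \<T> \<Longrightarrow> 0 < c_coarse \<P> lam \<kappa> sub T"
  unfolding c_coarse_def
  using coarse_sub[of T] coarse_sub_nonempty[of T] finite_subset[OF coarse_sub finite_fine, of T] c_pos
  by (subst Min_gr_iff) auto

text \<open>Almost every point of \<open>T\<close> lies in one of its simplices, whose constant is
  at least the minimum. The bound holds at every parameter, hence no comparison factor is attached
  to the residual.\<close>

lemma c_coarse_norm_le_energy:
  assumes T: "T \<in> \<T>" and \<mu>: "\<mu> \<in> \<P>" and g: "g \<in> L2 \<Omega>"
  shows "c_coarse \<P> lam \<kappa> sub T * (L2_norm T g)\<^sup>2 \<le> energy \<mu> T g"
proof -
  let ?c = "c_coarse \<P> lam \<kappa> sub T"
  have "AE x in lebesgue_on t. \<forall>y. c_fine \<P> lam \<kappa> t * (norm y)\<^sup>2 \<le> y \<bullet> (tensor \<mu> x *v y)"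
    if "t \<in> sub T" for t
    using that coarse_sub[OF T] \<mu> by (intro c_fine_le) auto
  then have "AE x in lebesgue_on T. \<exists>t\<in>sub T. x \<in> interior t \<and>
      (\<forall>y. c_fine \<P> lam \<kappa> t * (norm y)\<^sup>2 \<le> y \<bullet> (tensor \<mu> x *v y))"
    by (rule AE_fine_imp_coarse[OF T])
  then have "AE x in lebesgue_on T. ?c * (g x \<bullet> g x) \<le> (tensor \<mu> x *v g x) \<bullet> g x"
  proof eventually_elim
    case (elim x)
    then obtain t where t: "t \<in> sub T"
      and le: "\<And>y. c_fine \<P> lam \<kappa> t * (norm y)\<^sup>2 \<le> y \<bullet> (tensor \<mu> x *v y)" by blast
    have "finite (sub T)" using coarse_sub[OF T] finite_fine by (rule finite_subset)
    then have "?c \<le> c_fine \<P> lam \<kappa> t"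
      unfolding c_coarse_def using t by (intro Min_le) auto
    then have "?c * (norm (g x))\<^sup>2 \<le> c_fine \<P> lam \<kappa> t * (norm (g x))\<^sup>2"
      by (intro mult_right_mono) auto
    with le[of "g x"] show ?case by (simp add: power2_norm_eq_inner inner_commute)
  qed
  then have "(\<integral>x. ?c * (g x \<bullet> g x) \<partial>lebesgue_on T) \<le> (\<integral>x. (tensor \<mu> x *v g x) \<bullet> g x \<partial>lebesgue_on T)"
    using assms
    by (intro integral_mono_AE integrable_mult_right L2_inner_integrable L2_coarse[OF T] tensor_L2)
  then show ?thesis by (simp add: energy_def L2_norm_power2 L2_inner_def)
qed

end

context diffusion_mesh
begin

section \<open>Local estimators\<close>

text \<open>Measurability of the integrand holds since \<open>\<kappa>\<close> is piecewise constant, so that its inverse is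
  a finite combination of indicator functions up to null sets.\<close>

lemma L2_inner_le_matrix_inv_sqrt:
  assumes T: "T \<in> \<T>" and \<nu>: "\<nu> \<in> \<P>" and z: "z \<in> L2 \<Omega>" and g: "g \<in> L2 \<Omega>"
  shows "\<bar>L2_inner T z g\<bar> \<le> L2_norm T (\<lambda>x. matrix_inv_sqrt (tensor \<nu> x) *v z x) * sqrt (energy \<nu> T g)"
proof -
  obtain c C where c: "0 < c" and "AE x in lebesgue_on \<Omega>. 0 < lam \<nu> x \<and> symmetric_matrix (tensor \<nu> x) \<and>
    (\<forall>y. c * (norm y)\<^sup>2 \<le> y \<bullet> (tensor \<nu> x *v y) \<and> y \<bullet> (tensor \<nu> x *v y) \<le> C * (norm y)\<^sup>2)"
    using tensor_bounds[OF \<nu>] .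
  from AE_domain_imp_coarse[OF this(2) T]
  have bounds: "AE x in lebesgue_on T. 0 < lam \<nu> x \<and> symmetric_matrix (tensor \<nu> x) \<and>
    (\<forall>y. c * (norm y)\<^sup>2 \<le> y \<bullet> (tensor \<nu> x *v y) \<and> y \<bullet> (tensor \<nu> x *v y) \<le> C * (norm y)\<^sup>2)" .
  have pos: "0 < y \<bullet> (tensor \<nu> x *v y)"
    if "\<forall>y. c * (norm y)\<^sup>2 \<le> y \<bullet> (tensor \<nu> x *v y) \<and> y \<bullet> (tensor \<nu> x *v y) \<le> C * (norm y)\<^sup>2" "y \<noteq> 0"
    for x y
  proof -
    have "0 < c * (norm y)\<^sup>2" using c that(2) by simp
    also have "\<dots> \<le> y \<bullet> (tensor \<nu> x *v y)" using that(1) by blast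
    finally show ?thesis .
  qed
  note sets = coarse_sets[OF T]
  have zT: "z \<in> L2 T" and gT: "g \<in> L2 T" and AgT: "(\<lambda>x. tensor \<nu> x *v g x) \<in> L2 T"
    using z g tensor_L2[OF \<nu> g] by (auto intro: L2_coarse[OF T])
  \<comment> \<open>Pointwise the integrand is at most \<open>a x * b x\<close>; the Cauchy-Schwarz
    inequality is then applied to these two scalar functions.\<close>
  define a where "a x = norm (matrix_inv_sqrt (tensor \<nu> x) *v z x)" for x
  define b where "b x = sqrt ((tensor \<nu> x *v g x) \<bullet> g x)" for x
  have a_measurable: "a \<in> borel_measurable (lebesgue_on T)"
  proof -
    have "\<exists>K. AE x in lebesgue_on t. \<kappa> x = K" if "t \<in> sub T" for t
      using kappa(3) that coarse_sub[OF T] by blast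
    then obtain K where "\<And>t. t \<in> sub T \<Longrightarrow> AE x in lebesgue_on t. \<kappa> x = K t"
      by metis
    then have K: "AE x in lebesgue_on T. \<exists>t\<in>sub T. x \<in> interior t \<and> \<kappa> x = K t"
      by (rule AE_fine_imp_coarse[OF T])
    \<comment> \<open>\<open>k\<close> is \<kappa> inverse applied to \<open>z\<close>, assembled
      from the matrix of each simplex.\<close>
    define k where "k x = (\<Sum>t\<in>sub T. indicator (interior t) x *\<^sub>R (matrix_inv (K t) *v z x))" for x
    have lam_meas: "lam \<nu> \<in> borel_measurable (lebesgue_on T)"
      using lam(1)[OF \<nu>] measurable_restrict_mono[OF _ coarse_subset[OF T]] by (auto simp: Linf_def)
    have "indicat_real (interior t) \<in> borel_measurable (lebesgue_on T)" for t
      by (intro measurable_restrict_space1 borel_measurable_indicator) auto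
    then have k_meas: "k \<in> borel_measurable (lebesgue_on T)"
      unfolding k_def using zT
      by (intro borel_measurable_sum borel_measurable_scaleR borel_measurable_matrix_vector_mult
          measurable_const) auto
    \<comment> \<open>By \<open>norm_matrix_inv_sqrt\<close> the square of \<open>a x\<close> is the
      product of \<open>z x\<close> with the inverse tensor applied to \<open>z x\<close>, that is,
      with \<open>k x / lam \<nu> x\<close>; this expression contains no matrix root.\<close>
    have "(\<lambda>x. sqrt (1 / lam \<nu> x * (z x \<bullet> k x))) \<in> borel_measurable (lebesgue_on T)"
    proof -
      note [measurable] = lam_meas k_meas L2_measurable[OF zT]
      show ?thesis by measurable
    qed
    moreover have "AE x in lebesgue_on T. sqrt (1 / lam \<nu> x * (z x \<bullet> k x)) = a x"
      using K bounds
    proof eventually_elim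
      case (elim x)
      then obtain t where t: "t \<in> sub T" "x \<in> interior t" "\<kappa> x = K t" by blast
      have fin: "finite (sub T)" using coarse_sub[OF T] finite_fine by (rule finite_subset)
      have "indicator (interior s) x *\<^sub>R (matrix_inv (K s) *v z x) = 0" if "s \<in> sub T - {t}" for s
      proof -
        have "x \<notin> interior s"
          using fine_interiors_disjoint[of s t x] that t coarse_sub[OF T] by blast
        then show ?thesis by simp
      qed
      then have "(\<Sum>s\<in>sub T - {t}. indicator (interior s) x *\<^sub>R (matrix_inv (K s) *v z x)) = 0"
        by (rule sum.neutral[rule_format])
      then have k: "k x = matrix_inv (\<kappa> x) *v z x"
        unfolding k_def sum.remove[OF fin t(1)] using t by simp
      \<comment> \<open>A kernel vector of \<kappa> would also be one of the tensor, which is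
        positive definite.\<close>
      have "inj ((*v) (\<kappa> x))"
      proof (subst linear_injective_0)
        show "\<forall>y. \<kappa> x *v y = 0 \<longrightarrow> y = 0"
        proof (intro allI impI)
          fix y assume "\<kappa> x *v y = 0"
          then have "tensor \<nu> x *v y = 0" by (simp add: scaleR_matrix_vector_assoc[symmetric])
          then show "y = 0" using pos[of x y] elim by auto
        qed
      qed auto
      then have "invertible (\<kappa> x)"
        by (simp add: invertible_left_inverse matrix_left_invertible_injective)
      then have "\<kappa> x ** matrix_inv (\<kappa> x) = mat 1"
        unfolding matrix_inv_def invertible_def by (metis (mono_tags, lifting) someI_ex)
      then have "\<kappa> x *v k x = z x" by (simp add: k matrix_vector_mul_assoc)
      then have "tensor \<nu> x *v ((1 / lam \<nu> x) *\<^sub>R k x) = z x"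
        using elim by (simp add: scaleR_matrix_vector_assoc[symmetric] matrix_vector_mult_scaleR)
      then have "(a x)\<^sup>2 = z x \<bullet> ((1 / lam \<nu> x) *\<^sub>R k x)"
        unfolding a_def using elim pos by (intro norm_matrix_inv_sqrt) auto
      then show ?case by (simp add: a_def real_sqrt_unique)
    qed
    ultimately show ?thesis by (rule borel_measurable_lebesgue_on_AE[OF sets])
  qed
  \<comment> \<open>The lower ellipticity bound enters here. If \<open>a\<close> were not square
    integrable, the convention for integrals would turn its norm into 0.\<close>
  have a_L2: "a \<in> L2 T"
  proof (rule L2_bound[OF zT a_measurable])
    show "AE x in lebesgue_on T. norm (a x) \<le> sqrt (1 / c) * norm (z x)"
      using bounds
    proof eventually_elim
      case (elim x)
      then have "c * (a x)\<^sup>2 \<le> (norm (z x))\<^sup>2"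
        unfolding a_def using pos[of x] by (intro matrix_inv_sqrt_le) auto
      then have "(a x)\<^sup>2 \<le> (sqrt (1 / c) * norm (z x))\<^sup>2"
        using c by (simp add: power_mult_distrib field_simps)
      then show ?case using c by (intro power2_le_imp_le[of "norm (a x)"]) auto
    qed
  qed
  have b_L2: "b \<in> L2 T"
  proof (rule L2_bound[OF gT])
    show "b \<in> borel_measurable (lebesgue_on T)"
    proof -
      note [measurable] = L2_measurable[OF AgT] L2_measurable[OF gT]
      show ?thesis unfolding b_def by measurable
    qed
    show "AE x in lebesgue_on T. norm (b x) \<le> sqrt C * norm (g x)"
      using bounds
    proof eventually_elim
      case (elim x)
      then have "(tensor \<nu> x *v g x) \<bullet> g x \<le> C * (norm (g x))\<^sup>2" by (simp add: inner_commute)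
      then have "sqrt ((tensor \<nu> x *v g x) \<bullet> g x) \<le> sqrt (C * (norm (g x))\<^sup>2)"
        by (rule real_sqrt_le_mono)
      moreover have "0 \<le> (tensor \<nu> x *v g x) \<bullet> g x"
        using pos[of x "g x"] elim by (cases "g x = 0") (auto simp: inner_commute less_imp_le)
      ultimately show ?case by (simp add: b_def real_sqrt_mult)
    qed
  qed
  have "\<bar>L2_inner T z g\<bar> \<le> (\<integral>x. \<bar>z x \<bullet> g x\<bar> \<partial>lebesgue_on T)"
    unfolding L2_inner_def by (rule integral_abs_bound)
  also have "\<dots> \<le> (\<integral>x. a x \<bullet> b x \<partial>lebesgue_on T)"
  proof (rule integral_mono_AE)
    show "integrable (lebesgue_on T) (\<lambda>x. \<bar>z x \<bullet> g x\<bar>)"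
      using L2_inner_integrable[OF zT gT] by (rule integrable_abs)
    show "integrable (lebesgue_on T) (\<lambda>x. a x \<bullet> b x)"
      using a_L2 b_L2 by (rule L2_inner_integrable)
    show "AE x in lebesgue_on T. \<bar>z x \<bullet> g x\<bar> \<le> a x \<bullet> b x"
      using bounds
    proof eventually_elim
      case (elim x)
      then have "\<bar>z x \<bullet> g x\<bar> \<le> norm (matrix_inv_sqrt (tensor \<nu> x) *v z x) * sqrt (g x \<bullet> (tensor \<nu> x *v g x))"
        using pos[of x] by (intro inner_le_matrix_inv_sqrt) auto
      then show ?case by (simp add: a_def b_def inner_commute)
    qed
  qed
  also have "\<dots> \<le> L2_norm T a * L2_norm T b"
    using L2_Cauchy_Schwarz[OF a_L2 b_L2] by (simp add: L2_inner_def)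
  also have "L2_norm T a = L2_norm T (\<lambda>x. matrix_inv_sqrt (tensor \<nu> x) *v z x)"
    by (simp add: L2_norm_def a_def)
  also have "L2_norm T b = sqrt (energy \<nu> T g)"
  proof -
    have "(\<integral>x. (norm (b x))\<^sup>2 \<partial>lebesgue_on T) = (\<integral>x. (tensor \<nu> x *v g x) \<bullet> g x \<partial>lebesgue_on T)"
    proof (rule integral_cong_AE)
      show "AE x in lebesgue_on T. (norm (b x))\<^sup>2 = (tensor \<nu> x *v g x) \<bullet> g x"
        using AE_domain_imp_coarse[OF tensor_nonneg[OF \<nu>] T]
        by eventually_elim (simp add: b_def)
    qed (use L2_integrable[OF b_L2] L2_inner_integrable[OF AgT gT] in auto)
    then show ?thesis by (simp add: L2_norm_def energy_def L2_inner_def)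
  qed
  finally show ?thesis .
qed

text \<open>\<open>sqrt C * diameter T\<close> comes from the Poincare inequality, and the root of
  \<open>c_coarse\<close> in the denominator from replacing the norm of the gradient by its energy
  at \<mu>.\<close>

lemma residual_le:
  assumes T: "T \<in> \<T>" and \<mu>: "\<mu> \<in> \<P>" and r: "r \<in> L2 \<Omega>" "L2_inner T r (\<lambda>_. 1) = 0"
    and \<phi>: "\<phi> \<in> H1 \<Omega>" and poincare: "poincare_constant T C"
  shows "\<bar>L2_inner T r \<phi>\<bar> \<le> sqrt (C / c_coarse \<P> lam \<kappa> sub T) * diameter T * L2_norm T r
    * sqrt (energy \<mu> T (weak_grad \<Omega> \<phi>))"
proof -
  let ?c = "c_coarse \<P> lam \<kappa> sub T" and ?m = "proj_const T \<phi>" and ?g = "weak_grad \<Omega> \<phi>"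
  have c: "0 < ?c" using T by (rule c_coarse_pos)
  have C: "0 < C" using poincare by (simp add: poincare_constant_def)
  have rT: "r \<in> L2 T" using T r(1) by (rule L2_coarse)
  have gT: "?g \<in> L2 T" using T weak_grad_L2[OF \<phi>] by (rule L2_coarse)
  \<comment> \<open>The Poincare inequality concerns the gradient chosen on \<open>T\<close>, the
    conclusion the one chosen on the domain.\<close>
  note sub = H1_subset[OF open_domain domain_lmeasurable coarse_open[OF T] coarse_subset[OF T] \<phi>]
  have \<phi>T: "\<phi> \<in> L2 T" using sub(1) by (rule H1_L2)
  have mT: "(\<lambda>_. ?m) \<in> L2 T" using coarse_lmeasurable[OF T] by (rule L2_const)
  \<comment> \<open>Orthogonality to 1 extends to all constants, in particular to the mean of
    \<phi>.\<close>
  have "L2_inner T r (\<lambda>_. ?m) = ?m * L2_inner T r (\<lambda>_. 1)"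
    by (simp add: L2_inner_def mult.commute)
  then have "L2_inner T r \<phi> = L2_inner T r (\<lambda>x. \<phi> x - ?m)"
    using r(2) by (simp add: L2_inner_diff(2)[OF \<phi>T mT rT])
  also have "\<bar>\<dots>\<bar> \<le> L2_norm T r * L2_norm T (\<lambda>x. \<phi> x - ?m)"
    by (intro L2_Cauchy_Schwarz rT L2_diff \<phi>T mT)
  finally have 1: "\<bar>L2_inner T r \<phi>\<bar> \<le> L2_norm T r * L2_norm T (\<lambda>x. \<phi> x - ?m)" .
  have diam: "0 \<le> diameter T"
    using domain coarse_subset[OF T] bounded_subset by (intro diameter_ge_0) (auto simp: polygonal_domain_def)
  have 2: "L2_norm T (\<lambda>x. \<phi> x - ?m) \<le> sqrt C * diameter T * L2_norm T ?g"
  proof (rule power2_le_imp_le)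
    have "L2_norm T (weak_grad T \<phi>) = L2_norm T ?g"
      using weak_grad_L2[OF sub(1)] gT sub(2) by (rule L2_norm_cong)
    then show "(L2_norm T (\<lambda>x. \<phi> x - ?m))\<^sup>2 \<le> (sqrt C * diameter T * L2_norm T ?g)\<^sup>2"
      using poincare sub(1) C by (auto simp: poincare_constant_def power_mult_distrib)
    show "0 \<le> sqrt C * diameter T * L2_norm T ?g"
      using C diam by simp
  qed
  have 3: "L2_norm T ?g \<le> sqrt (energy \<mu> T ?g) / sqrt ?c"
  proof -
    have "(L2_norm T ?g)\<^sup>2 \<le> energy \<mu> T ?g / ?c"
      using c_coarse_norm_le_energy[OF T \<mu> weak_grad_L2[OF \<phi>]] c by (simp add: field_simps)
    then have "L2_norm T ?g \<le> sqrt (energy \<mu> T ?g / ?c)" by (rule real_le_rsqrt)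
    then show ?thesis by (simp add: real_sqrt_divide)
  qed
  have "\<bar>L2_inner T r \<phi>\<bar> \<le> L2_norm T r * (sqrt C * diameter T * (sqrt (energy \<mu> T ?g) / sqrt ?c))"
    using C diam by (intro order_trans[OF 1] mult_left_mono order_trans[OF 2] 3) simp_all
  then show ?thesis by (simp add: real_sqrt_divide ac_simps)
qed

end

section \<open>Assembly of the error bound from the energy identity and the local estimates\<close>

theorem theorem4p2:
  fixes \<Omega> :: "(real^'d) set"
    and \<tau> \<T> :: "(real^'d) set set"
    and sub :: "(real^'d) set \<Rightarrow> (real^'d) set set"
    and \<P> :: "(real^'p) set"
    and f :: "real^'d \<Rightarrow> real"
    and lam :: "real^'p \<Rightarrow> real^'d \<Rightarrow> real"
    and \<kappa> :: "real^'d \<Rightarrow> real^'d^'d"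
    and \<Xi> :: nat
    and \<theta> :: "nat \<Rightarrow> real^'p \<Rightarrow> real"
    and lamc :: "nat \<Rightarrow> real^'d \<Rightarrow> real"
    and \<sigma> :: real
    and C\<^sub>P :: "(real^'d) set \<Rightarrow> real"
    and \<mu> \<mu>\<^sub>b \<mu>\<^sub>h :: "real^'p"
    and p s p\<^sub>h :: "real^'d \<Rightarrow> real"
    and v :: "real^'d \<Rightarrow> real^'d"
  assumes dim: "CARD('d) \<in> {2, 3}"
    and domain: "polygonal_domain \<Omega>"
    and fine: "fine_triangulation \<Omega> \<tau>" "shape_regular \<sigma> \<tau>"
    and coarse: "coarse_partition \<Omega> \<tau> \<T> sub"
    and f: "f \<in> L2 \<Omega>" "f \<in> Linf \<Omega>"
    and lam: "\<And>\<nu>. \<nu> \<in> \<P> \<Longrightarrow> lam \<nu> \<in> Linf \<Omega>"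
      "\<And>\<nu>. \<nu> \<in> \<P> \<Longrightarrow> AE x in lebesgue_on \<Omega>. 0 < lam \<nu> x"
    and kappa: "\<kappa> \<in> Linf \<Omega>"
      "AE x in lebesgue_on \<Omega>. symmetric_matrix (\<kappa> x)"
      "\<exists>c>0. AE x in lebesgue_on \<Omega>. \<forall>y. c * (norm y)\<^sup>2 \<le> y \<bullet> (\<kappa> x *v y)"
      "\<And>t. t \<in> \<tau> \<Longrightarrow> \<exists>K. AE x in lebesgue_on t. \<kappa> x = K"
    and lam_kappa: "\<And>\<nu>. \<nu> \<in> \<P> \<Longrightarrow> \<exists>c>0. \<exists>C. AE x in lebesgue_on \<Omega>. \<forall>y.
        c * (norm y)\<^sup>2 \<le> y \<bullet> ((lam \<nu> x *\<^sub>R \<kappa> x) *v y) \<and>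
        y \<bullet> ((lam \<nu> x *\<^sub>R \<kappa> x) *v y) \<le> C * (norm y)\<^sup>2"
    and c_pos: "\<And>t. t \<in> \<tau> \<Longrightarrow> 0 < c_fine \<P> lam \<kappa> t"
    and affine: "1 \<le> \<Xi>"
      "\<And>\<xi> \<nu>. \<xi> \<in> {1..\<Xi>} \<Longrightarrow> \<nu> \<in> \<P> \<Longrightarrow> 0 < \<theta> \<xi> \<nu>"
      "\<And>\<xi>. \<xi> \<in> {1..\<Xi>} \<Longrightarrow> lamc \<xi> \<in> Linf \<Omega>"
      "\<And>\<nu>. \<nu> \<in> \<P> \<Longrightarrow> AE x in lebesgue_on \<Omega>. lam \<nu> x = (\<Sum>\<xi>=1..\<Xi>. \<theta> \<xi> \<nu> * lamc \<xi> x)"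
    and param_equiv: "\<And>\<nu> \<rho>. \<nu> \<in> \<P> \<Longrightarrow> \<rho> \<in> \<P> \<Longrightarrow> AE x in lebesgue_on \<Omega>.
        coeff_alpha \<Xi> \<theta> \<nu> \<rho> * lam \<rho> x \<le> lam \<nu> x \<and>
        lam \<nu> x \<le> coeff_gamma \<Xi> \<theta> \<nu> \<rho> * lam \<rho> x"
    and params: "\<mu> \<in> \<P>" "\<mu>\<^sub>b \<in> \<P>" "\<mu>\<^sub>h \<in> \<P>"
    and solution: "p \<in> H10 \<Omega>" "\<And>q. q \<in> H10 \<Omega> \<Longrightarrow> b_form \<tau> \<T> lam \<kappa> p q \<mu> = L2_inner \<Omega> f q"
    and s: "s \<in> H10 \<Omega>"
    and p\<^sub>h: "p\<^sub>h \<in> broken_H1 \<Omega> \<tau>"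
    and v: "v \<in> Hdiv \<Omega>"
      "\<And>T. T \<in> \<T> \<Longrightarrow> L2_inner T (weak_div \<Omega> v) (\<lambda>_. 1) = L2_inner T f (\<lambda>_. 1)"
    and poincare: "\<And>T. T \<in> \<T> \<Longrightarrow> poincare_constant T (C\<^sub>P T)"
  shows "energy_norm \<tau> \<T> lam \<kappa> \<mu>\<^sub>b (\<lambda>x. p x - p\<^sub>h x) \<le>
    1 / sqrt (coeff_alpha \<Xi> \<theta> \<mu> \<mu>\<^sub>b) *
      (sqrt (coeff_gamma \<Xi> \<theta> \<mu> \<mu>\<^sub>b) * sqrt (\<Sum>T\<in>\<T>. (eta_nc \<tau> lam \<kappa> T p\<^sub>h s \<mu>\<^sub>b)\<^sup>2)
       + sqrt (\<Sum>T\<in>\<T>. (eta_r \<Omega> f (C\<^sub>P T) (c_coarse \<P> lam \<kappa> sub T) T v)\<^sup>2)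
       + 1 / sqrt (coeff_alpha \<Xi> \<theta> \<mu> \<mu>\<^sub>h) * sqrt (\<Sum>T\<in>\<T>. (eta_df \<tau> lam \<kappa> \<mu> T p\<^sub>h v \<mu>\<^sub>h)\<^sup>2))"
proof -
  interpret diffusion_mesh \<Omega> \<tau> \<T> sub \<P> lam \<kappa>
    by unfold_locales (use domain fine coarse lam kappa lam_kappa c_pos in blast)+
  define \<alpha>\<^sub>b where "\<alpha>\<^sub>b = coeff_alpha \<Xi> \<theta> \<mu> \<mu>\<^sub>b"
  define \<alpha>\<^sub>h where "\<alpha>\<^sub>h = coeff_alpha \<Xi> \<theta> \<mu> \<mu>\<^sub>h"
  define \<gamma> where "\<gamma> = coeff_gamma \<Xi> \<theta> \<mu> \<mu>\<^sub>b"
  have alpha_pos: "0 < coeff_alpha \<Xi> \<theta> \<mu> \<nu>" if "\<nu> \<in> \<P>" for \<nu>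
    unfolding coeff_alpha_def using affine(1,2) params(1) that by (subst Min_gr_iff) auto
  have \<alpha>: "0 < \<alpha>\<^sub>b" "0 < \<alpha>\<^sub>h" using alpha_pos params by (simp_all add: \<alpha>\<^sub>b_def \<alpha>\<^sub>h_def)
  let ?G = "broken_grad \<tau>"
  \<comment> \<open>These are differences of gradients, not gradients of differences, so that
    \<open>w\<close> is the sum of \<open>e\<close> and \<open>a\<close> at every point; the scalar
    function \<phi> is kept separately for the weak equation.\<close>
  define e where "e x = ?G p x - ?G p\<^sub>h x" for x
  define a where "a x = ?G p\<^sub>h x - ?G s x" for x
  define w where "w x = ?G p x - ?G s x" for x
  define \<phi> where "\<phi> x = p x - s x" for x
  note H1 = H10_H1[OF solution(1)] H10_H1[OF s]
  have \<phi>: "\<phi> \<in> H10 \<Omega>"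
    unfolding \<phi>_def using open_domain domain_lmeasurable solution(1) s by (rule H10_diff)
  note broken = H1_broken_H1[OF H1(1)] H1_broken_H1[OF H1(2)] p\<^sub>h H1_broken_H1[OF H10_H1[OF \<phi>]]
  note G_L2 = broken[THEN broken_grad_L2]
  have L2: "e \<in> L2 \<Omega>" "a \<in> L2 \<Omega>" "w \<in> L2 \<Omega>"
    unfolding e_def a_def w_def by (intro L2_diff G_L2)+
  have Gw: "AE x in lebesgue_on \<Omega>. ?G \<phi> x = w x"
    unfolding \<phi>_def w_def by (rule broken_grad_diff(2)[OF broken(1,2)])
  have gw: "AE x in lebesgue_on \<Omega>. weak_grad \<Omega> \<phi> x = w x"
    using broken_grad_H1[OF H10_H1[OF \<phi>]] Gw by eventually_elim simp
  have energy_w: "energy \<mu> \<Omega> (weak_grad \<Omega> \<phi>) = energy \<mu> \<Omega> w"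
    using params(1) weak_grad_L2[OF H10_H1[OF \<phi>]] L2(3) gw by (rule energy_cong)

  let ?R = "sqrt (\<Sum>T\<in>\<T>. (eta_r \<Omega> f (C\<^sub>P T) (c_coarse \<P> lam \<kappa> sub T) T v)\<^sup>2)"
  let ?D = "sqrt (\<Sum>T\<in>\<T>. (eta_df \<tau> lam \<kappa> \<mu> T p\<^sub>h v \<mu>\<^sub>h)\<^sup>2)"
  let ?W = "sqrt (energy \<mu> \<Omega> w)"
  let ?B = "\<lambda>g h. L2_inner \<Omega> (\<lambda>x. tensor \<mu> x *v g x) h"

  obtain d where "is_weak_divergence \<Omega> v d" using v(1) by (auto simp: Hdiv_def)
  then have div: "is_weak_divergence \<Omega> v (weak_div \<Omega> v)"
    unfolding weak_div_def using someI[of "is_weak_divergence \<Omega> v"] by blast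
  have vL2: "v \<in> L2 \<Omega>" using v(1) by (simp add: Hdiv_def)
  have divL2: "weak_div \<Omega> v \<in> L2 \<Omega>" using div by (simp add: is_weak_divergence_def)
  define r where "r x = f x - weak_div \<Omega> v x" for x
  have r_eq: "r = (\<lambda>x. f x - weak_div \<Omega> v x)" by (simp add: r_def fun_eq_iff)
  have r: "r \<in> L2 \<Omega>" unfolding r_def using f(1) divL2 by (rule L2_diff)
  define z where "z x = tensor \<mu> x *v ?G p\<^sub>h x + v x" for x
  have z: "z \<in> L2 \<Omega>" unfolding z_def by (intro L2_add tensor_L2 params(1) G_L2 vL2)

  \<comment> \<open>The weak equation replaces the term with the gradient of \<open>p\<close> by the
    load. The Green formula allows the flux \<open>v\<close> to be added to the discrete flux while
    its divergence is subtracted from \<open>f\<close>.\<close>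
  have Bew_eq: "?B e w = L2_inner \<Omega> r \<phi> - L2_inner \<Omega> z w"
  proof -
    have "?B e w = ?B (?G p) w - ?B (?G p\<^sub>h) w"
      unfolding e_def matrix_vector_mult_diff_distrib
      by (intro L2_inner_diff tensor_L2 params(1) G_L2 L2)
    moreover have "?B (?G p) w = L2_inner \<Omega> f \<phi>"
    proof -
      have "?B (?G p) w = ?B (?G p) (?G \<phi>)"
        by (intro L2_inner_cong tensor_L2 params(1) G_L2 L2) (use Gw in \<open>auto elim: eventually_mono\<close>)
      also have "\<dots> = (\<Sum>T\<in>\<T>. L2_inner T (\<lambda>x. tensor \<mu> x *v ?G p x) (?G \<phi>))"
        by (intro sum_L2_inner_coarse[symmetric] tensor_L2 params(1) G_L2)
      also have "\<dots> = b_form \<tau> \<T> lam \<kappa> p \<phi> \<mu>"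
        by (simp add: b_form_def b_loc_def L2_inner_def)
      finally show ?thesis using solution(2)[OF \<phi>] by simp
    qed
    moreover have "L2_inner \<Omega> v w = - L2_inner \<Omega> (weak_div \<Omega> v) \<phi>"
    proof -
      have "L2_inner \<Omega> v w = L2_inner \<Omega> v (weak_grad \<Omega> \<phi>)"
        by (intro L2_inner_cong vL2 L2 weak_grad_L2 H10_H1 \<phi>) (use gw in \<open>auto elim: eventually_mono\<close>)
      then show ?thesis
        using weak_divergence_H10[OF open_domain domain_lmeasurable vL2 div \<phi>] by simp
    qed
    moreover have "L2_inner \<Omega> z w = ?B (?G p\<^sub>h) w + L2_inner \<Omega> v w"
      using L2_inner_integrable[OF tensor_L2[OF params(1) G_L2(3)] L2(3)] L2_inner_integrable[OF vL2 L2(3)]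
      by (simp add: L2_inner_def z_def inner_add_left)
    moreover have "L2_inner \<Omega> r \<phi> = L2_inner \<Omega> f \<phi> - L2_inner \<Omega> (weak_div \<Omega> v) \<phi>"
      unfolding r_def by (intro L2_inner_diff f(1) divL2 H1_L2 H10_H1 \<phi>)
    ultimately show ?thesis by linarith
  qed
  have residual: "L2_inner \<Omega> r \<phi> \<le> ?R * ?W"
  proof -
    have "L2_inner \<Omega> r \<phi> = (\<Sum>T\<in>\<T>. L2_inner T r \<phi>)"
      by (intro sum_L2_inner_coarse[symmetric] r H1_L2 H10_H1 \<phi>)
    \<comment> \<open>The absolute values match the discrete Cauchy-Schwarz inequality
      \<open>L2_set_mult_ineq\<close>, which separates the estimators from the local
      energies.\<close>
    also have "\<dots> \<le> (\<Sum>T\<in>\<T>. \<bar>eta_r \<Omega> f (C\<^sub>P T) (c_coarse \<P> lam \<kappa> sub T) T v\<bar>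
        * \<bar>sqrt (energy \<mu> T (weak_grad \<Omega> \<phi>))\<bar>)"
    proof (rule sum_mono)
      fix T assume T: "T \<in> \<T>"
      have "L2_inner T r (\<lambda>_. 1) = 0"
        unfolding r_def using v(2)[OF T] L2_const[OF coarse_lmeasurable[OF T], of 1]
        by (subst L2_inner_diff(1)) (auto intro: L2_coarse[OF T] f(1) divL2)
      from residual_le[OF T params(1) r this H10_H1[OF \<phi>] poincare[OF T]]
      have "L2_inner T r \<phi> \<le> eta_r \<Omega> f (C\<^sub>P T) (c_coarse \<P> lam \<kappa> sub T) T v
          * sqrt (energy \<mu> T (weak_grad \<Omega> \<phi>))"
        by (simp add: eta_r_def r_eq)
      also have "\<dots> \<le> \<bar>\<dots>\<bar>" by (rule abs_ge_self)
      finally show "L2_inner T r \<phi> \<le> \<bar>eta_r \<Omega> f (C\<^sub>P T) (c_coarse \<P> lam \<kappa> sub T) T v\<bar>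
          * \<bar>sqrt (energy \<mu> T (weak_grad \<Omega> \<phi>))\<bar>" by (simp only: abs_mult)
    qed
    also have "\<dots> \<le> ?R * sqrt (\<Sum>T\<in>\<T>. (sqrt (energy \<mu> T (weak_grad \<Omega> \<phi>)))\<^sup>2)"
      using L2_set_mult_ineq unfolding L2_set_def .
    also have "(\<Sum>T\<in>\<T>. (sqrt (energy \<mu> T (weak_grad \<Omega> \<phi>)))\<^sup>2) = energy \<mu> \<Omega> w"
      using energy_ge_0(2)[OF params(1)] sum_energy[OF params(1) weak_grad_L2[OF H10_H1[OF \<phi>]]] energy_w
      by simp
    finally show ?thesis .
  qed
  have flux: "- L2_inner \<Omega> z w \<le> ?D * (1 / sqrt \<alpha>\<^sub>h * ?W)"
  proof -
    have "- L2_inner \<Omega> z w = (\<Sum>T\<in>\<T>. - L2_inner T z w)"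
      using sum_L2_inner_coarse[OF z L2(3)] by (simp add: sum_negf)
    also have "\<dots> \<le> (\<Sum>T\<in>\<T>. \<bar>eta_df \<tau> lam \<kappa> \<mu> T p\<^sub>h v \<mu>\<^sub>h\<bar> * \<bar>sqrt (energy \<mu>\<^sub>h T w)\<bar>)"
    proof (rule sum_mono)
      fix T assume T: "T \<in> \<T>"
      have "- L2_inner T z w \<le> \<bar>L2_inner T z w\<bar>" by simp
      also have "\<dots> \<le> \<bar>eta_df \<tau> lam \<kappa> \<mu> T p\<^sub>h v \<mu>\<^sub>h\<bar> * \<bar>sqrt (energy \<mu>\<^sub>h T w)\<bar>"
        using L2_inner_le_matrix_inv_sqrt[OF T params(3) z L2(3)] energy_ge_0(2)[OF params(3) T]
        by (simp add: eta_df_def z_def)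
      finally show "- L2_inner T z w \<le> \<bar>eta_df \<tau> lam \<kappa> \<mu> T p\<^sub>h v \<mu>\<^sub>h\<bar> * \<bar>sqrt (energy \<mu>\<^sub>h T w)\<bar>" .
    qed
    also have "\<dots> \<le> ?D * sqrt (\<Sum>T\<in>\<T>. (sqrt (energy \<mu>\<^sub>h T w))\<^sup>2)"
      using L2_set_mult_ineq unfolding L2_set_def .
    also have "(\<Sum>T\<in>\<T>. (sqrt (energy \<mu>\<^sub>h T w))\<^sup>2) = energy \<mu>\<^sub>h \<Omega> w"
      using energy_ge_0(2)[OF params(3)] sum_energy[OF params(3) L2(3)] by simp
    finally have le: "- L2_inner \<Omega> z w \<le> ?D * sqrt (energy \<mu>\<^sub>h \<Omega> w)" .
    \<comment> \<open>Origin of \<open>1 / sqrt \<alpha>\<^sub>h\<close>: the weighted flux estimate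
      produces the energy of \<open>w\<close> at \<open>\<mu>\<^sub>h\<close>, whereas the energy
      identity supplies it at \<mu>.\<close>
    have "sqrt (energy \<mu>\<^sub>h \<Omega> w) \<le> 1 / sqrt \<alpha>\<^sub>h * ?W"
    proof -
      have "\<alpha>\<^sub>h * energy \<mu>\<^sub>h \<Omega> w \<le> 1 * energy \<mu> \<Omega> w"
        using param_equiv[OF params(1,3)] unfolding \<alpha>\<^sub>h_def
        by (intro energy_mono params L2) (auto elim: eventually_mono)
      then have "energy \<mu>\<^sub>h \<Omega> w \<le> energy \<mu> \<Omega> w / \<alpha>\<^sub>h" using \<alpha> by (simp add: field_simps)
      from real_sqrt_le_mono[OF this] show ?thesis by (simp add: real_sqrt_divide)
    qed
    then show ?thesis by (intro order_trans[OF le] mult_left_mono) (simp_all add: sum_nonneg)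
  qed
  have "(?R + 1 / sqrt \<alpha>\<^sub>h * ?D) * ?W = ?R * ?W + ?D * (1 / sqrt \<alpha>\<^sub>h * ?W)"
    by (simp add: algebra_simps)
  with Bew_eq residual flux have Bew: "?B e w \<le> (?R + 1 / sqrt \<alpha>\<^sub>h * ?D) * ?W"
    by linarith

  have "energy \<mu> \<Omega> a = energy \<mu> \<Omega> e - 2 * ?B e w + energy \<mu> \<Omega> w"
  proof -
    \<comment> \<open>The two mixed terms in the expansion of the energy of \<open>w - e\<close>
      coincide because the tensor is symmetric almost everywhere.\<close>
    have sym: "?B w e = ?B e w"
    proof -
      obtain c C where "AE x in lebesgue_on \<Omega>. 0 < lam \<mu> x \<and> symmetric_matrix (tensor \<mu> x) \<and>
        (\<forall>y. c * (norm y)\<^sup>2 \<le> y \<bullet> (tensor \<mu> x *v y) \<and> y \<bullet> (tensor \<mu> x *v y) \<le> C * (norm y)\<^sup>2)"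
        using tensor_bounds[OF params(1)] by blast
      then have "AE x in lebesgue_on \<Omega>. (tensor \<mu> x *v w x) \<bullet> e x = (tensor \<mu> x *v e x) \<bullet> w x"
        by eventually_elim (metis symmetric_matrix_inner inner_commute)
      then show ?thesis
        unfolding L2_inner_def
        by (intro integral_cong_AE borel_measurable_integrable L2_inner_integrable tensor_L2 params L2)
    qed
    have "energy \<mu> \<Omega> a = energy \<mu> \<Omega> (\<lambda>x. w x - e x)"
      by (rule arg_cong[where f = "energy \<mu> \<Omega>"]) (simp add: fun_eq_iff a_def w_def e_def)
    also have "\<dots> = ?B w w - ?B e w - (?B w e - ?B e e)"
      unfolding energy_def matrix_vector_mult_diff_distrib
      by (simp add: L2_inner_diff L2_diff tensor_L2 params(1) L2)
    finally show ?thesis using sym by (simp add: energy_def)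
  qed
  then have "energy \<mu> \<Omega> e \<le> (sqrt (energy \<mu> \<Omega> a))\<^sup>2 + (?R + 1 / sqrt \<alpha>\<^sub>h * ?D)\<^sup>2"
  proof -
    \<comment> \<open>Young's inequality; the square of \<open>?W\<close> cancels against the energy
      of \<open>w\<close> subtracted by the identity.\<close>
    have "2 * ((?R + 1 / sqrt \<alpha>\<^sub>h * ?D) * ?W) \<le> (?R + 1 / sqrt \<alpha>\<^sub>h * ?D)\<^sup>2 + ?W\<^sup>2"
      using sum_squares_bound[of "?R + 1 / sqrt \<alpha>\<^sub>h * ?D" ?W] by (simp only: mult.assoc)
    moreover have "?W\<^sup>2 = energy \<mu> \<Omega> w" "(sqrt (energy \<mu> \<Omega> a))\<^sup>2 = energy \<mu> \<Omega> a"
      using energy_ge_0(1)[OF params(1)] by simp_all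
    ultimately show ?thesis
      using \<open>energy \<mu> \<Omega> a = _\<close> Bew by linarith
  qed
  \<comment> \<open>A sum of squares is at most the square of the sum, as both terms are
    nonnegative.\<close>
  also have "\<dots> \<le> (sqrt (energy \<mu> \<Omega> a) + (?R + 1 / sqrt \<alpha>\<^sub>h * ?D))\<^sup>2"
    using \<alpha> energy_ge_0(1)[OF params(1), of a]
    by (simp add: power2_sum sum_nonneg)
  finally have main: "sqrt (energy \<mu> \<Omega> e) \<le> sqrt (energy \<mu> \<Omega> a) + (?R + 1 / sqrt \<alpha>\<^sub>h * ?D)"
    using \<alpha> energy_ge_0(1)[OF params(1), of a] by (intro real_le_lsqrt) (auto simp: sum_nonneg)

  have error: "energy_norm \<tau> \<T> lam \<kappa> \<mu>\<^sub>b (\<lambda>x. p x - p\<^sub>h x) = sqrt (energy \<mu>\<^sub>b \<Omega> e)"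
    unfolding energy_norm_def
    using sum_energy_norm_loc[OF params(2) broken_grad_diff(1)[OF broken(1,3)] L2(1)]
      broken_grad_diff(2)[OF broken(1,3)] by (simp add: e_def)
  have nonconformity: "(\<Sum>T\<in>\<T>. (eta_nc \<tau> lam \<kappa> T p\<^sub>h s \<mu>\<^sub>b)\<^sup>2) = energy \<mu>\<^sub>b \<Omega> a"
    unfolding eta_nc_def
    using sum_energy_norm_loc[OF params(2) broken_grad_diff(1)[OF broken(3,2)] L2(2)]
      broken_grad_diff(2)[OF broken(3,2)] by (simp add: a_def)
  \<comment> \<open>The error passes from \<mu> to \<open>\<mu>\<^sub>b\<close>, which produces the
    common factor in front.\<close>
  have "\<alpha>\<^sub>b * energy \<mu>\<^sub>b \<Omega> e \<le> 1 * energy \<mu> \<Omega> e"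
    using param_equiv[OF params(1,2)] unfolding \<alpha>\<^sub>b_def
    by (intro energy_mono params L2) (auto elim: eventually_mono)
  then have "energy \<mu>\<^sub>b \<Omega> e \<le> energy \<mu> \<Omega> e / \<alpha>\<^sub>b" using \<alpha> by (simp add: field_simps)
  from real_sqrt_le_mono[OF this]
  have "sqrt (energy \<mu>\<^sub>b \<Omega> e) \<le> 1 / sqrt \<alpha>\<^sub>b * sqrt (energy \<mu> \<Omega> e)" by (simp add: real_sqrt_divide)
  also have "\<dots> \<le> 1 / sqrt \<alpha>\<^sub>b * (sqrt (energy \<mu> \<Omega> a) + (?R + 1 / sqrt \<alpha>\<^sub>h * ?D))"
    using \<alpha> by (intro mult_left_mono main) simp
  also have "\<dots> \<le> 1 / sqrt \<alpha>\<^sub>b * (sqrt \<gamma> * sqrt (energy \<mu>\<^sub>b \<Omega> a) + (?R + 1 / sqrt \<alpha>\<^sub>h * ?D))"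
  \<comment> \<open>Only the nonconformity term returns to \<open>\<mu>\<^sub>b\<close>, through the
    upper comparison constant.\<close>
  proof -
    have "1 * energy \<mu> \<Omega> a \<le> \<gamma> * energy \<mu>\<^sub>b \<Omega> a"
      using param_equiv[OF params(1,2)] unfolding \<gamma>_def
      by (intro energy_mono params L2) (auto elim: eventually_mono)
    then have "sqrt (energy \<mu> \<Omega> a) \<le> sqrt \<gamma> * sqrt (energy \<mu>\<^sub>b \<Omega> a)"
      unfolding real_sqrt_mult[symmetric] by simp
    then show ?thesis using \<alpha> by (intro mult_left_mono add_right_mono) simp_all
  qed
  finally show ?thesis
    unfolding error nonconformity \<alpha>\<^sub>b_def \<alpha>\<^sub>h_def \<gamma>_def add.assoc .
qed

end
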